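(* Assume (G1), (G2), (SP1) and (SP2). Then as $n\to\infty$, $$\frac{U_n(\rho)}{\sqrt{\mathrm{Var}(U_n(\rho))}}\to N(0,1)\quad\text{and}\quad \mathrm{SNR}\cdot(\hat\rho^*-\rho)=\frac{\mathbb E[Q_n(a)]}{\sqrt{\mathrm{Var}(U_n(\rho))}}(\hat\rho^*-\rho)\to N(0,1)\qquad\text{in law}.$$
   Context: Asymptotic framework: $n\to\infty$ and all parameters may depend on $n$; $a_n\asymp b_n$ means $c_0\le a_n/b_n\le c_1$ for constants $c_1>c_0>0$ and all large $n$. $(x,y)$ is the inner product, $\|x\|_1$ the $\ell^1$ norm, $x_{\max}$ the largest entry. The $p_1$ model: a directed network on nodes $\{1,\dots,n\}$ has adjacency matrix $A\in\{0,1\}^{n\times n}$ with $A_{ii}=0$. The pairs $(A_{ij},A_{ji})$, $1\le i<j\le n$, are independent, and for parameters $\theta=(\rho,\gamma,\alpha_1,\beta_1,\dots,\alpha_n,\beta_n)$ with $\sum_i\alpha_i=\sum_i\beta_i=0$, for $a,b\in\{0,1\}$, $i\ne j$: $\mathbb P(A_{ij}=a,A_{ji}=b)=K_{ij}\exp(a(\gamma+\alpha_i+\beta_j)+b(\gamma+\alpha_j+\beta_i)+ab\rho)$, $K_{ij}=[1+e^{\gamma+\alpha_i+\beta_j}+e^{\gamma+\alpha_j+\beta_i}+e^{2\gamma+\alpha_i+\beta_j+\alpha_j+\beta_i+\rho}]^{-1}$. Let $\mu_i=e^{\gamma/2+\alpha_i}$, $\nu_i=e^{\gamma/2+\beta_i}$,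 $\eta_i=\mu_i\nu_i$. Let $\tilde J_n$ be the all-ones matrix minus identity, $\circ$ entrywise product; $A^{11}=A\circ A'$, $A^{00}=(\tilde J_n-A)\circ(\tilde J_n-A')$, $A^{10}=A\circ(\tilde J_n-A')$, $A^{01}=(A^{10})'$. $Q_n(a)=\sum_{i,j,k,\ell\,(\mathrm{dist})}A^{11}_{ij}A^{00}_{jk}A^{01}_{k\ell}A^{00}_{\ell i}$, $Q_n(b)=\sum_{i,j,k,\ell\,(\mathrm{dist})}A^{10}_{ij}A^{10}_{jk}A^{00}_{k\ell}A^{10}_{\ell i}$ (sums over distinct indices); $U_n(\rho)=Q_n(a)-e^\rho Q_n(b)$; $\mathrm{SNR}=\mathbb E[Q_n(a)]/\sqrt{\mathrm{Var}(U_n(\rho))}$. With $H(x;t)=x$ if $|x|\le t$ and $\mathrm{sign}(x)t$ otherwise, $\hat\rho^*=H(\log(Q_n(a)/Q_n(b));2\log n)$. $\tilde\rho=\log(\|\eta\|_1^2/[(\mu,\eta)(\nu,\eta)])$. Conditions: (G1) $\mu_{\max}\to0$, $\nu_{\max}\to0$, $e^{\rho/2}\eta_{\max}\to0$. (G2) $e^{\rho/2}\|\eta\|_1\to\infty$ and $\|\eta\|_1\to\infty$. (SP1) $\mu_{\max}^2\nu_{\max}^2/[(\mu,\eta)(\nu,\eta)]\to0$. Case (L): $e^\rho\ge Ce^{\tilde\rho}$ for a constant $C>0$. (SP2) In Case (L) (and only there), $\|\mu\|_1\asymp\|\nu\|_1$. *)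

theory Defs
  imports "HOL-Probability.Probability"
begin

text \<open>Unnormalised weight of a dyad outcome (a,b) = (A_ij, A_ji), where
  x = gamma + alpha_i + beta_j, y = gamma + alpha_j + beta_i, r = rho.\<close>
definition dyad_w :: "real \<Rightarrow> real \<Rightarrow> real \<Rightarrow> bool \<times> bool \<Rightarrow> real" where
  "dyad_w x y r ab = exp ((if fst ab then x else 0) + (if snd ab then y else 0)
                          + (if fst ab \<and> snd ab then r else 0))"

definition dyad_pmf :: "real \<Rightarrow> real \<Rightarrow> real \<Rightarrow> (bool \<times> bool) pmf" where
  "dyad_pmf x y r = embed_pmf (\<lambda>ab. dyad_w x y r ab / (\<Sum>c\<in>UNIV. dyad_w x y r c))"

lemma dyad_w_pos: "dyad_w x y r ab > 0"
  by (simp add: dyad_w_def)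

lemma pmf_dyad_pmf:
  "pmf (dyad_pmf x y r) ab = dyad_w x y r ab / (\<Sum>c\<in>UNIV. dyad_w x y r c)"
proof -
  let ?S = "(\<Sum>c\<in>(UNIV :: (bool \<times> bool) set). dyad_w x y r c)"
  have Spos: "?S > 0" by (rule sum_pos) (auto simp: dyad_w_pos)
  have nn: "\<And>c. dyad_w x y r c / ?S \<ge> 0" using Spos dyad_w_pos[of x y r] by (simp add: less_imp_le)
  have "(\<integral>\<^sup>+ c. ennreal (dyad_w x y r c / ?S) \<partial>count_space UNIV) = ennreal (\<Sum>c\<in>UNIV. dyad_w x y r c / ?S)"
    by (subst nn_integral_count_space_finite) (auto simp: nn sum_nonneg)
  also have "(\<Sum>c\<in>UNIV. dyad_w x y r c / ?S) = 1"
    using Spos by (simp add: sum_divide_distrib[symmetric])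
  finally show ?thesis
    unfolding dyad_pmf_def by (subst pmf_embed_pmf) (use nn in auto)
qed

text \<open>Random adjacency matrix on nodes {0..<n} (node i of the paper is i-1 here).
  Dyads (A_ij, A_ji), i<j<n, are independent with law dyad_pmf; A_ii = 0 and
  all entries outside {0..<n} are 0.\<close>
definition p1_pmf :: "nat \<Rightarrow> real \<Rightarrow> real \<Rightarrow> (nat \<Rightarrow> real) \<Rightarrow> (nat \<Rightarrow> real)
                      \<Rightarrow> (nat \<Rightarrow> nat \<Rightarrow> bool) pmf" where
  "p1_pmf n \<rho> \<gamma> \<alpha> \<beta> =
     map_pmf (\<lambda>f i j. if i < j then fst (f (i, j)) else if j < i then snd (f (j, i)) else False)
       (Pi_pmf {(i, j). i < j \<and> j < n} (False, False)
          (\<lambda>(i, j). dyad_pmf (\<gamma> + \<alpha> i + \<beta> j) (\<gamma> + \<alpha> j + \<beta> i) \<rho>))"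

definition A11 :: "(nat \<Rightarrow> nat \<Rightarrow> bool) \<Rightarrow> nat \<Rightarrow> nat \<Rightarrow> real" where
  "A11 A i j = (if i \<noteq> j \<and> A i j \<and> A j i then 1 else 0)"
definition A00 :: "(nat \<Rightarrow> nat \<Rightarrow> bool) \<Rightarrow> nat \<Rightarrow> nat \<Rightarrow> real" where
  "A00 A i j = (if i \<noteq> j \<and> \<not> A i j \<and> \<not> A j i then 1 else 0)"
definition A10 :: "(nat \<Rightarrow> nat \<Rightarrow> bool) \<Rightarrow> nat \<Rightarrow> nat \<Rightarrow> real" where
  "A10 A i j = (if i \<noteq> j \<and> A i j \<and> \<not> A j i then 1 else 0)"
definition A01 :: "(nat \<Rightarrow> nat \<Rightarrow> bool) \<Rightarrow> nat \<Rightarrow> nat \<Rightarrow> real" where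
  "A01 A i j = A10 A j i"

definition distinct4 :: "nat \<Rightarrow> (nat \<times> nat \<times> nat \<times> nat) set" where
  "distinct4 n = {(i, j, k, l). i < n \<and> j < n \<and> k < n \<and> l < n \<and> distinct [i, j, k, l]}"

definition Qa :: "nat \<Rightarrow> (nat \<Rightarrow> nat \<Rightarrow> bool) \<Rightarrow> real" where
  "Qa n A = (\<Sum>(i, j, k, l)\<in>distinct4 n. A11 A i j * A00 A j k * A01 A k l * A00 A l i)"
definition Qb :: "nat \<Rightarrow> (nat \<Rightarrow> nat \<Rightarrow> bool) \<Rightarrow> real" where
  "Qb n A = (\<Sum>(i, j, k, l)\<in>distinct4 n. A10 A i j * A10 A j k * A00 A k l * A10 A l i)"

definition Ustat :: "nat \<Rightarrow> real \<Rightarrow> (nat \<Rightarrow> nat \<Rightarrow> bool) \<Rightarrow> real" where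
  "Ustat n \<rho> A = Qa n A - exp \<rho> * Qb n A"

definition trunc_H :: "real \<Rightarrow> real \<Rightarrow> real" where
  "trunc_H x t = (if \<bar>x\<bar> \<le> t then x else sgn x * t)"

text \<open>log(qa/qb) in the extended reals, then truncated at level t:
  log(0/positive) = -infinity, log(positive/0) = +infinity; 0/0 is set to 0.\<close>
definition trunc_log_ratio :: "real \<Rightarrow> real \<Rightarrow> real \<Rightarrow> real" where
  "trunc_log_ratio qa qb t =
     (if qa > 0 \<and> qb > 0 then trunc_H (ln (qa / qb)) t
      else if qa > 0 then t else if qb > 0 then - t else 0)"

definition rho_hat :: "nat \<Rightarrow> (nat \<Rightarrow> nat \<Rightarrow> bool) \<Rightarrow> real" where
  "rho_hat n A = trunc_log_ratio (Qa n A) (Qb n A) (2 * ln (real n))"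

end

theory Submission
  imports Defs
begin

text \<open>
  Write a dyad indicator as its mean plus a centred part. Expanding the products in Qa and Qb and
  discarding everything but the terms with one centred factor leaves a sum over independent dyads.
  Products of centred indicators over different sets of dyads are orthogonal, so the discarded
  terms are controlled by second moments: either two opposite edges of the cycle are centred, which
  already fixes all four vertices, or two adjacent ones are, with one free vertex.

  With h, m, v the sums of eta, mu, nu and p = (mu, eta), q = (nu, eta), a = exp rho, the linear
  part has variance of order M1 + M2, where M1 = a h^2 m^2 v^2 comes from reciprocal dyads and
  M2 = a^2 m^2 v^2 p q from asymmetric ones. The inequalities h^2 <= p v, h^2 <= q m,
  h <= m max nu, h <= v max mu show that everything else is o(M1 + M2). The coefficient of the
  indicator of the asymmetric dyad (x, y) is
  a (2 h^2 - (h + mu_y v)(h + nu_x m)); its two brackets have mean 2h under the weights nu_y, mu_x,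
  so it cannot cancel in mean square. By (SP1) the summands are uniformly small, so Lindeberg's
  central limit theorem applies.
  The second claim follows from log(Qa / Qb) - rho = - log(1 - U / Qa).
\<close>


section \<open>Independent coordinates and weak convergence\<close>

text \<open>All estimates are made at one fixed \<open>n\<close> with explicit constants; the limit
  is taken only in the final theorem. The normaliser is the exact standard deviation of U, so E(U -
  lin)^2 has to be small against the true variance of \<open>lin\<close>, and an upper bound of the
  right order would not do: this is why a lower bound for that variance takes so much room. Three
  points make the bookkeeping close. The means of \<open>Qa\<close> and exp rho times
  \<open>Qb\<close> agree term by term, so U is centred. An edge required to be empty has
  probability near 1, and its linear terms in \<open>Qa\<close> are negligible only because the
  variance of its indicator is at most 1 - K. Finally, sums over distinct pairs lack the diagonal;
  when the squared coefficients are summed, the diagonal contains the sum of eta^3, and (SP1) makes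
  it negligible. This is a second use of that condition, besides the uniform smallness of the
  summands.\<close>

lemma expectation_prod_Pi_pmf_subset:
  fixes p :: "'d \<Rightarrow> 's::finite pmf" and g :: "'d \<Rightarrow> 's \<Rightarrow> real"
  assumes "finite D" "E \<subseteq> D"
  shows "measure_pmf.expectation (Pi_pmf D dflt p) (\<lambda>f. \<Prod>d\<in>E. g d (f d))
       = (\<Prod>d\<in>E. measure_pmf.expectation (p d) (g d))"
proof -
  have fE: "finite E" using assms finite_subset by auto
  have "prob_space.indep_vars (measure_pmf (Pi_pmf D dflt p)) (\<lambda>_. count_space UNIV) (\<lambda>x f. f x) D"
    by (rule indep_vars_Pi_pmf[OF assms(1)])
  hence i: "prob_space.indep_vars (measure_pmf (Pi_pmf D dflt p)) (\<lambda>_. count_space UNIV) (\<lambda>x f. f x) E"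
    by (rule prob_space.indep_vars_subset[OF prob_space_measure_pmf _ assms(2)])
  have i2: "prob_space.indep_vars (measure_pmf (Pi_pmf D dflt p)) (\<lambda>_. borel) (\<lambda>x f. g x (f x)) E"
    by (rule prob_space.indep_vars_compose2[OF prob_space_measure_pmf i]) auto
  \<comment> \<open>Integrability is automatic on a finite state space: \<open>g d\<close> is
    bounded by the largest of its finitely many values.\<close>
  have int: "integrable (measure_pmf (Pi_pmf D dflt p)) (\<lambda>f. g d (f d))" for d
    by (rule measure_pmf.integrable_const_bound[where B="Max (range (\<lambda>s. \<bar>g d s\<bar>))"]) auto
  have "measure_pmf.expectation (Pi_pmf D dflt p) (\<lambda>f. \<Prod>d\<in>E. g d (f d))
     = (\<Prod>d\<in>E. measure_pmf.expectation (Pi_pmf D dflt p) (\<lambda>f. g d (f d)))"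
    by (rule prob_space.indep_vars_lebesgue_integral[OF prob_space_measure_pmf fE i2 int])
  also have "\<dots> = (\<Prod>d\<in>E. measure_pmf.expectation (p d) (g d))"
  proof (rule prod.cong)
    fix d assume "d \<in> E"
    hence d: "d \<in> D" using assms by auto
    have "measure_pmf.expectation (Pi_pmf D dflt p) (\<lambda>f. g d (f d))
       = measure_pmf.expectation (map_pmf (\<lambda>f. f d) (Pi_pmf D dflt p)) (g d)" by simp
    also have "map_pmf (\<lambda>f. f d) (Pi_pmf D dflt p) = p d"
      using d assms(1) by (subst Pi_pmf_component) auto
    finally show "measure_pmf.expectation (Pi_pmf D dflt p) (\<lambda>f. g d (f d))
       = measure_pmf.expectation (p d) (g d)" .
  qed simp
  finally show ?thesis .
qed

lemma finite_set_Pi_pmf: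
  fixes p :: "'d \<Rightarrow> 's::finite pmf"
  assumes "finite D"
  shows "finite (set_pmf (Pi_pmf D dflt p))"
proof (rule finite_subset)
  show "set_pmf (Pi_pmf D dflt p) \<subseteq> PiE_dflt D dflt (\<lambda>_. UNIV)"
    using set_Pi_pmf_subset[OF assms, of dflt p] by (auto simp: PiE_dflt_def)
  show "finite (PiE_dflt D dflt (\<lambda>_. UNIV :: 's set))"
    by (rule finite_PiE_dflt) (use assms in auto)
qed

lemma integrable_Pi_pmf:
  fixes p :: "'d \<Rightarrow> 's::finite pmf" and h :: "('d \<Rightarrow> 's) \<Rightarrow> real"
  assumes "finite D"
  shows "integrable (measure_pmf (Pi_pmf D dflt p)) h"
  by (rule integrable_measure_pmf_finite[OF finite_set_Pi_pmf[OF assms]])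

text \<open>Two terms are correlated only if the centred coordinates \<open>S\<close> of each lie
  among the coordinates \<open>E\<close> of the other; otherwise a centred factor stands alone and
  kills the expectation. The surviving covariances are bounded by AM-GM, so only the number
  \<open>N\<close> of partners of a term matters. Factors outside \<open>S\<close> may be arbitrary,
  which later allows products that mix centred and raw indicators.\<close>

lemma orthogonal_second_moment:
  fixes p :: "'d \<Rightarrow> 's::finite pmf" and g :: "'t \<Rightarrow> 'd \<Rightarrow> 's \<Rightarrow> real"
  assumes D: "finite D" and T: "finite T"
    and E: "\<And>t. t \<in> T \<Longrightarrow> E t \<subseteq> D"
    and S: "\<And>t. t \<in> T \<Longrightarrow> S t \<subseteq> E t"
    and centered: "\<And>t d. t \<in> T \<Longrightarrow> d \<in> S t \<Longrightarrow> measure_pmf.expectation (p d) (g t d) = 0"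
    and N: "\<And>t. t \<in> T \<Longrightarrow> card {t'\<in>T. S t \<subseteq> E t' \<and> S t' \<subseteq> E t} \<le> N"
  shows "measure_pmf.expectation (Pi_pmf D dflt p)
            (\<lambda>f. (\<Sum>t\<in>T. w t * (\<Prod>d\<in>E t. g t d (f d)))\<^sup>2)
      \<le> real N * (\<Sum>t\<in>T. (w t)\<^sup>2 * (\<Prod>d\<in>E t. measure_pmf.expectation (p d) (\<lambda>s. (g t d s)\<^sup>2)))"
proof -
  let ?P = "Pi_pmf D dflt p"
  let ?E = "measure_pmf.expectation ?P"
  define Y where "Y t f = w t * (\<Prod>d\<in>E t. g t d (f d))" for t and f :: "'d \<Rightarrow> 's"
  define R where "R = {(t, t'). t \<in> T \<and> t' \<in> T \<and> S t \<subseteq> E t' \<and> S t' \<subseteq> E t}"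
  define V where "V t = ?E (\<lambda>f. (Y t f)\<^sup>2)" for t
  have int: "integrable (measure_pmf ?P) h" for h :: "_ \<Rightarrow> real"
    by (rule integrable_Pi_pmf[OF D])
  have V: "V t = (w t)\<^sup>2 * (\<Prod>d\<in>E t. measure_pmf.expectation (p d) (\<lambda>s. (g t d s)\<^sup>2))" if "t \<in> T" for t
  proof -
    have "V t = ?E (\<lambda>f. (w t)\<^sup>2 * (\<Prod>d\<in>E t. (g t d (f d))\<^sup>2))"
      unfolding V_def Y_def by (simp add: power_mult_distrib prod_power_distrib)
    also have "\<dots> = (w t)\<^sup>2 * ?E (\<lambda>f. (\<Prod>d\<in>E t. (g t d (f d))\<^sup>2))" by simp
    also have "?E (\<lambda>f. (\<Prod>d\<in>E t. (g t d (f d))\<^sup>2)) = (\<Prod>d\<in>E t. measure_pmf.expectation (p d) (\<lambda>s. (g t d s)\<^sup>2))"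
      by (rule expectation_prod_Pi_pmf_subset[OF D E[OF that]])
    finally show ?thesis .
  qed
  have zero: "?E (\<lambda>f. Y t f * Y t' f) = 0" if t: "t \<in> T" "t' \<in> T" "\<not> S t \<subseteq> E t'" for t t'
  proof -
    obtain d0 where d0: "d0 \<in> S t" "d0 \<notin> E t'" using t by auto
    \<comment> \<open>The two products are merged into one over the union, with factor 1 where a
      coordinate is absent; independence then gives a product of expectations whose factor at
      \<open>d0\<close> is 0.\<close>
    define G where "G d s = (if d \<in> E t then g t d s else 1) * (if d \<in> E t' then g t' d s else 1)" for d s
    have fin: "finite (E t)" "finite (E t')" using E t D finite_subset by metis+
    have "Y t f * Y t' f = w t * w t' * (\<Prod>d\<in>E t \<union> E t'. G d (f d))" for f
    proof -
      have "(\<Prod>d\<in>E t \<union> E t'. if d \<in> E t then g t d (f d) else 1) = (\<Prod>d\<in>E t. g t d (f d))"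
        by (rule prod.mono_neutral_cong_right) (use fin in auto)
      moreover have "(\<Prod>d\<in>E t \<union> E t'. if d \<in> E t' then g t' d (f d) else 1) = (\<Prod>d\<in>E t'. g t' d (f d))"
        by (rule prod.mono_neutral_cong_right) (use fin in auto)
      ultimately show ?thesis unfolding Y_def G_def prod.distrib by simp
    qed
    hence "?E (\<lambda>f. Y t f * Y t' f) = w t * w t' * ?E (\<lambda>f. \<Prod>d\<in>E t \<union> E t'. G d (f d))" by simp
    also have "?E (\<lambda>f. \<Prod>d\<in>E t \<union> E t'. G d (f d)) = (\<Prod>d\<in>E t \<union> E t'. measure_pmf.expectation (p d) (G d))"
      by (rule expectation_prod_Pi_pmf_subset[OF D]) (use E t in auto)
    also have "\<dots> = 0"
    proof (rule prod_zero)
      show "finite (E t \<union> E t')" using fin by simp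
      have "d0 \<in> E t" using d0 S t by auto
      hence "G d0 = g t d0" using d0 by (auto simp: G_def)
      thus "\<exists>d\<in>E t \<union> E t'. measure_pmf.expectation (p d) (G d) = 0"
        using centered[OF t(1) d0(1)] \<open>d0 \<in> E t\<close> by (intro bexI[of _ d0]) auto
    qed
    finally show ?thesis by simp
  qed
  have amgm: "?E (\<lambda>f. Y t f * Y t' f) \<le> (V t + V t') / 2" for t t'
  proof -
    have "?E (\<lambda>f. Y t f * Y t' f) \<le> ?E (\<lambda>f. ((Y t f)\<^sup>2 + (Y t' f)\<^sup>2) / 2)"
    proof (rule integral_mono[OF int int])
      fix f show "Y t f * Y t' f \<le> ((Y t f)\<^sup>2 + (Y t' f)\<^sup>2) / 2"
        using sum_squares_bound[of "Y t f" "Y t' f"] by simp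
    qed
    also have "\<dots> = (V t + V t') / 2" unfolding V_def
      by (simp add: Bochner_Integration.integral_add[OF int int])
    finally show ?thesis .
  qed
  have Vnn: "V t \<ge> 0" for t unfolding V_def by (rule integral_nonneg_AE) auto
  have RT: "R \<subseteq> T \<times> T" by (auto simp: R_def)
  have fR: "finite R" using RT T finite_subset by blast
  have "?E (\<lambda>f. (\<Sum>t\<in>T. Y t f)\<^sup>2) = ?E (\<lambda>f. \<Sum>(t,t')\<in>T\<times>T. Y t f * Y t' f)"
    by (simp add: power2_eq_square sum_product sum.cartesian_product)
  also have "\<dots> = (\<Sum>(t,t')\<in>T\<times>T. ?E (\<lambda>f. Y t f * Y t' f))"
    by (subst Bochner_Integration.integral_sum[OF int]) (auto simp: case_prod_beta)
  also have "\<dots> = (\<Sum>(t,t')\<in>R. ?E (\<lambda>f. Y t f * Y t' f))"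
  proof (rule sum.mono_neutral_right)
    show "\<forall>i\<in>T \<times> T - R. (case i of (t, t') \<Rightarrow> ?E (\<lambda>f. Y t f * Y t' f)) = 0"
    proof safe
      fix t t' assume a: "t \<in> T" "t' \<in> T" "(t, t') \<notin> R"
      then consider "\<not> S t \<subseteq> E t'" | "\<not> S t' \<subseteq> E t" by (auto simp: R_def)
      thus "?E (\<lambda>f. Y t f * Y t' f) = 0"
      proof cases
        case 1 thus ?thesis using zero a by auto
      next
        case 2
        have "(\<lambda>f. Y t f * Y t' f) = (\<lambda>f. Y t' f * Y t f)" by (auto simp: mult.commute)
        thus ?thesis using zero[OF a(2) a(1) 2] by simp
      qed
    qed
  qed (use T RT in auto)
  also have "\<dots> \<le> (\<Sum>(t,t')\<in>R. (V t + V t') / 2)"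
    by (rule sum_mono) (auto intro: amgm)
  also have "\<dots> = ((\<Sum>(t,t')\<in>R. V t) + (\<Sum>(t,t')\<in>R. V t')) / 2"
    by (simp add: case_prod_beta sum_divide_distrib[symmetric] sum.distrib)
  \<comment> \<open>The relation \<open>R\<close> is symmetric, so both halves of the AM-GM bound
    have the same sum.\<close>
  also have "(\<Sum>(t,t')\<in>R. V t') = (\<Sum>(t,t')\<in>R. V t)"
    by (rule sum.reindex_bij_witness[where i="\<lambda>(a,b). (b,a)" and j="\<lambda>(a,b). (b,a)"]) (auto simp: R_def)
  also have "((\<Sum>(t,t')\<in>R. V t) + (\<Sum>(t,t')\<in>R. V t)) / 2 = (\<Sum>(t,t')\<in>R. V t)" by simp
  also have "\<dots> = (\<Sum>t\<in>T. real (card {t'\<in>T. S t \<subseteq> E t' \<and> S t' \<subseteq> E t}) * V t)"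
  proof -
    have "R = (SIGMA t:T. {t'\<in>T. S t \<subseteq> E t' \<and> S t' \<subseteq> E t})" by (auto simp: R_def)
    thus ?thesis using T by (simp add: sum.Sigma[symmetric])
  qed
  also have "\<dots> \<le> (\<Sum>t\<in>T. real N * V t)"
    by (rule sum_mono, rule mult_right_mono) (use N Vnn in auto)
  also have "\<dots> = real N * (\<Sum>t\<in>T. (w t)\<^sup>2 * (\<Prod>d\<in>E t. measure_pmf.expectation (p d) (\<lambda>s. (g t d s)\<^sup>2)))"
    by (simp add: sum_distrib_left V)
  finally show ?thesis unfolding Y_def .
qed

section \<open>Characteristic functions of sums of bounded independent variables\<close>

lemma abs_exp_minus_Taylor1:
  fixes u :: real assumes "u \<ge> 0"
  shows "\<bar>exp (-u) - (1 - u)\<bar> \<le> u\<^sup>2 / 2"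
proof -
  have e: "1 + u + u\<^sup>2 / 2 \<le> exp u" by (rule exp_lower_Taylor_quadratic[OF assms])
  have pos: "1 + u + u\<^sup>2/2 > 0" using assms by (simp add: add_nonneg_pos add_pos_nonneg)
  have "exp (-u) \<le> 1 / (1 + u + u\<^sup>2/2)"
    using e pos by (simp add: exp_minus field_simps)
  also have "\<dots> \<le> 1 - u + u\<^sup>2/2"
  proof -
    \<comment> \<open>The two quadratics multiply to 1 + u^4 / 4, so each dominates the reciprocal
      of the other.\<close>
    have "(1 - u + u\<^sup>2/2) * (1 + u + u\<^sup>2/2) = 1 + (u\<^sup>2)\<^sup>2/4" by (simp add: power2_eq_square algebra_simps)
    hence "1 \<le> (1 - u + u\<^sup>2/2) * (1 + u + u\<^sup>2/2)" by simp
    thus ?thesis using pos by (simp add: divide_le_eq)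
  qed
  finally have "exp (-u) \<le> 1 - u + u\<^sup>2/2" .
  moreover have "1 - u \<le> exp (-u)" using exp_ge_add_one_self[of "-u"] by simp
  ultimately show ?thesis by auto
qed

text \<open>Lindeberg's comparison in quantitative form. Each factor of the characteristic function
  is compared with the Gaussian factor of the same variance v; all factors have modulus at most 1,
  so the errors add. The third moment is at most \<open>\<epsilon>\<close> v, which gives the first
  error term; the Gaussian side costs t^4 v^2 / 8 with v at most \<open>\<epsilon>\<close> squared.
  Total variance 1 sums both.\<close>

lemma char_sum_Pi_pmf_approx:
  fixes p :: "'d \<Rightarrow> 's::finite pmf" and X :: "'d \<Rightarrow> 's \<Rightarrow> real"
  assumes D: "finite D"
    and mean: "\<And>d. d \<in> D \<Longrightarrow> measure_pmf.expectation (p d) (X d) = 0"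
    and bound: "\<And>d s. d \<in> D \<Longrightarrow> \<bar>X d s\<bar> \<le> \<epsilon>"
    and var: "(\<Sum>d\<in>D. measure_pmf.expectation (p d) (\<lambda>s. (X d s)\<^sup>2)) = 1"
  shows "cmod (char (distr (measure_pmf (Pi_pmf D dflt p)) borel (\<lambda>f. \<Sum>d\<in>D. X d (f d))) t
            - exp (- t\<^sup>2 / 2)) \<le> \<bar>t\<bar>^3 * \<epsilon> / 6 + t^4 * \<epsilon>\<^sup>2 / 8"
proof -
  let ?P = "Pi_pmf D dflt p"
  let ?v = "\<lambda>d. measure_pmf.expectation (p d) (\<lambda>s. (X d s)\<^sup>2)"
  have int: "integrable (measure_pmf (p d)) h" for d and h :: "'s \<Rightarrow> real"
    by (rule integrable_measure_pmf_finite) simp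
  have comp: "map_pmf (\<lambda>f. f d) ?P = p d" if "d \<in> D" for d
    using that D by (subst Pi_pmf_component) auto
  have i: "prob_space.indep_vars (measure_pmf ?P) (\<lambda>_. borel) (\<lambda>x f. X x (f x)) D"
    by (rule prob_space.indep_vars_compose2[OF prob_space_measure_pmf indep_vars_Pi_pmf[OF D]]) auto
  have char_eq: "char (distr (measure_pmf ?P) borel (\<lambda>f. \<Sum>d\<in>D. X d (f d))) t
      = (\<Prod>d\<in>D. char (distr (measure_pmf ?P) borel (\<lambda>f. X d (f d))) t)"
    by (rule prob_space.char_distr_sum[OF prob_space_measure_pmf i])
  have dd: "distr (measure_pmf ?P) borel (\<lambda>f. X d (f d)) = distr (measure_pmf (p d)) borel (X d)"
    if "d \<in> D" for d
    by (subst comp[OF that, symmetric]) (simp add: map_pmf_rep_eq distr_distr o_def)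
  have vnn: "?v d \<ge> 0" for d by (rule integral_nonneg_AE) auto
  have eps: "\<epsilon> \<ge> 0" if "D \<noteq> {}"
    using bound that by (meson abs_ge_zero all_not_in_conv order_trans)
  \<comment> \<open>Total variance 1 excludes an empty index set, and the bound on any one summand
    then forces \<open>\<epsilon>\<close> to be nonnegative.\<close>
  have Dne: "D \<noteq> {}" using var by auto
  note eps = eps[OF Dne]
  have vle: "?v d \<le> \<epsilon>\<^sup>2" if "d \<in> D" for d
  proof -
    have "?v d \<le> measure_pmf.expectation (p d) (\<lambda>_. \<epsilon>\<^sup>2)"
      by (rule integral_mono[OF int int]) (use bound[OF that] in \<open>simp add: abs_le_square_iff[symmetric] eps\<close>)
    thus ?thesis by simp
  qed
  have summand: "cmod (char (distr (measure_pmf (p d)) borel (X d)) t - exp (- (t\<^sup>2 * ?v d / 2)))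
     \<le> \<bar>t\<bar>^3 * \<epsilon> / 6 * ?v d + t^4 * \<epsilon>\<^sup>2 / 8 * ?v d" if d: "d \<in> D" for d
  proof -
    have a: "cmod (char (distr (measure_pmf (p d)) borel (X d)) t - (1 - t\<^sup>2 * ?v d / 2)) \<le>
       t\<^sup>2 / 6 * measure_pmf.expectation (p d) (\<lambda>x. min (6 * (X d x)\<^sup>2) (\<bar>t\<bar> * \<bar>X d x\<bar> ^ 3))"
      by (rule prob_space.char_approx3'[OF prob_space_measure_pmf, where X="X d"]) (use mean[OF d] in \<open>auto simp: int\<close>)
    have "measure_pmf.expectation (p d) (\<lambda>x. min (6 * (X d x)\<^sup>2) (\<bar>t\<bar> * \<bar>X d x\<bar> ^ 3))
       \<le> measure_pmf.expectation (p d) (\<lambda>x. \<bar>t\<bar> * \<epsilon> * (X d x)\<^sup>2)"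
    proof (rule integral_mono[OF int int])
      fix x
      have "\<bar>X d x\<bar> ^ 3 \<le> \<epsilon> * (X d x)\<^sup>2"
        using mult_right_mono[OF bound[OF d, of x], of "(X d x)\<^sup>2"]
        by (simp add: power3_eq_cube power2_eq_square mult.assoc[symmetric])
      hence "\<bar>t\<bar> * \<bar>X d x\<bar> ^ 3 \<le> \<bar>t\<bar> * (\<epsilon> * (X d x)\<^sup>2)" by (rule mult_left_mono) simp
      thus "min (6 * (X d x)\<^sup>2) (\<bar>t\<bar> * \<bar>X d x\<bar> ^ 3) \<le> \<bar>t\<bar> * \<epsilon> * (X d x)\<^sup>2"
        by (simp add: mult.assoc min.coboundedI2)
    qed
    also have "\<dots> = \<bar>t\<bar> * \<epsilon> * ?v d" by simp
    finally have "t\<^sup>2 / 6 * measure_pmf.expectation (p d) (\<lambda>x. min (6 * (X d x)\<^sup>2) (\<bar>t\<bar> * \<bar>X d x\<bar> ^ 3))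
       \<le> t\<^sup>2 / 6 * (\<bar>t\<bar> * \<epsilon> * ?v d)" by (rule mult_left_mono) simp
    also have "\<dots> = \<bar>t\<bar>^3 * \<epsilon> / 6 * ?v d"
      by (simp add: power3_eq_cube power2_eq_square)
    finally have a': "cmod (char (distr (measure_pmf (p d)) borel (X d)) t - (1 - t\<^sup>2 * ?v d / 2))
      \<le> \<bar>t\<bar>^3 * \<epsilon> / 6 * ?v d" using a by linarith
    have "\<bar>exp (- (t\<^sup>2 * ?v d / 2)) - (1 - t\<^sup>2 * ?v d / 2)\<bar> \<le> (t\<^sup>2 * ?v d / 2)\<^sup>2 / 2"
      by (rule abs_exp_minus_Taylor1) (use vnn in simp)
    also have "\<dots> = t^4 / 8 * ?v d * ?v d" by (simp add: power2_eq_square power4_eq_xxxx)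
    also have "\<dots> \<le> t^4 / 8 * ?v d * \<epsilon>\<^sup>2"
      by (rule mult_left_mono[OF vle[OF d]]) (use vnn in simp)
    finally have b: "\<bar>(1 - t\<^sup>2 * ?v d / 2) - exp (- (t\<^sup>2 * ?v d / 2))\<bar> \<le> t^4 * \<epsilon>\<^sup>2 / 8 * ?v d"
      by (simp add: mult.commute mult.left_commute abs_minus_commute)
    have "cmod (char (distr (measure_pmf (p d)) borel (X d)) t - exp (- (t\<^sup>2 * ?v d / 2)))
      \<le> cmod (char (distr (measure_pmf (p d)) borel (X d)) t - complex_of_real (1 - t\<^sup>2 * ?v d / 2))
       + cmod (complex_of_real (1 - t\<^sup>2 * ?v d / 2) - complex_of_real (exp (- (t\<^sup>2 * ?v d / 2))))"
      by (rule norm_diff_triangle_ineq[of _ "complex_of_real (1 - t\<^sup>2 * ?v d / 2)" "complex_of_real (1 - t\<^sup>2 * ?v d / 2)", simplified, THEN order_trans])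
         (simp add: norm_triangle_ineq)
    also have "cmod (complex_of_real (1 - t\<^sup>2 * ?v d / 2) - complex_of_real (exp (- (t\<^sup>2 * ?v d / 2))))
       = \<bar>(1 - t\<^sup>2 * ?v d / 2) - exp (- (t\<^sup>2 * ?v d / 2))\<bar>"
      by (simp only: of_real_diff[symmetric] norm_of_real)
    finally show ?thesis using a' b by simp
  qed
  have "exp (- t\<^sup>2 / 2) = (\<Prod>d\<in>D. exp (- (t\<^sup>2 * ?v d / 2)))"
  proof -
    have "(\<Prod>d\<in>D. exp (- (t\<^sup>2 * ?v d / 2))) = exp (\<Sum>d\<in>D. - (t\<^sup>2 * ?v d / 2))"
      by (simp add: exp_sum[OF D])
    also have "(\<Sum>d\<in>D. - (t\<^sup>2 * ?v d / 2)) = - t\<^sup>2 / 2 * (\<Sum>d\<in>D. ?v d)"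
      by (simp add: sum_distrib_left sum_negf)
    finally show ?thesis using var by simp
  qed
  hence ex: "complex_of_real (exp (- t\<^sup>2 / 2)) = (\<Prod>d\<in>D. complex_of_real (exp (- (t\<^sup>2 * ?v d / 2))))"
    by (simp only: of_real_prod)
  have "cmod (char (distr (measure_pmf ?P) borel (\<lambda>f. \<Sum>d\<in>D. X d (f d))) t - exp (- t\<^sup>2 / 2))
     = cmod ((\<Prod>d\<in>D. char (distr (measure_pmf (p d)) borel (X d)) t) - (\<Prod>d\<in>D. complex_of_real (exp (- (t\<^sup>2 * ?v d / 2)))))"
    unfolding char_eq ex by (simp add: dd)
  also have "\<dots> \<le> (\<Sum>d\<in>D. cmod (char (distr (measure_pmf (p d)) borel (X d)) t - complex_of_real (exp (- (t\<^sup>2 * ?v d / 2)))))"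
  proof (rule norm_prod_diff)
    fix d
    interpret rd: real_distribution "distr (measure_pmf (p d)) borel (X d)"
      by (rule prob_space.real_distribution_distr[OF prob_space_measure_pmf]) simp
    show "cmod (char (distr (measure_pmf (p d)) borel (X d)) t) \<le> 1" by (rule rd.cmod_char_le_1)
    show "cmod (complex_of_real (exp (- (t\<^sup>2 * ?v d / 2)))) \<le> 1"
      using vnn[of d] by (simp del: of_real_exp)
  qed
  also have "\<dots> \<le> (\<Sum>d\<in>D. \<bar>t\<bar>^3 * \<epsilon> / 6 * ?v d + t^4 * \<epsilon>\<^sup>2 / 8 * ?v d)"
    by (rule sum_mono) (rule summand)
  also have "\<dots> = \<bar>t\<bar>^3 * \<epsilon> / 6 + t^4 * \<epsilon>\<^sup>2 / 8"
    by (simp only: sum.distrib sum_distrib_left[symmetric] var mult_1_right)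
  finally show ?thesis .
qed

lemma clt_Pi_pmf:
  fixes D :: "nat \<Rightarrow> 'd set" and p :: "nat \<Rightarrow> 'd \<Rightarrow> 's::finite pmf" and X :: "nat \<Rightarrow> 'd \<Rightarrow> 's \<Rightarrow> real"
  assumes "\<forall>\<^sub>F n in sequentially. finite (D n)
      \<and> (\<forall>d\<in>D n. measure_pmf.expectation (p n d) (X n d) = 0 \<and> (\<forall>s. \<bar>X n d s\<bar> \<le> \<epsilon> n))
      \<and> (\<Sum>d\<in>D n. measure_pmf.expectation (p n d) (\<lambda>s. (X n d s)\<^sup>2)) = 1"
    and eps: "\<epsilon> \<longlonglongrightarrow> 0"
  shows "weak_conv_m (\<lambda>n. distr (measure_pmf (Pi_pmf (D n) dflt (p n))) borel (\<lambda>f. \<Sum>d\<in>D n. X n d (f d)))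
           std_normal_distribution"
proof (rule levy_continuity)
  fix t
  let ?c = "\<lambda>n. char (distr (measure_pmf (Pi_pmf (D n) dflt (p n))) borel (\<lambda>f. \<Sum>d\<in>D n. X n d (f d))) t"
  have "\<forall>\<^sub>F n in sequentially. norm (?c n - exp (- t\<^sup>2 / 2)) \<le> \<bar>t\<bar>^3 * \<epsilon> n / 6 + t^4 * (\<epsilon> n)\<^sup>2 / 8"
    using assms(1) by eventually_elim (rule char_sum_Pi_pmf_approx; blast)
  moreover have "(\<lambda>n. \<bar>t\<bar>^3 * \<epsilon> n / 6 + t^4 * (\<epsilon> n)\<^sup>2 / 8) \<longlonglongrightarrow> 0"
    by (auto intro!: tendsto_eq_intros eps)
  ultimately have "(\<lambda>n. ?c n - exp (- t\<^sup>2 / 2)) \<longlonglongrightarrow> 0"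
    by (rule Lim_null_comparison)
  hence "?c \<longlonglongrightarrow> exp (- t\<^sup>2 / 2)" by (rule LIM_zero_cancel)
  thus "?c \<longlonglongrightarrow> char std_normal_distribution t" by (simp add: char_std_normal_distribution)
qed (auto intro!: real_dist_normal_dist prob_space.real_distribution_distr[OF prob_space_measure_pmf])

lemma cmod_iexp_diff_le: "cmod (iexp a - iexp b) \<le> \<bar>a - b\<bar>"
proof -
  have "iexp a - iexp b = iexp b * (iexp (a - b) - 1)"
    by (simp add: exp_diff ring_distribs)
  hence "cmod (iexp a - iexp b) = cmod (iexp (a - b) - 1)"
    by (simp add: norm_mult)
  also have "\<dots> \<le> \<bar>a - b\<bar>" using iexp_approx1[of "a - b" 0] by simp
  finally show ?thesis .
qed

text \<open>Slutsky's lemma when the probability space varies with \<open>n\<close>. The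
  characteristic functions are compared on the common space \<open>M n\<close>: off the exceptional
  set the integrands differ by at most |t| \<open>\<delta>\<close>, on it by at most 2.\<close>

lemma slutsky_pmf:
  fixes M :: "nat \<Rightarrow> 'a pmf" and X Y :: "nat \<Rightarrow> 'a \<Rightarrow> real"
  assumes conv: "weak_conv_m (\<lambda>n. distr (measure_pmf (M n)) borel (X n)) N"
    and N: "real_distribution N"
    and diff: "\<And>\<delta>. \<delta> > 0 \<Longrightarrow> (\<lambda>n. measure_pmf.prob (M n) {x. \<bar>Y n x - X n x\<bar> > \<delta>}) \<longlonglongrightarrow> 0"
  shows "weak_conv_m (\<lambda>n. distr (measure_pmf (M n)) borel (Y n)) N"
proof (rule levy_continuity)
  fix t
  let ?c = "\<lambda>n. char (distr (measure_pmf (M n)) borel (X n)) t"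
  let ?d = "\<lambda>n. char (distr (measure_pmf (M n)) borel (Y n)) t"
  have c: "?c \<longlonglongrightarrow> char N t"
    by (rule levy_continuity1[OF _ N conv]) (auto intro: prob_space.real_distribution_distr[OF prob_space_measure_pmf])
  have bound: "cmod (?d n - ?c n) \<le> \<bar>t\<bar> * \<delta> + 2 * measure_pmf.prob (M n) {x. \<bar>Y n x - X n x\<bar> > \<delta>}"
    if "\<delta> > 0" for n \<delta>
  proof -
    let ?A = "{x. \<bar>Y n x - X n x\<bar> > \<delta>}"
    have int: "integrable (measure_pmf (M n)) (\<lambda>x. iexp (t * Z x))" for Z :: "'a \<Rightarrow> real"
      by (rule measure_pmf.integrable_const_bound[where B=1]) auto
    have intr: "integrable (measure_pmf (M n)) (\<lambda>x. \<bar>t\<bar> * \<delta> + 2 * indicator ?A x)"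
      by (intro Bochner_Integration.integrable_add integrable_mult_right integrable_real_indicator) (auto simp: measure_pmf.emeasure_eq_measure)
    have "?d n - ?c n = measure_pmf.expectation (M n) (\<lambda>x. iexp (t * Y n x) - iexp (t * X n x))"
      unfolding char_def by (subst Bochner_Integration.integral_diff[OF int int]) (simp add: integral_distr)
    also have "cmod \<dots> \<le> measure_pmf.expectation (M n) (\<lambda>x. cmod (iexp (t * Y n x) - iexp (t * X n x)))"
      by (rule integral_norm_bound)
    also have "\<dots> \<le> measure_pmf.expectation (M n) (\<lambda>x. \<bar>t\<bar> * \<delta> + 2 * indicator ?A x)"
    proof (rule integral_mono[OF _ intr])
      show "integrable (measure_pmf (M n)) (\<lambda>x. cmod (iexp (t * Y n x) - iexp (t * X n x)))"
        by (intro integrable_norm Bochner_Integration.integrable_diff int)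
      fix x
      show "cmod (iexp (t * Y n x) - iexp (t * X n x)) \<le> \<bar>t\<bar> * \<delta> + 2 * indicator ?A x"
      proof (cases "x \<in> ?A")
        case True
        have "cmod (iexp (t * Y n x) - iexp (t * X n x)) \<le> cmod (iexp (t * Y n x)) + cmod (iexp (t * X n x))"
          by (rule norm_triangle_ineq4)
        also have "\<dots> = 2" by simp
        finally have "cmod (iexp (t * Y n x) - iexp (t * X n x)) \<le> 2" .
        moreover have "\<bar>t\<bar> * \<delta> \<ge> 0" using that by simp
        moreover have "indicator ?A x = (1::real)" using True by simp
        ultimately show ?thesis by simp
      next
        case False
        have "cmod (iexp (t * Y n x) - iexp (t * X n x)) \<le> \<bar>t * Y n x - t * X n x\<bar>"
          by (rule cmod_iexp_diff_le)
        also have "\<dots> = \<bar>t\<bar> * \<bar>Y n x - X n x\<bar>" by (simp add: abs_mult right_diff_distrib[symmetric])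
        also have "\<dots> \<le> \<bar>t\<bar> * \<delta>" using False by (intro mult_left_mono) auto
        finally show ?thesis using False by simp
      qed
    qed
    also have "\<dots> = \<bar>t\<bar> * \<delta> + 2 * measure_pmf.prob (M n) ?A"
      by (subst Bochner_Integration.integral_add) (auto intro!: integrable_mult_right integrable_real_indicator simp: measure_pmf.emeasure_eq_measure)
    finally show ?thesis .
  qed
  have "(\<lambda>n. ?d n - ?c n) \<longlonglongrightarrow> 0"
  proof (rule tendstoI)
    fix e :: real assume e: "e > 0"
    \<comment> \<open>Half of \<open>e\<close> goes to |t| \<open>\<delta>\<close>, the other half
      to twice the exceptional probability, which is made smaller than \<open>e / 4\<close>. The
      added 1 covers t = 0.\<close>
    define \<delta> where "\<delta> = e / (2 * (\<bar>t\<bar> + 1))"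
    have \<delta>: "\<delta> > 0" using e by (simp add: \<delta>_def)
    have td: "\<bar>t\<bar> * \<delta> \<le> e / 2"
      unfolding \<delta>_def using e by (simp add: field_simps)
    have "\<forall>\<^sub>F n in sequentially. measure_pmf.prob (M n) {x. \<bar>Y n x - X n x\<bar> > \<delta>} < e / 4"
      using order_tendstoD(2)[OF diff[OF \<delta>], of "e/4"] e by simp
    thus "\<forall>\<^sub>F n in sequentially. dist (?d n - ?c n) 0 < e"
      by eventually_elim (use bound[OF \<delta>] td in \<open>simp add: dist_norm, smt (verit)\<close>)
  qed
  from tendsto_add[OF this c] show "?d \<longlonglongrightarrow> char N t" by simp
qed (auto intro!: N prob_space.real_distribution_distr[OF prob_space_measure_pmf])

section \<open>Independent dyads\<close>

text \<open>Edges of a cycle are directed, whereas the independent coordinates are unordered dyads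
  stored under a key (i, j) with i < j. \<open>dyad_of\<close> gives the key of an edge, and
  \<open>orient\<close> reads the stored state from the side of that edge.\<close>

definition dyad_of :: "nat \<times> nat \<Rightarrow> nat \<times> nat" where
  "dyad_of e = (min (fst e) (snd e), max (fst e) (snd e))"

definition orient :: "nat \<times> nat \<Rightarrow> bool \<times> bool \<Rightarrow> bool \<times> bool" where
  "orient e s = (if fst e < snd e then s else prod.swap s)"

definition state :: "(nat \<Rightarrow> nat \<Rightarrow> bool) \<Rightarrow> nat \<times> nat \<Rightarrow> bool \<times> bool" where
  "state A e = (A (fst e) (snd e), A (snd e) (fst e))"

definition ordered_pairs :: "nat \<Rightarrow> (nat \<times> nat) set" where
  "ordered_pairs n = {(i, j). i < j \<and> j < n}"

text \<open>The map inside \<open>p1_pmf\<close>, named so that the network law becomes a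
  push-forward of a product law.\<close>

definition adjacency :: "(nat \<times> nat \<Rightarrow> bool \<times> bool) \<Rightarrow> nat \<Rightarrow> nat \<Rightarrow> bool" where
  "adjacency f i j = (if i < j then fst (f (i, j)) else if j < i then snd (f (j, i)) else False)"

definition distinct2 :: "nat \<Rightarrow> (nat \<times> nat) set" where
  "distinct2 n = {(i, j). i < n \<and> j < n \<and> i \<noteq> j}"

definition distinct3 :: "nat \<Rightarrow> (nat \<times> nat \<times> nat) set" where
  "distinct3 n = {(i, j, k). i < n \<and> j < n \<and> k < n \<and> distinct [i, j, k]}"

lemma finite_ordered_pairs [simp]: "finite (ordered_pairs n)"
  by (rule finite_subset[of _ "{..<n} \<times> {..<n}"]) (auto simp: ordered_pairs_def)

lemma finite_distinct [simp]: "finite (distinct2 n)" "finite (distinct3 n)" "finite (distinct4 n)"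
  by (rule finite_subset[of _ "{..<n} \<times> {..<n}"], auto simp: distinct2_def)
     (rule finite_subset[of _ "{..<n} \<times> {..<n} \<times> {..<n}"], auto simp: distinct3_def,
      rule finite_subset[of _ "{..<n} \<times> {..<n} \<times> {..<n} \<times> {..<n}"], auto simp: distinct4_def)

lemma state_adjacency:
  assumes "fst e \<noteq> snd e"
  shows "state (adjacency f) e = orient e (f (dyad_of e))"
  using assms by (auto simp: state_def adjacency_def orient_def dyad_of_def prod_eq_iff)

lemma dyad_of_eq_iff: "dyad_of (i, j) = dyad_of (k, l) \<longleftrightarrow> (i = k \<and> j = l) \<or> (i = l \<and> j = k)"
  by (auto simp: dyad_of_def min_def max_def split: if_splits)

text \<open>Isolates what depends only on independent dyads whose law is swapped when the dyad is
  read backwards. The exponential weights enter with \<open>p1_model\<close>.\<close>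

locale dyad_model =
  fixes n :: nat and dp :: "nat \<times> nat \<Rightarrow> (bool \<times> bool) pmf"
  assumes dp_swap: "fst e \<noteq> snd e \<Longrightarrow> dp (prod.swap e) = map_pmf prod.swap (dp e)"
begin

definition PM :: "(nat \<times> nat \<Rightarrow> bool \<times> bool) pmf" where
  "PM = Pi_pmf (ordered_pairs n) (False, False) dp"

definition NM :: "(nat \<Rightarrow> nat \<Rightarrow> bool) pmf" where
  "NM = map_pmf adjacency PM"

abbreviation EN :: "((nat \<Rightarrow> nat \<Rightarrow> bool) \<Rightarrow> real) \<Rightarrow> real" where
  "EN \<equiv> measure_pmf.expectation NM"

abbreviation Ed :: "nat \<times> nat \<Rightarrow> (bool \<times> bool \<Rightarrow> real) \<Rightarrow> real" where
  "Ed e \<equiv> measure_pmf.expectation (dp e)"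

lemma finite_set_NM: "finite (set_pmf NM)"
  unfolding NM_def PM_def by (simp add: finite_set_Pi_pmf)

lemma int_NM [simp, intro]: "integrable (measure_pmf NM) (h :: _ \<Rightarrow> real)"
  by (rule integrable_measure_pmf_finite[OF finite_set_NM])

lemma int_dp [simp, intro]: "integrable (measure_pmf (dp e)) (h :: _ \<Rightarrow> real)"
  by (rule integrable_measure_pmf_finite) simp

lemma EN_sum: "EN (\<lambda>A. \<Sum>t\<in>T. F t A) = (\<Sum>t\<in>T. EN (F t))"
  by (rule Bochner_Integration.integral_sum) simp

lemma EN_mono: "(\<And>A. F A \<le> G A) \<Longrightarrow> EN F \<le> EN G"
  by (rule integral_mono) auto

lemma EN_add: "EN (\<lambda>A. F A + G A) = EN F + EN G"
  by (rule Bochner_Integration.integral_add) auto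

lemma EN_diff: "EN (\<lambda>A. F A - G A) = EN F - EN G"
  by (rule Bochner_Integration.integral_diff) auto

lemma Ed_orient:
  assumes "fst e \<noteq> snd e"
  shows "measure_pmf.expectation (dp (dyad_of e)) (\<lambda>s. \<phi> (orient e s)) = Ed e \<phi>"
proof (cases "fst e < snd e")
  case True
  hence "dyad_of e = e" by (auto simp: dyad_of_def prod_eq_iff)
  thus ?thesis using True by (simp add: orient_def)
next
  case False
  hence d: "dyad_of e = prod.swap e" using assms by (auto simp: dyad_of_def prod_eq_iff)
  have "fst (prod.swap e) \<noteq> snd (prod.swap e)" using assms by auto
  from dp_swap[OF this] have "dp e = map_pmf prod.swap (dp (prod.swap e))" by simp
  thus ?thesis using False d by (simp add: orient_def)
qed

section \<open>Expectations of products over edges with different dyads\<close>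

definition edges_ok :: "'k set \<Rightarrow> ('k \<Rightarrow> nat \<times> nat) \<Rightarrow> bool" where
  "edges_ok K e \<longleftrightarrow> finite K \<and> inj_on (\<lambda>k. dyad_of (e k)) K \<and> (\<forall>k\<in>K. e k \<in> distinct2 n)"

lemma dyad_of_ordered: "e \<in> distinct2 n \<Longrightarrow> dyad_of e \<in> ordered_pairs n"
  by (cases e) (auto simp: distinct2_def ordered_pairs_def dyad_of_def)

lemma distinct2_neq: "e \<in> distinct2 n \<Longrightarrow> fst e \<noteq> snd e"
  by (auto simp: distinct2_def)

text \<open>The independence lemmas take products over coordinates, while the factors of a cycle are
  indexed by positions \<open>k\<close>. The index is changed by inverting
  \<open>k \<mapsto> dyad_of (e k)\<close>, which is injective by \<open>edges_ok\<close>.\<close>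

definition lift :: "'k set \<Rightarrow> ('k \<Rightarrow> nat \<times> nat) \<Rightarrow> ('k \<Rightarrow> bool \<times> bool \<Rightarrow> real) \<Rightarrow> nat \<times> nat \<Rightarrow> bool \<times> bool \<Rightarrow> real" where
  "lift K e \<phi> d s = (let k = the_inv_into K (\<lambda>k. dyad_of (e k)) d in \<phi> k (orient (e k) s))"

lemma lift_eq: "edges_ok K e \<Longrightarrow> k \<in> K \<Longrightarrow> lift K e \<phi> (dyad_of (e k)) = (\<lambda>s. \<phi> k (orient (e k) s))"
  unfolding lift_def edges_ok_def Let_def
  by (subst (1 2) the_inv_into_f_f[of "\<lambda>k. dyad_of (e k)"]) auto

lemma prod_lift:
  assumes "edges_ok K e"
  shows "(\<Prod>k\<in>K. \<phi> k (state (adjacency f) (e k))) = (\<Prod>d\<in>(\<lambda>k. dyad_of (e k)) ` K. lift K e \<phi> d (f d))"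
  using assms by (subst prod.reindex)
    (auto simp: edges_ok_def lift_eq[OF assms] state_adjacency distinct2_neq intro!: prod.cong)

lemma Ed_lift:
  assumes "edges_ok K e" "k \<in> K"
  shows "measure_pmf.expectation (dp (dyad_of (e k))) (lift K e \<phi> (dyad_of (e k))) = Ed (e k) (\<phi> k)"
  using assms by (simp add: lift_eq Ed_orient edges_ok_def distinct2_neq)

lemma EN_prod_edges:
  assumes "edges_ok K e"
  shows "EN (\<lambda>A. \<Prod>k\<in>K. \<phi> k (state A (e k))) = (\<Prod>k\<in>K. Ed (e k) (\<phi> k))"
proof -
  have "EN (\<lambda>A. \<Prod>k\<in>K. \<phi> k (state A (e k)))
     = measure_pmf.expectation PM (\<lambda>f. \<Prod>d\<in>(\<lambda>k. dyad_of (e k)) ` K. lift K e \<phi> d (f d))"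
    unfolding NM_def by (simp add: prod_lift[OF assms])
  also have "\<dots> = (\<Prod>d\<in>(\<lambda>k. dyad_of (e k)) ` K. measure_pmf.expectation (dp d) (lift K e \<phi> d))"
    unfolding PM_def by (rule expectation_prod_Pi_pmf_subset) (use assms in \<open>auto simp: edges_ok_def dyad_of_ordered\<close>)
  also have "\<dots> = (\<Prod>k\<in>K. Ed (e k) (\<phi> k))"
    using assms by (subst prod.reindex) (auto simp: edges_ok_def Ed_lift[OF assms] intro!: prod.cong)
  finally show ?thesis .
qed

text \<open>Of the two inclusions that characterise correlated terms only one is kept: the centred
  dyads of the partner lie among the dyads of \<open>t\<close>. The partners can then be counted by
  their possible vertices.\<close>

lemma edges_second_moment:
  fixes e :: "'t \<Rightarrow> 'k \<Rightarrow> nat \<times> nat"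
  assumes T: "finite T"
    and ok: "\<And>t. t \<in> T \<Longrightarrow> edges_ok K (e t)"
    and C: "C \<subseteq> K"
    and centered: "\<And>t k. t \<in> T \<Longrightarrow> k \<in> C \<Longrightarrow> Ed (e t k) (\<phi> t k) = 0"
    and N: "\<And>t. t \<in> T \<Longrightarrow> card {t'\<in>T. (\<lambda>k. dyad_of (e t' k)) ` C \<subseteq> (\<lambda>k. dyad_of (e t k)) ` K} \<le> N"
  shows "EN (\<lambda>A. (\<Sum>t\<in>T. w t * (\<Prod>k\<in>K. \<phi> t k (state A (e t k))))^2)
      \<le> real N * (\<Sum>t\<in>T. (w t)^2 * (\<Prod>k\<in>K. Ed (e t k) (\<lambda>s. (\<phi> t k s)^2)))"
proof -
  let ?E = "\<lambda>t. (\<lambda>k. dyad_of (e t k)) ` K"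
  let ?S = "\<lambda>t. (\<lambda>k. dyad_of (e t k)) ` C"
  let ?g = "\<lambda>t. lift K (e t) (\<phi> t)"
  have "EN (\<lambda>A. (\<Sum>t\<in>T. w t * (\<Prod>k\<in>K. \<phi> t k (state A (e t k))))^2)
     = measure_pmf.expectation PM (\<lambda>f. (\<Sum>t\<in>T. w t * (\<Prod>d\<in>?E t. ?g t d (f d)))^2)"
    unfolding NM_def by (simp add: prod_lift[OF ok] cong: sum.cong)
  also have "\<dots> \<le> real N * (\<Sum>t\<in>T. (w t)^2 * (\<Prod>d\<in>?E t. measure_pmf.expectation (dp d) (\<lambda>s. (?g t d s)^2)))"
    unfolding PM_def
  proof (rule orthogonal_second_moment[where S="?S"])
    fix t assume t: "t \<in> T"
    show "?E t \<subseteq> ordered_pairs n" using ok[OF t] by (auto simp: edges_ok_def dyad_of_ordered)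
    show "?S t \<subseteq> ?E t" using C by auto
    show "measure_pmf.expectation (dp d) (?g t d) = 0" if "d \<in> ?S t" for d
      using that C centered[OF t] Ed_lift[OF ok[OF t]] by auto
    have "card {t' \<in> T. ?S t \<subseteq> ?E t' \<and> ?S t' \<subseteq> ?E t} \<le> card {t'\<in>T. ?S t' \<subseteq> ?E t}"
      by (rule card_mono) (use T in auto)
    also have "\<dots> \<le> N" by (rule N[OF t])
    finally show "card {t' \<in> T. ?S t \<subseteq> ?E t' \<and> ?S t' \<subseteq> ?E t} \<le> N" .
  qed (use T in auto)
  also have "(\<Sum>t\<in>T. (w t)^2 * (\<Prod>d\<in>?E t. measure_pmf.expectation (dp d) (\<lambda>s. (?g t d s)^2)))
     = (\<Sum>t\<in>T. (w t)^2 * (\<Prod>k\<in>K. Ed (e t k) (\<lambda>s. (\<phi> t k s)^2)))"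
  proof (rule sum.cong[OF refl])
    fix t assume t: "t \<in> T"
    note o = ok[OF t]
    have "(\<Prod>d\<in>?E t. measure_pmf.expectation (dp d) (\<lambda>s. (?g t d s)^2))
       = (\<Prod>k\<in>K. measure_pmf.expectation (dp (dyad_of (e t k))) (\<lambda>s. (?g t (dyad_of (e t k)) s)^2))"
      using o by (subst prod.reindex) (auto simp: edges_ok_def)
    also have "\<dots> = (\<Prod>k\<in>K. Ed (e t k) (\<lambda>s. (\<phi> t k s)^2))"
    proof (rule prod.cong[OF refl])
      fix k assume k: "k \<in> K"
      have "fst (e t k) \<noteq> snd (e t k)" using o k by (auto simp: edges_ok_def distinct2_neq)
      thus "measure_pmf.expectation (dp (dyad_of (e t k))) (\<lambda>s. (?g t (dyad_of (e t k)) s)^2) = Ed (e t k) (\<lambda>s. (\<phi> t k s)^2)"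
        using Ed_orient[of "e t k" "\<lambda>s. (\<phi> t k s)^2"] by (simp add: lift_eq[OF o k])
    qed
    finally show "(w t)^2 * (\<Prod>d\<in>?E t. measure_pmf.expectation (dp d) (\<lambda>s. (?g t d s)^2))
       = (w t)^2 * (\<Prod>k\<in>K. Ed (e t k) (\<lambda>s. (\<phi> t k s)^2))" by simp
  qed
  finally show ?thesis .
qed

definition edges4 :: "nat \<times> nat \<times> nat \<times> nat \<Rightarrow> nat \<Rightarrow> nat \<times> nat" where
  "edges4 t c = (case t of (i, j, k, l) \<Rightarrow> [(i, j), (j, k), (k, l), (l, i)] ! c)"

lemma lessThan_4: "{..<4::nat} = {0, 1, 2, 3}" by auto

lemma edges4_simps [simp]:
  "edges4 (i, j, k, l) 0 = (i, j)" "edges4 (i, j, k, l) (Suc 0) = (j, k)"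
  "edges4 (i, j, k, l) 2 = (k, l)" "edges4 (i, j, k, l) 3 = (l, i)"
  by (simp_all add: edges4_def numeral_eq_Suc)

lemma edges4_ok: "t \<in> distinct4 n \<Longrightarrow> edges_ok {..<4} (edges4 t)"
  by (cases t) (auto simp: edges_ok_def lessThan_4 inj_on_def distinct4_def distinct2_def dyad_of_eq_iff)

lemma dyad_of_mem_vertices:
  assumes "dyad_of (i, j) \<in> (\<lambda>k. dyad_of (e k)) ` K" "\<And>k. k \<in> K \<Longrightarrow> fst (e k) \<in> V \<and> snd (e k) \<in> V"
  shows "i \<in> V \<and> j \<in> V"
  using assms by (auto simp: image_iff) (metis dyad_of_eq_iff prod.collapse)+

text \<open>Two opposite edges already contain all vertices of a four-cycle. A correlated cycle has
  its centred pair among the dyads of \<open>t\<close>, hence all its vertices among four given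
  ones, which leaves at most 4^4 = 256 choices. One centred opposite pair is enough for this; the
  other two factors are free.\<close>

lemma opposite_second_moment:
  assumes C: "(\<forall>e\<in>distinct2 n. Ed e (f1 e) = 0 \<and> Ed e (f3 e) = 0) \<or> (\<forall>e\<in>distinct2 n. Ed e (f2 e) = 0 \<and> Ed e (f4 e) = 0)"
  shows "EN (\<lambda>A. (\<Sum>(i,j,k,l)\<in>distinct4 n. f1 (i,j) (state A (i,j)) * f2 (j,k) (state A (j,k))
                   * f3 (k,l) (state A (k,l)) * f4 (l,i) (state A (l,i)))^2)
     \<le> 256 * (\<Sum>(i,j,k,l)\<in>distinct4 n. Ed (i,j) (\<lambda>s. (f1 (i,j) s)^2) * Ed (j,k) (\<lambda>s. (f2 (j,k) s)^2)
                   * Ed (k,l) (\<lambda>s. (f3 (k,l) s)^2) * Ed (l,i) (\<lambda>s. (f4 (l,i) s)^2))"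
proof -
  define \<phi> where "\<phi> t c = ([f1, f2, f3, f4] ! c) (edges4 t c)" for t c
  define Cs where "Cs = (if (\<forall>e\<in>distinct2 n. Ed e (f1 e) = 0 \<and> Ed e (f3 e) = 0) then {0,2} else {1,3::nat})"
  have "EN (\<lambda>A. (\<Sum>t\<in>distinct4 n. 1 * (\<Prod>c\<in>{..<4}. \<phi> t c (state A (edges4 t c))))^2)
    \<le> real 256 * (\<Sum>t\<in>distinct4 n. 1^2 * (\<Prod>c\<in>{..<4}. Ed (edges4 t c) (\<lambda>s. (\<phi> t c s)^2)))"
  proof (rule edges_second_moment[where C=Cs])
    show "Cs \<subseteq> {..<4}" by (auto simp: Cs_def)
    show "Ed (edges4 t c) (\<phi> t c) = 0" if "t \<in> distinct4 n" "c \<in> Cs" for t c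
    proof -
      obtain i j k l where t: "t = (i,j,k,l)" by (cases t)
      have d2: "(i,j) \<in> distinct2 n" "(j,k) \<in> distinct2 n" "(k,l) \<in> distinct2 n" "(l,i) \<in> distinct2 n"
        using that by (auto simp: distinct4_def distinct2_def t)
      show ?thesis using C that(2) d2 by (auto simp: Cs_def \<phi>_def t numeral_eq_Suc edges4_def split: if_splits)
    qed
    fix t assume t: "t \<in> distinct4 n"
    show "edges_ok {..<4} (edges4 t)" by (rule edges4_ok[OF t])
    obtain i j k l where t: "t = (i,j,k,l)" by (cases t)
    define V where "V = {i,j,k,l}"
    have inV: "i \<in> V" "j \<in> V" "k \<in> V" "l \<in> V" using V_def by auto
    have V: "fst (edges4 t c) \<in> V \<and> snd (edges4 t c) \<in> V" if "c \<in> {..<4}" for c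
      using that inV by (auto simp: t lessThan_4)
    have "{t' \<in> distinct4 n. (\<lambda>c. dyad_of (edges4 t' c)) ` Cs \<subseteq> (\<lambda>c. dyad_of (edges4 t c)) ` {..<4}}
       \<subseteq> V \<times> V \<times> V \<times> V"
    proof
      fix t' assume a: "t' \<in> {t' \<in> distinct4 n. (\<lambda>c. dyad_of (edges4 t' c)) ` Cs \<subseteq> (\<lambda>c. dyad_of (edges4 t c)) ` {..<4}}"
      obtain i' j' k' l' where t': "t' = (i',j',k',l')" by (cases t')
      have m: "fst (edges4 t' c) \<in> V \<and> snd (edges4 t' c) \<in> V" if "c \<in> Cs" for c
        by (rule dyad_of_mem_vertices[of _ _ "edges4 t" "{..<4}"]) (use a that V in \<open>auto simp: image_subset_iff\<close>)
      show "t' \<in> V \<times> V \<times> V \<times> V"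
      proof (cases "Cs = {0,2}")
        case True thus ?thesis using m[of 0] m[of 2] by (simp add: t')
      next
        case False
        hence "Cs = {1,3}" by (auto simp: Cs_def)
        thus ?thesis using m[of 1] m[of 3] by (simp add: t')
      qed
    qed
    hence "card {t' \<in> distinct4 n. (\<lambda>c. dyad_of (edges4 t' c)) ` Cs \<subseteq> (\<lambda>c. dyad_of (edges4 t c)) ` {..<4}}
       \<le> card (V \<times> V \<times> V \<times> V)" by (rule card_mono[rotated]) (simp add: V_def)
    also have "\<dots> \<le> 4 * (4 * (4 * 4))"
    proof -
      have "card V \<le> 4" using card_length[of "[i,j,k,l]"] by (simp add: V_def)
      thus ?thesis unfolding card_cartesian_product by (intro mult_mono) auto
    qed
    finally show "card {t' \<in> distinct4 n. (\<lambda>c. dyad_of (edges4 t' c)) ` Cs \<subseteq> (\<lambda>c. dyad_of (edges4 t c)) ` {..<4}} \<le> 256" by simp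
  qed auto
  thus ?thesis
    by (simp add: \<phi>_def lessThan_4 case_prod_beta edges4_def mult.assoc numeral_eq_Suc)
qed

text \<open>Two adjacent edges determine three vertices, hence 3^3 = 27 partners. The fourth vertex
  of the cycle would be undetermined, so it has to be summed out beforehand into the deterministic
  weight \<open>w\<close>.\<close>

lemma adjacent_second_moment:
  assumes C: "\<forall>e\<in>distinct2 n. Ed e (f1 e) = 0 \<and> Ed e (f2 e) = 0"
  shows "EN (\<lambda>A. (\<Sum>(i,j,k)\<in>distinct3 n. w i j k * (f1 (i,j) (state A (i,j)) * f2 (j,k) (state A (j,k))))^2)
     \<le> 27 * (\<Sum>(i,j,k)\<in>distinct3 n. (w i j k)^2 * (Ed (i,j) (\<lambda>s. (f1 (i,j) s)^2) * Ed (j,k) (\<lambda>s. (f2 (j,k) s)^2)))"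
proof -
  define ed where "ed t c = (case t of (i, j, k) \<Rightarrow> if c then (i,j) else (j,k))" for t :: "nat \<times> nat \<times> nat" and c :: bool
  define \<phi> where "\<phi> t c = (if c then f1 else f2) (ed t c)" for t c
  define w' where "w' = (\<lambda>(i,j,k). w i j k)"
  have "EN (\<lambda>A. (\<Sum>t\<in>distinct3 n. w' t * (\<Prod>c\<in>UNIV. \<phi> t c (state A (ed t c))))^2)
    \<le> real 27 * (\<Sum>t\<in>distinct3 n. (w' t)^2 * (\<Prod>c\<in>UNIV. Ed (ed t c) (\<lambda>s. (\<phi> t c s)^2)))"
  proof (rule edges_second_moment[where C=UNIV])
    show "Ed (ed t c) (\<phi> t c) = 0" if "t \<in> distinct3 n" for t c
      using C that by (auto simp: \<phi>_def ed_def distinct3_def distinct2_def split: prod.splits)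
    fix t assume t: "t \<in> distinct3 n"
    show "edges_ok UNIV (ed t)" using t
      by (auto simp: edges_ok_def ed_def inj_on_def distinct3_def distinct2_def dyad_of_eq_iff split: if_splits)
    obtain i j k where t: "t = (i,j,k)" by (cases t)
    define V where "V = {i,j,k}"
    have inV: "i \<in> V" "j \<in> V" "k \<in> V" using V_def by auto
    have "{t' \<in> distinct3 n. range (\<lambda>c. dyad_of (ed t' c)) \<subseteq> range (\<lambda>c. dyad_of (ed t c))}
       \<subseteq> V \<times> V \<times> V"
    proof
      fix t' assume a: "t' \<in> {t' \<in> distinct3 n. range (\<lambda>c. dyad_of (ed t' c)) \<subseteq> range (\<lambda>c. dyad_of (ed t c))}"
      obtain i' j' k' where t': "t' = (i',j',k')" by (cases t')
      have m: "fst (ed t' c) \<in> V \<and> snd (ed t' c) \<in> V" for c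
        by (rule dyad_of_mem_vertices[of _ _ "ed t" UNIV]) (use a in \<open>auto simp: image_subset_iff t ed_def inV split: if_splits\<close>)
      show "t' \<in> V \<times> V \<times> V"
        using m[of True] m[of False] by (simp add: t' ed_def)
    qed
    hence "card {t' \<in> distinct3 n. range (\<lambda>c. dyad_of (ed t' c)) \<subseteq> range (\<lambda>c. dyad_of (ed t c))}
       \<le> card (V \<times> V \<times> V)" by (rule card_mono[rotated]) (simp add: V_def)
    also have "\<dots> \<le> 3 * (3 * 3)"
    proof -
      have "card V \<le> 3" using card_length[of "[i,j,k]"] by (simp add: V_def)
      thus ?thesis unfolding card_cartesian_product by (intro mult_mono) auto
    qed
    finally show "card {t' \<in> distinct3 n. range (\<lambda>c. dyad_of (ed t' c)) \<subseteq> range (\<lambda>c. dyad_of (ed t c))} \<le> 27" by simp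
  qed auto
  thus ?thesis
    by (simp add: \<phi>_def UNIV_bool case_prod_beta ed_def w'_def ac_simps)
qed

text \<open>A partner has both endpoints among the two endpoints of the given edge; 2^2 = 4 is a
  crude count of the two directions.\<close>

lemma single_second_moment:
  assumes C: "\<forall>e\<in>distinct2 n. Ed e (f e) = 0"
  shows "EN (\<lambda>A. (\<Sum>e\<in>distinct2 n. w e * f e (state A e))^2)
     \<le> 4 * (\<Sum>e\<in>distinct2 n. (w e)^2 * Ed e (\<lambda>s. (f e s)^2))"
proof -
  have "EN (\<lambda>A. (\<Sum>t\<in>distinct2 n. w t * (\<Prod>c\<in>(UNIV::unit set). f t (state A t)))^2)
    \<le> real 4 * (\<Sum>t\<in>distinct2 n. (w t)^2 * (\<Prod>c\<in>(UNIV::unit set). Ed t (\<lambda>s. (f t s)^2)))"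
  proof (rule edges_second_moment[where C=UNIV and e="\<lambda>t _. t"])
    show "Ed t (f t) = 0" if "t \<in> distinct2 n" for t
      using C that by auto
    fix t assume t: "t \<in> distinct2 n"
    show "edges_ok UNIV (\<lambda>_::unit. t)" using t by (auto simp: edges_ok_def inj_on_def)
    obtain i j where t: "t = (i,j)" by (cases t)
    let ?V = "{i,j}"
    have "{t' \<in> distinct2 n. range (\<lambda>_::unit. dyad_of t') \<subseteq> range (\<lambda>_::unit. dyad_of t)} \<subseteq> ?V \<times> ?V"
      by (auto simp: t dyad_of_eq_iff)
    hence "card {t' \<in> distinct2 n. range (\<lambda>_::unit. dyad_of t') \<subseteq> range (\<lambda>_::unit. dyad_of t)}
       \<le> card (?V \<times> ?V)" by (rule card_mono[rotated]) auto
    also have "\<dots> \<le> 2 * 2"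
    proof -
      have "card ?V \<le> 2" using card_length[of "[i,j]"] by simp
      thus ?thesis unfolding card_cartesian_product by (intro mult_mono) auto
    qed
    finally show "card {t' \<in> distinct2 n. range (\<lambda>_::unit. dyad_of t') \<subseteq> range (\<lambda>_::unit. dyad_of t)} \<le> 4" by simp
  qed auto
  thus ?thesis by simp
qed

end

section \<open>Expansion of four-cycle counts\<close>

lemma sum_distinct4_rotate:
  "(\<Sum>(i,j,k,l)\<in>distinct4 n. F i j k l) = (\<Sum>(i,j,k,l)\<in>distinct4 n. F j k l i)"
  by (rule sum.reindex_bij_witness[where i="\<lambda>(i,j,k,l). (j,k,l,i)" and j="\<lambda>(i,j,k,l). (l,i,j,k)"])
     (auto simp: distinct4_def)

lemma sum_distinct4_fibre3:
  fixes F :: "nat \<Rightarrow> nat \<Rightarrow> nat \<Rightarrow> nat \<Rightarrow> real"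
  shows "(\<Sum>(i,j,k,l)\<in>distinct4 n. F i j k l)
     = (\<Sum>(i,j,k)\<in>distinct3 n. \<Sum>l\<in>{l. (i,j,k,l) \<in> distinct4 n}. F i j k l)"
proof -
  have fin: "finite {l. (i,j,k,l) \<in> distinct4 n}" for i j k
    by (rule finite_subset[of _ "{..<n}"]) (auto simp: distinct4_def)
  have "(\<Sum>(i,j,k)\<in>distinct3 n. \<Sum>l\<in>{l. (i,j,k,l) \<in> distinct4 n}. F i j k l)
     = (\<Sum>t\<in>distinct3 n. \<Sum>l\<in>{l. (fst t, fst (snd t), snd (snd t), l) \<in> distinct4 n}. F (fst t) (fst (snd t)) (snd (snd t)) l)"
    by (simp add: case_prod_beta)
  also have "\<dots> = (\<Sum>(t,l)\<in>(SIGMA t:distinct3 n. {l. (fst t, fst (snd t), snd (snd t), l) \<in> distinct4 n}).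
     F (fst t) (fst (snd t)) (snd (snd t)) l)"
    by (rule sum.Sigma) (auto simp: fin)
  also have "\<dots> = (\<Sum>(i,j,k,l)\<in>distinct4 n. F i j k l)"
    by (rule sum.reindex_bij_witness[where i="\<lambda>(i,j,k,l). ((i,j,k),l)" and j="\<lambda>((i,j,k),l). (i,j,k,l)"])
       (auto simp: distinct4_def distinct3_def)
  finally show ?thesis by simp
qed

lemma sum_distinct4_fibre2:
  fixes F :: "nat \<Rightarrow> nat \<Rightarrow> nat \<Rightarrow> nat \<Rightarrow> real"
  shows "(\<Sum>(i,j,k,l)\<in>distinct4 n. F i j k l)
     = (\<Sum>e\<in>distinct2 n. \<Sum>(k,l)\<in>{(k,l). (fst e,snd e,k,l) \<in> distinct4 n}. F (fst e) (snd e) k l)"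
proof -
  have fin: "finite {(k,l). (i,j,k,l) \<in> distinct4 n}" for i j
    by (rule finite_subset[of _ "{..<n} \<times> {..<n}"]) (auto simp: distinct4_def)
  have "(\<Sum>e\<in>distinct2 n. \<Sum>kl\<in>{(k,l). (fst e,snd e,k,l) \<in> distinct4 n}. F (fst e) (snd e) (fst kl) (snd kl))
    = (\<Sum>(e,kl)\<in>(SIGMA e:distinct2 n. {(k,l). (fst e,snd e,k,l) \<in> distinct4 n}). F (fst e) (snd e) (fst kl) (snd kl))"
    by (rule sum.Sigma) (auto simp: fin)
  also have "\<dots> = (\<Sum>(i,j,k,l)\<in>distinct4 n. F i j k l)"
    by (rule sum.reindex_bij_witness[where i="\<lambda>(i,j,k,l). ((i,j),(k,l))" and j="\<lambda>((i,j),(k,l)). (i,j,k,l)"])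
       (auto simp: distinct4_def distinct2_def)
  finally show ?thesis by (simp add: case_prod_beta)
qed

definition ind :: "'a \<Rightarrow> 'a \<Rightarrow> real" where
  "ind s s' = of_bool (s' = s)"

text \<open>Both counts have this form, so a single expansion by edge states serves
  \<open>Qa\<close> and \<open>Qb\<close>.\<close>

definition cyc :: "nat \<Rightarrow> bool \<times> bool \<Rightarrow> bool \<times> bool \<Rightarrow> bool \<times> bool \<Rightarrow> bool \<times> bool
    \<Rightarrow> (nat \<Rightarrow> nat \<Rightarrow> bool) \<Rightarrow> real" where
  "cyc n s1 s2 s3 s4 A = (\<Sum>(i,j,k,l)\<in>distinct4 n. ind s1 (state A (i,j)) * ind s2 (state A (j,k))
      * ind s3 (state A (k,l)) * ind s4 (state A (l,i)))"

lemma Qa_eq_cyc: "Qa n = cyc n (True,True) (False,False) (False,True) (False,False)"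
  unfolding Qa_def cyc_def fun_eq_iff
  by (auto intro!: sum.cong simp: distinct4_def A11_def A00_def A01_def A10_def ind_def state_def)

lemma Qb_eq_cyc: "Qb n = cyc n (True,False) (True,False) (False,False) (True,False)"
  unfolding Qb_def cyc_def fun_eq_iff
  by (auto intro!: sum.cong simp: distinct4_def A11_def A00_def A01_def A10_def ind_def state_def)

context dyad_model begin

definition pr :: "bool \<times> bool \<Rightarrow> nat \<times> nat \<Rightarrow> real" where
  "pr s e = pmf (dp e) s"

definition cind :: "bool \<times> bool \<Rightarrow> nat \<times> nat \<Rightarrow> bool \<times> bool \<Rightarrow> real" where
  "cind s e s' = ind s s' - pr s e"

text \<open>Expected number of completions of the directed edge to a four-cycle with the remaining
  states. It is the coefficient of the centred indicator of that edge; \<open>coef3\<close> is its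
  analogue for a path of two edges.\<close>

definition coef2 :: "bool \<times> bool \<Rightarrow> bool \<times> bool \<Rightarrow> bool \<times> bool \<Rightarrow> nat \<times> nat \<Rightarrow> real" where
  "coef2 s2 s3 s4 e = (\<Sum>(k,l)\<in>{(k,l). (fst e,snd e,k,l) \<in> distinct4 n}. pr s2 (snd e,k) * pr s3 (k,l) * pr s4 (l,fst e))"

definition coef3 :: "bool \<times> bool \<Rightarrow> bool \<times> bool \<Rightarrow> nat \<Rightarrow> nat \<Rightarrow> nat \<Rightarrow> real" where
  "coef3 s3 s4 i j k = (\<Sum>l\<in>{l. (i,j,k,l) \<in> distinct4 n}. pr s3 (k,l) * pr s4 (l,i))"

definition single :: "bool \<times> bool \<Rightarrow> bool \<times> bool \<Rightarrow> bool \<times> bool \<Rightarrow> bool \<times> bool \<Rightarrow> (nat \<Rightarrow> nat \<Rightarrow> bool) \<Rightarrow> real" where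
  "single s1 s2 s3 s4 A = (\<Sum>e\<in>distinct2 n. coef2 s2 s3 s4 e * cind s1 e (state A e))"

definition adj :: "bool \<times> bool \<Rightarrow> bool \<times> bool \<Rightarrow> bool \<times> bool \<Rightarrow> bool \<times> bool \<Rightarrow> (nat \<Rightarrow> nat \<Rightarrow> bool) \<Rightarrow> real" where
  "adj s1 s2 s3 s4 A = (\<Sum>(i,j,k)\<in>distinct3 n. coef3 s3 s4 i j k
      * (cind s1 (i,j) (state A (i,j)) * cind s2 (j,k) (state A (j,k))))"

definition opp :: "(nat \<times> nat \<Rightarrow> bool \<times> bool \<Rightarrow> real) \<Rightarrow> (nat \<times> nat \<Rightarrow> bool \<times> bool \<Rightarrow> real)
    \<Rightarrow> (nat \<times> nat \<Rightarrow> bool \<times> bool \<Rightarrow> real) \<Rightarrow> (nat \<times> nat \<Rightarrow> bool \<times> bool \<Rightarrow> real) \<Rightarrow> (nat \<Rightarrow> nat \<Rightarrow> bool) \<Rightarrow> real" where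
  "opp f1 f2 f3 f4 A = (\<Sum>(i,j,k,l)\<in>distinct4 n. f1 (i,j) (state A (i,j)) * f2 (j,k) (state A (j,k))
                   * f3 (k,l) (state A (k,l)) * f4 (l,i) (state A (l,i)))"

definition mean4 :: "bool \<times> bool \<Rightarrow> bool \<times> bool \<Rightarrow> bool \<times> bool \<Rightarrow> bool \<times> bool \<Rightarrow> real" where
  "mean4 s1 s2 s3 s4 = (\<Sum>(i,j,k,l)\<in>distinct4 n. pr s1 (i,j) * pr s2 (j,k) * pr s3 (k,l) * pr s4 (l,i))"

definition adj_bound :: "bool \<times> bool \<Rightarrow> bool \<times> bool \<Rightarrow> bool \<times> bool \<Rightarrow> bool \<times> bool \<Rightarrow> real" where
  "adj_bound s1 s2 s3 s4 = (\<Sum>(i,j,k)\<in>distinct3 n. (coef3 s3 s4 i j k)^2 * (pr s1 (i,j) * pr s2 (j,k)))"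

definition rest :: "bool \<times> bool \<Rightarrow> bool \<times> bool \<Rightarrow> bool \<times> bool \<Rightarrow> bool \<times> bool \<Rightarrow> (nat \<Rightarrow> nat \<Rightarrow> bool) \<Rightarrow> real" where
  "rest s1 s2 s3 s4 A = cyc n s1 s2 s3 s4 A - mean4 s1 s2 s3 s4
     - (single s1 s2 s3 s4 A + single s2 s3 s4 s1 A + single s3 s4 s1 s2 A + single s4 s1 s2 s3 A)"

lemma pr_nonneg [simp]: "pr s e \<ge> 0" and pr_le_1 [simp]: "pr s e \<le> 1"
  by (simp_all add: pr_def pmf_le_1)

lemma Ed_const [simp]: "Ed e (\<lambda>_. c) = (c::real)" by simp

lemma Ed_ind: "Ed e (ind s) = pr s e"
proof -
  have "ind s = (indicator {s} :: _ \<Rightarrow> real)" by (auto simp: ind_def fun_eq_iff)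
  thus ?thesis by (simp add: pr_def pmf.rep_eq)
qed

lemma ind_sq: "(ind s s')^2 = ind s s'" by (simp add: ind_def)

lemma Ed_ind_sq: "Ed e (\<lambda>s'. (ind s s')^2) = pr s e"
  by (simp add: ind_sq Ed_ind)

lemma Ed_cind: "Ed e (cind s e) = 0"
  unfolding cind_def by (subst Bochner_Integration.integral_diff) (auto simp: Ed_ind)

lemma Ed_cind_sq: "Ed e (\<lambda>s'. (cind s e s')^2) = pr s e * (1 - pr s e)"
proof -
  have "(cind s e s')^2 = (1 - 2 * pr s e) * ind s s' + (pr s e)^2" for s'
    by (auto simp: cind_def ind_def power2_eq_square algebra_simps)
  hence "Ed e (\<lambda>s'. (cind s e s')^2) = (1 - 2 * pr s e) * Ed e (ind s) + (pr s e)^2"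
    by (simp add: Bochner_Integration.integral_add)
  thus ?thesis by (simp add: Ed_ind power2_eq_square algebra_simps)
qed

lemma Ed_cind_sq_le: "Ed e (\<lambda>s'. (cind s e s')^2) \<le> pr s e"
  unfolding Ed_cind_sq using mult_left_mono[of "1 - pr s e" 1 "pr s e"] by simp

lemma Ed_sq_nonneg: "Ed e (\<lambda>s'. (f s')^2) \<ge> (0::real)"
  by (rule integral_nonneg_AE) auto

lemma pr_sq_le: "(pr s e)^2 \<le> pr s e"
  using mult_left_mono[OF pr_le_1 pr_nonneg, of s e s e] by (simp add: power2_eq_square)

lemma rest_eq:
  "rest s1 s2 s3 s4 A =
     (adj s1 s2 s3 s4 A + adj s2 s3 s4 s1 A + adj s3 s4 s1 s2 A + adj s4 s1 s2 s3 A)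
   + (opp (cind s1) (\<lambda>_. ind s2) (cind s3) (\<lambda>_. ind s4) A
    + opp (\<lambda>e _. pr s1 e) (cind s2) (\<lambda>_. ind s3) (cind s4) A
    + opp (cind s1) (cind s2) (\<lambda>e _. pr s3 e) (cind s4) A)"
proof -
  define x where "x s e = cind s e (state A e)" for s e
  define u where "u s e = ind s (state A e)" for s e
  have u: "u s e = pr s e + x s e" for s e by (simp add: u_def x_def cind_def)
  have single4: "single t1 t2 t3 t4 A = (\<Sum>(i,j,k,l)\<in>distinct4 n. x t1 (i,j) * pr t2 (j,k) * pr t3 (k,l) * pr t4 (l,i))" for t1 t2 t3 t4
    unfolding single_def coef2_def
    by (subst sum_distinct4_fibre2)
       (simp add: sum_distrib_left sum_distrib_right x_def case_prod_beta mult_ac)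
  have adj4: "adj t1 t2 t3 t4 A = (\<Sum>(i,j,k,l)\<in>distinct4 n. x t1 (i,j) * x t2 (j,k) * pr t3 (k,l) * pr t4 (l,i))" for t1 t2 t3 t4
    unfolding adj_def coef3_def
    by (subst sum_distinct4_fibre3)
       (simp add: sum_distrib_left sum_distrib_right x_def case_prod_beta mult_ac)
  note r1 = sum_distinct4_rotate
  have s2: "single s2 s3 s4 s1 A = (\<Sum>(i,j,k,l)\<in>distinct4 n. pr s1 (i,j) * x s2 (j,k) * pr s3 (k,l) * pr s4 (l,i))"
    unfolding single4 by (subst r1) (simp add: mult_ac)
  have s3: "single s3 s4 s1 s2 A = (\<Sum>(i,j,k,l)\<in>distinct4 n. pr s1 (i,j) * pr s2 (j,k) * x s3 (k,l) * pr s4 (l,i))"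
    unfolding single4 by (subst r1, subst r1) (simp add: mult_ac)
  have s4: "single s4 s1 s2 s3 A = (\<Sum>(i,j,k,l)\<in>distinct4 n. pr s1 (i,j) * pr s2 (j,k) * pr s3 (k,l) * x s4 (l,i))"
    unfolding single4 by (subst r1, subst r1, subst r1) (simp add: mult_ac)
  have a2: "adj s2 s3 s4 s1 A = (\<Sum>(i,j,k,l)\<in>distinct4 n. pr s1 (i,j) * x s2 (j,k) * x s3 (k,l) * pr s4 (l,i))"
    unfolding adj4 by (subst r1) (simp add: mult_ac)
  have a3: "adj s3 s4 s1 s2 A = (\<Sum>(i,j,k,l)\<in>distinct4 n. pr s1 (i,j) * pr s2 (j,k) * x s3 (k,l) * x s4 (l,i))"
    unfolding adj4 by (subst r1, subst r1) (simp add: mult_ac)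
  have a4: "adj s4 s1 s2 s3 A = (\<Sum>(i,j,k,l)\<in>distinct4 n. x s1 (i,j) * pr s2 (j,k) * pr s3 (k,l) * x s4 (l,i))"
    unfolding adj4 by (subst r1, subst r1, subst r1) (simp add: mult_ac)
  \<comment> \<open>Of the 16 terms, the seven that are neither mean, linear nor adjacent all
    contain a centred opposite pair. Those with \<open>x1\<close> and \<open>x3\<close> form one
    group; the others contain \<open>x2\<close> and \<open>x4\<close> and are split by whether
    \<open>x1\<close> occurs. Leaving factors p + x unexpanded reduces seven terms to three.\<close>
  have alg: "(p1 + x1) * (p2 + x2) * (p3 + x3) * (p4 + x4)
     = p1*p2*p3*p4 + (x1*p2*p3*p4 + p1*x2*p3*p4 + p1*p2*x3*p4 + p1*p2*p3*x4)
       + (x1*x2*p3*p4 + p1*x2*x3*p4 + p1*p2*x3*x4 + x1*p2*p3*x4)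
       + (x1*(p2+x2)*x3*(p4+x4) + p1*x2*(p3+x3)*x4 + x1*x2*p3*x4)" for p1 p2 p3 p4 x1 x2 x3 x4 :: real
    by (simp add: algebra_simps)
  have "cyc n s1 s2 s3 s4 A = mean4 s1 s2 s3 s4
     + (single s1 s2 s3 s4 A + single s2 s3 s4 s1 A + single s3 s4 s1 s2 A + single s4 s1 s2 s3 A)
     + (adj s1 s2 s3 s4 A + adj s2 s3 s4 s1 A + adj s3 s4 s1 s2 A + adj s4 s1 s2 s3 A)
   + (opp (cind s1) (\<lambda>_. ind s2) (cind s3) (\<lambda>_. ind s4) A
    + opp (\<lambda>e _. pr s1 e) (cind s2) (\<lambda>_. ind s3) (cind s4) A
    + opp (cind s1) (cind s2) (\<lambda>e _. pr s3 e) (cind s4) A)"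
    unfolding s2 s3 s4 a2 a3 a4
    unfolding single4 adj4 cyc_def mean4_def opp_def
      sum.distrib[symmetric] u_def[symmetric] x_def[symmetric] u
    by (rule sum.cong) (auto simp: alg)
  thus ?thesis unfolding rest_def by simp
qed

text \<open>Centred, raw and averaged factors all have second moment at most the probability of the
  state, so the bound collapses to the mean count itself.\<close>

lemma opp_second_moment_le:
  assumes C: "(\<forall>e\<in>distinct2 n. Ed e (f1 e) = 0 \<and> Ed e (f3 e) = 0) \<or> (\<forall>e\<in>distinct2 n. Ed e (f2 e) = 0 \<and> Ed e (f4 e) = 0)"
    and b: "\<And>e. Ed e (\<lambda>s. (f1 e s)^2) \<le> pr s1 e" "\<And>e. Ed e (\<lambda>s. (f2 e s)^2) \<le> pr s2 e"
      "\<And>e. Ed e (\<lambda>s. (f3 e s)^2) \<le> pr s3 e" "\<And>e. Ed e (\<lambda>s. (f4 e s)^2) \<le> pr s4 e"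
  shows "EN (\<lambda>A. (opp f1 f2 f3 f4 A)^2) \<le> 256 * mean4 s1 s2 s3 s4"
proof -
  have "EN (\<lambda>A. (opp f1 f2 f3 f4 A)^2) \<le> 256 * (\<Sum>(i,j,k,l)\<in>distinct4 n. Ed (i,j) (\<lambda>s. (f1 (i,j) s)^2) * Ed (j,k) (\<lambda>s. (f2 (j,k) s)^2)
                   * Ed (k,l) (\<lambda>s. (f3 (k,l) s)^2) * Ed (l,i) (\<lambda>s. (f4 (l,i) s)^2))"
    unfolding opp_def by (rule opposite_second_moment[OF C])
  also have "\<dots> \<le> 256 * mean4 s1 s2 s3 s4"
    unfolding mean4_def
    by (intro mult_left_mono sum_mono) (auto intro!: mult_mono b mult_nonneg_nonneg Ed_sq_nonneg)
  finally show ?thesis .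
qed

lemma adj_second_moment_le: "EN (\<lambda>A. (adj s1 s2 s3 s4 A)^2) \<le> 27 * adj_bound s1 s2 s3 s4"
proof -
  have "EN (\<lambda>A. (adj s1 s2 s3 s4 A)^2) \<le> 27 * (\<Sum>(i,j,k)\<in>distinct3 n. (coef3 s3 s4 i j k)^2
     * (Ed (i,j) (\<lambda>s. (cind s1 (i,j) s)^2) * Ed (j,k) (\<lambda>s. (cind s2 (j,k) s)^2)))"
    unfolding adj_def by (rule adjacent_second_moment) (auto simp: Ed_cind)
  also have "\<dots> \<le> 27 * adj_bound s1 s2 s3 s4"
    unfolding adj_bound_def
    by (intro mult_left_mono sum_mono) (auto intro!: mult_mono Ed_cind_sq_le mult_nonneg_nonneg Ed_sq_nonneg)
  finally show ?thesis .
qed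

text \<open>The factor 7 is Cauchy-Schwarz for seven summands; the three of opposite type contribute
  256 each, together 768.\<close>

lemma rest_second_moment_le:
  "EN (\<lambda>A. (rest s1 s2 s3 s4 A)^2) \<le> 7 * (768 * mean4 s1 s2 s3 s4
     + 27 * (adj_bound s1 s2 s3 s4 + adj_bound s2 s3 s4 s1 + adj_bound s3 s4 s1 s2 + adj_bound s4 s1 s2 s3))"
proof -
  define R where "R c = [adj s1 s2 s3 s4, adj s2 s3 s4 s1, adj s3 s4 s1 s2, adj s4 s1 s2 s3,
     opp (cind s1) (\<lambda>_. ind s2) (cind s3) (\<lambda>_. ind s4),
     opp (\<lambda>e _. pr s1 e) (cind s2) (\<lambda>_. ind s3) (cind s4),
     opp (cind s1) (cind s2) (\<lambda>e _. pr s3 e) (cind s4)] ! c" for c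
  have l7: "{..<7::nat} = {0,1,2,3,4,5,6}" by auto
  have "(rest s1 s2 s3 s4 A)^2 \<le> 7 * (\<Sum>c<7. (R c A)^2)" for A
  proof -
    have "rest s1 s2 s3 s4 A = (\<Sum>c<7. R c A)"
      unfolding rest_eq l7 R_def by (simp add: numeral_eq_Suc)
    thus ?thesis using sum_squared_le_sum_of_squares[of "\<lambda>c. R c A" "{..<7}"] by (simp add: mult.commute)
  qed
  hence "EN (\<lambda>A. (rest s1 s2 s3 s4 A)^2) \<le> EN (\<lambda>A. 7 * (\<Sum>c<7. (R c A)^2))"
    by (rule EN_mono)
  also have "\<dots> = 7 * (\<Sum>c<7. EN (\<lambda>A. (R c A)^2))" by (simp add: EN_sum)
  also have "(\<Sum>c<7. EN (\<lambda>A. (R c A)^2)) \<le> 27 * (adj_bound s1 s2 s3 s4 + adj_bound s2 s3 s4 s1 + adj_bound s3 s4 s1 s2 + adj_bound s4 s1 s2 s3) + 768 * mean4 s1 s2 s3 s4"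
  proof -
    have o1: "EN (\<lambda>A. (opp (cind s1) (\<lambda>_. ind s2) (cind s3) (\<lambda>_. ind s4) A)^2) \<le> 256 * mean4 s1 s2 s3 s4"
      by (rule opp_second_moment_le) (auto simp: Ed_cind Ed_cind_sq_le Ed_ind_sq)
    have o2: "EN (\<lambda>A. (opp (\<lambda>e _. pr s1 e) (cind s2) (\<lambda>_. ind s3) (cind s4) A)^2) \<le> 256 * mean4 s1 s2 s3 s4"
      by (rule opp_second_moment_le) (auto simp: Ed_cind Ed_cind_sq_le Ed_ind_sq pr_sq_le)
    have o3: "EN (\<lambda>A. (opp (cind s1) (cind s2) (\<lambda>e _. pr s3 e) (cind s4) A)^2) \<le> 256 * mean4 s1 s2 s3 s4"
      by (rule opp_second_moment_le) (auto simp: Ed_cind Ed_cind_sq_le Ed_ind_sq pr_sq_le)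
    show ?thesis unfolding l7 R_def
      using o1 o2 o3 adj_second_moment_le[of s1 s2 s3 s4] adj_second_moment_le[of s2 s3 s4 s1] adj_second_moment_le[of s3 s4 s1 s2] adj_second_moment_le[of s4 s1 s2 s3]
      by (simp add: numeral_eq_Suc)
  qed
  finally show ?thesis by simp
qed

text \<open>The variance is kept in the form p (1 - p): for an empty dyad it is 1 - p that is
  small.\<close>

lemma single_state_le:
  "EN (\<lambda>A. (\<Sum>e\<in>distinct2 n. w e * cind s e (state A e))^2)
     \<le> 4 * (\<Sum>e\<in>distinct2 n. (w e)^2 * (pr s e * (1 - pr s e)))"
  using single_second_moment[of "cind s" w] by (simp add: Ed_cind Ed_cind_sq)

lemma EN_cyc: "EN (cyc n s1 s2 s3 s4) = mean4 s1 s2 s3 s4"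
proof -
  have "EN (\<lambda>A. case t of (i,j,k,l) \<Rightarrow> ind s1 (state A (i,j)) * ind s2 (state A (j,k))
      * ind s3 (state A (k,l)) * ind s4 (state A (l,i)))
    = (case t of (i,j,k,l) \<Rightarrow> pr s1 (i,j) * pr s2 (j,k) * pr s3 (k,l) * pr s4 (l,i))"
    if t: "t \<in> distinct4 n" for t
  proof -
    obtain i j k l where t': "t = (i,j,k,l)" by (cases t)
    have "EN (\<lambda>A. \<Prod>c\<in>{..<4}. (ind ([s1,s2,s3,s4] ! c)) (state A (edges4 t c)))
       = (\<Prod>c\<in>{..<4}. Ed (edges4 t c) (ind ([s1,s2,s3,s4] ! c)))"
      by (rule EN_prod_edges[OF edges4_ok[OF t]])
    thus ?thesis by (simp add: t' lessThan_4 Ed_ind mult.assoc numeral_eq_Suc edges4_def)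
  qed
  thus ?thesis unfolding cyc_def mean4_def by (simp add: EN_sum cong: sum.cong)
qed

end

section \<open>Moment bounds in the p1 model\<close>

lemma sum_distinct2_le_sep:
  fixes G :: "nat \<times> nat \<Rightarrow> real"
  assumes "\<And>i j. i < n \<Longrightarrow> j < n \<Longrightarrow> G (i,j) \<le> c * (f i * g j)"
    and "c \<ge> 0" "\<And>i. f i \<ge> 0" "\<And>i. g i \<ge> 0"
  shows "(\<Sum>e\<in>distinct2 n. G e) \<le> c * ((\<Sum>i<n. f i) * (\<Sum>i<n. g i))"
proof -
  have "(\<Sum>e\<in>distinct2 n. G e) \<le> (\<Sum>(i,j)\<in>distinct2 n. c * (f i * g j))"
    by (rule sum_mono) (use assms(1) in \<open>auto simp: distinct2_def\<close>)
  also have "\<dots> \<le> (\<Sum>(i,j)\<in>{..<n}\<times>{..<n}. c * (f i * g j))"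
    by (rule sum_mono2) (use assms in \<open>auto simp: distinct2_def\<close>)
  also have "\<dots> = c * ((\<Sum>i<n. f i) * (\<Sum>i<n. g i))"
    by (simp add: sum.cartesian_product[symmetric] sum_distrib_left[symmetric] sum_distrib_right[symmetric])
  finally show ?thesis .
qed

lemma sum_distinct3_le_sep:
  fixes G :: "nat \<Rightarrow> nat \<Rightarrow> nat \<Rightarrow> real"
  assumes "\<And>i j k. i < n \<Longrightarrow> j < n \<Longrightarrow> k < n \<Longrightarrow> G i j k \<le> c * (f i * (g j * w k))"
    and "c \<ge> 0" "\<And>i. f i \<ge> 0" "\<And>i. g i \<ge> 0" "\<And>i. w i \<ge> 0"
  shows "(\<Sum>(i,j,k)\<in>distinct3 n. G i j k) \<le> c * ((\<Sum>i<n. f i) * ((\<Sum>i<n. g i) * (\<Sum>i<n. w i)))"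
proof -
  have "(\<Sum>(i,j,k)\<in>distinct3 n. G i j k) \<le> (\<Sum>(i,j,k)\<in>distinct3 n. c * (f i * (g j * w k)))"
    by (rule sum_mono) (use assms(1) in \<open>auto simp: distinct3_def\<close>)
  also have "\<dots> \<le> (\<Sum>(i,j,k)\<in>{..<n}\<times>{..<n}\<times>{..<n}. c * (f i * (g j * w k)))"
    by (rule sum_mono2) (use assms in \<open>auto simp: distinct3_def\<close>)
  also have "\<dots> = c * ((\<Sum>i<n. f i) * ((\<Sum>i<n. g i) * (\<Sum>i<n. w i)))"
    by (simp add: sum.cartesian_product[symmetric] sum_distrib_left[symmetric] sum_distrib_right[symmetric])
  finally show ?thesis .
qed

lemma sum_distinct4_le_sep:
  fixes G :: "nat \<Rightarrow> nat \<Rightarrow> nat \<Rightarrow> nat \<Rightarrow> real"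
  assumes "\<And>i j k l. i < n \<Longrightarrow> j < n \<Longrightarrow> k < n \<Longrightarrow> l < n \<Longrightarrow> G i j k l \<le> c * (f i * (g j * (w k * z l)))"
    and "c \<ge> 0" "\<And>i. f i \<ge> 0" "\<And>i. g i \<ge> 0" "\<And>i. w i \<ge> 0" "\<And>i. z i \<ge> 0"
  shows "(\<Sum>(i,j,k,l)\<in>distinct4 n. G i j k l) \<le> c * ((\<Sum>i<n. f i) * ((\<Sum>i<n. g i) * ((\<Sum>i<n. w i) * (\<Sum>i<n. z i))))"
proof -
  have "(\<Sum>(i,j,k,l)\<in>distinct4 n. G i j k l) \<le> (\<Sum>(i,j,k,l)\<in>distinct4 n. c * (f i * (g j * (w k * z l))))"
    by (rule sum_mono) (use assms(1) in \<open>auto simp: distinct4_def\<close>)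
  also have "\<dots> \<le> (\<Sum>(i,j,k,l)\<in>{..<n}\<times>{..<n}\<times>{..<n}\<times>{..<n}. c * (f i * (g j * (w k * z l))))"
    by (rule sum_mono2) (use assms in \<open>auto simp: distinct4_def\<close>)
  also have "\<dots> = c * ((\<Sum>i<n. f i) * ((\<Sum>i<n. g i) * ((\<Sum>i<n. w i) * (\<Sum>i<n. z i))))"
    by (simp add: sum.cartesian_product[symmetric] sum_distrib_left[symmetric] sum_distrib_right[symmetric])
  finally show ?thesis .
qed

context dyad_model begin

lemma coef3_le_sep:
  assumes "\<And>l. l < n \<Longrightarrow> pr s3 (k,l) * pr s4 (l,i) \<le> c * f l" "c \<ge> 0" "\<And>l. f l \<ge> 0"
  shows "coef3 s3 s4 i j k \<le> c * (\<Sum>l<n. f l)"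
proof -
  have "coef3 s3 s4 i j k \<le> (\<Sum>l\<in>{l. (i,j,k,l) \<in> distinct4 n}. c * f l)"
    unfolding coef3_def by (rule sum_mono) (use assms(1) in \<open>auto simp: distinct4_def\<close>)
  also have "\<dots> \<le> (\<Sum>l<n. c * f l)"
    by (rule sum_mono2) (use assms in \<open>auto simp: distinct4_def\<close>)
  finally show ?thesis by (simp add: sum_distrib_left)
qed

lemma coef3_nonneg: "coef3 s3 s4 i j k \<ge> 0"
  unfolding coef3_def by (intro sum_nonneg mult_nonneg_nonneg) auto

lemma coef2_nonneg: "coef2 s2 s3 s4 e \<ge> 0"
  unfolding coef2_def by (intro sum_nonneg) (auto intro!: mult_nonneg_nonneg)

lemma coef2_le_sep:
  assumes "\<And>k l. k < n \<Longrightarrow> l < n \<Longrightarrow> pr s2 (j,k) * pr s3 (k,l) * pr s4 (l,i) \<le> c * (f k * g l)"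
    "c \<ge> 0" "\<And>l. f l \<ge> 0" "\<And>l. g l \<ge> 0"
  shows "coef2 s2 s3 s4 (i,j) \<le> c * ((\<Sum>l<n. f l) * (\<Sum>l<n. g l))"
proof -
  have "coef2 s2 s3 s4 (i,j) \<le> (\<Sum>(k,l)\<in>{(k,l). (i,j,k,l) \<in> distinct4 n}. c * (f k * g l))"
    unfolding coef2_def fst_conv snd_conv by (rule sum_mono) (use assms(1) in \<open>auto simp: distinct4_def\<close>)
  also have "\<dots> \<le> (\<Sum>(k,l)\<in>{..<n}\<times>{..<n}. c * (f k * g l))"
    by (rule sum_mono2) (use assms in \<open>auto simp: distinct4_def\<close>)
  also have "\<dots> = c * ((\<Sum>l<n. f l) * (\<Sum>l<n. g l))"
    by (simp add: sum.cartesian_product[symmetric] sum_distrib_left[symmetric] sum_distrib_right[symmetric])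
  finally show ?thesis .
qed

text \<open>No single weight exceeds the fraction \<open>\<tau>\<close> of its total. Excluding the
  vertices in use therefore loses at most 2 \<open>\<tau>\<close> of the sum over k and 3
  \<open>\<tau>\<close> of the sum over l, together at most 5 \<open>\<tau>\<close>.\<close>

lemma coef2_ge_sep:
  assumes P: "\<And>k l. k < n \<Longrightarrow> l < n \<Longrightarrow> (i,j,k,l) \<in> distinct4 n \<Longrightarrow> c * (f k * g l) \<le> pr s2 (j,k) * pr s3 (k,l) * pr s4 (l,i)"
    and c: "c \<ge> 0" and f: "\<And>l. f l \<ge> 0" and g: "\<And>l. g l \<ge> 0"
    and ij: "(i,j) \<in> distinct2 n"
    and \<tau>: "0 \<le> \<tau>" "\<tau> \<le> 1/100"
    and fs: "\<And>l. l < n \<Longrightarrow> f l \<le> \<tau> * (\<Sum>l<n. f l)" and gs: "\<And>l. l < n \<Longrightarrow> g l \<le> \<tau> * (\<Sum>l<n. g l)"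
  shows "coef2 s2 s3 s4 (i,j) \<ge> (1 - 5 * \<tau>) * c * ((\<Sum>l<n. f l) * (\<Sum>l<n. g l))"
proof -
  let ?F = "\<Sum>l<n. f l" and ?G = "\<Sum>l<n. g l"
  have Fnn: "?F \<ge> 0" "?G \<ge> 0" using f g by (auto intro: sum_nonneg)
  have ij': "i < n" "j < n" "i \<noteq> j" using ij by (auto simp: distinct2_def)
  have inner: "(1 - 3 * \<tau>) * ?G \<le> (\<Sum>l\<in>{..<n} - {i,j,k}. g l)" if "k < n" "k \<noteq> i" "k \<noteq> j" for k
  proof -
    have "?G = (\<Sum>l\<in>{..<n} - {i,j,k}. g l) + (\<Sum>l\<in>{i,j,k}. g l)"
      by (rule sum.subset_diff) (use ij' that in auto)
    also have "(\<Sum>l\<in>{i,j,k}. g l) = g i + g j + g k" using ij' that by simp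
    finally show ?thesis using gs[OF ij'(1)] gs[OF ij'(2)] gs[OF that(1)] by (simp add: algebra_simps)
  qed
  have outer: "(1 - 2 * \<tau>) * ?F \<le> (\<Sum>k\<in>{..<n} - {i,j}. f k)"
  proof -
    have "?F = (\<Sum>l\<in>{..<n} - {i,j}. f l) + (\<Sum>l\<in>{i,j}. f l)"
      by (rule sum.subset_diff) (use ij' in auto)
    also have "(\<Sum>l\<in>{i,j}. f l) = f i + f j" using ij' by simp
    finally show ?thesis using fs[OF ij'(1)] fs[OF ij'(2)] by (simp add: algebra_simps)
  qed
  have set: "{(k,l). (i,j,k,l) \<in> distinct4 n} = (SIGMA k:{..<n} - {i,j}. {..<n} - {i,j,k})"
    using ij' by (auto simp: distinct4_def)
  have "(1 - 5 * \<tau>) * c * (?F * ?G) \<le> (1 - 2*\<tau>) * (1 - 3*\<tau>) * c * (?F * ?G)"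
    by (intro mult_right_mono) (use c Fnn \<tau> in \<open>auto simp: algebra_simps\<close>)
  also have "\<dots> = c * (((1 - 2 * \<tau>) * ?F) * ((1 - 3 * \<tau>) * ?G))" by (simp add: algebra_simps)
  also have "\<dots> \<le> c * ((\<Sum>k\<in>{..<n} - {i,j}. f k) * ((1 - 3 * \<tau>) * ?G))"
    by (intro mult_left_mono mult_right_mono outer c) (use Fnn \<tau> in auto)
  also have "\<dots> = (\<Sum>k\<in>{..<n} - {i,j}. c * (f k * ((1 - 3 * \<tau>) * ?G)))"
  proof -
    have "c * (sum f S * X) = (\<Sum>k\<in>S. c * (f k * X))" for S :: "nat set" and X
      by (simp add: sum_distrib_left sum_distrib_right)
    thus ?thesis .
  qed
  also have "\<dots> \<le> (\<Sum>k\<in>{..<n} - {i,j}. c * (f k * (\<Sum>l\<in>{..<n} - {i,j,k}. g l)))"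
    by (intro sum_mono mult_left_mono c f inner) auto
  also have "\<dots> = (\<Sum>k\<in>{..<n} - {i,j}. \<Sum>l\<in>{..<n} - {i,j,k}. c * (f k * g l))"
    by (simp add: sum_distrib_left)
  also have "\<dots> = (\<Sum>(k,l)\<in>{(k,l). (i,j,k,l) \<in> distinct4 n}. c * (f k * g l))"
    unfolding set by (rule sum.Sigma) auto
  also have "\<dots> \<le> coef2 s2 s3 s4 (i,j)"
    unfolding coef2_def fst_conv snd_conv by (rule sum_mono) (use P in \<open>auto simp: distinct4_def\<close>)
  finally show ?thesis .
qed

end

abbreviation (input) TT :: "bool \<times> bool" where "TT \<equiv> (True, True)"
abbreviation (input) TF :: "bool \<times> bool" where "TF \<equiv> (True, False)"
abbreviation (input) FT :: "bool \<times> bool" where "FT \<equiv> (False, True)"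
abbreviation (input) FF :: "bool \<times> bool" where "FF \<equiv> (False, False)"

locale p1_model =
  fixes n :: nat and \<rho> \<gamma> :: real and \<alpha> \<beta> :: "nat \<Rightarrow> real"
begin

definition mu :: "nat \<Rightarrow> real" where "mu i = exp (\<gamma> / 2 + \<alpha> i)"
definition nu :: "nat \<Rightarrow> real" where "nu i = exp (\<gamma> / 2 + \<beta> i)"
definition eta :: "nat \<Rightarrow> real" where "eta i = mu i * nu i"
definition dlaw :: "nat \<times> nat \<Rightarrow> (bool \<times> bool) pmf" where
  "dlaw = (\<lambda>(i, j). dyad_pmf (\<gamma> + \<alpha> i + \<beta> j) (\<gamma> + \<alpha> j + \<beta> i) \<rho>)"
definition a :: real where "a = exp \<rho>"
text \<open>Total weight of the nonempty states of a dyad when the empty state has weight 1; hence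
  \<open>K\<close> is the probability of an empty dyad.\<close>

definition om :: "nat \<Rightarrow> nat \<Rightarrow> real" where
  "om i j = mu i * nu j + mu j * nu i + a * eta i * eta j"
definition K :: "nat \<Rightarrow> nat \<Rightarrow> real" where "K i j = 1 / (1 + om i j)"

lemma mu_pos [simp]: "mu i > 0" and nu_pos [simp]: "nu i > 0" and eta_pos [simp]: "eta i > 0" and a_pos [simp]: "a > 0"
  by (simp_all add: mu_def nu_def eta_def a_def)

lemma nonneg [simp]: "mu i \<ge> 0" "nu i \<ge> 0" "eta i \<ge> 0" "a \<ge> 0"
  by (simp_all add: less_imp_le)

lemma om_nonneg [simp]: "om i j \<ge> 0" by (simp add: om_def)

lemma K_pos [simp]: "K i j > 0" and K_le_1: "K i j \<le> 1" and K_nonneg [simp]: "K i j \<ge> 0"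
proof -
  have "1 + om i j > 0" using om_nonneg[of i j] by linarith
  thus "K i j > 0" "K i j \<ge> 0" "K i j \<le> 1" by (simp_all add: K_def)
qed

lemma one_minus_K_le: "1 - K i j \<le> om i j"
proof -
  have "1 + om i j > 0" using om_nonneg[of i j] by linarith
  hence "1 - K i j = om i j / (1 + om i j)" by (simp add: K_def field_simps)
  also have "\<dots> \<le> om i j" using om_nonneg[of i j]
    by (simp add: divide_le_eq) (simp add: mult_le_cancel_left1 algebra_simps)
  finally show ?thesis .
qed

lemma dyad_w_eq:
  "dyad_w (\<gamma> + \<alpha> i + \<beta> j) (\<gamma> + \<alpha> j + \<beta> i) \<rho> FF = 1"
  "dyad_w (\<gamma> + \<alpha> i + \<beta> j) (\<gamma> + \<alpha> j + \<beta> i) \<rho> TF = mu i * nu j"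
  "dyad_w (\<gamma> + \<alpha> i + \<beta> j) (\<gamma> + \<alpha> j + \<beta> i) \<rho> FT = mu j * nu i"
  "dyad_w (\<gamma> + \<alpha> i + \<beta> j) (\<gamma> + \<alpha> j + \<beta> i) \<rho> TT = a * eta i * eta j"
  by (simp_all add: dyad_w_def mu_def nu_def eta_def a_def exp_add[symmetric] algebra_simps)

lemma UNIV_bool2: "(UNIV :: (bool \<times> bool) set) = {FF, TF, FT, TT}" by auto

lemma dyad_w_sum:
  "(\<Sum>c\<in>UNIV. dyad_w (\<gamma> + \<alpha> i + \<beta> j) (\<gamma> + \<alpha> j + \<beta> i) \<rho> c) = 1 + om i j"
  unfolding UNIV_bool2 by (simp add: dyad_w_eq om_def)

lemma pmf_dlaw:
  "pmf (dlaw (i,j)) FF = K i j"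
  "pmf (dlaw (i,j)) TF = K i j * (mu i * nu j)"
  "pmf (dlaw (i,j)) FT = K i j * (mu j * nu i)"
  "pmf (dlaw (i,j)) TT = K i j * (a * eta i * eta j)"
  unfolding dlaw_def by (simp_all add: pmf_dyad_pmf dyad_w_sum dyad_w_eq K_def)

sublocale dyad_model n dlaw
proof
  fix e :: "nat \<times> nat" assume "fst e \<noteq> snd e"
  obtain i j where e: "e = (i,j)" by (cases e)
  have K: "K j i = K i j" by (simp add: K_def om_def algebra_simps)
  have "pmf (dlaw (j,i)) s = pmf (map_pmf prod.swap (dlaw (i,j))) s" for s
  proof -
    obtain x y where s: "s = (x,y)" by (cases s)
    have "pmf (map_pmf prod.swap (dlaw (i,j))) (prod.swap (y,x)) = pmf (dlaw (i,j)) (y,x)"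
      by (rule pmf_map_inj') (simp add: inj_def)
    thus ?thesis unfolding s by (cases x; cases y) (simp_all add: pmf_dlaw K mult_ac)
  qed
  thus "dlaw (prod.swap e) = map_pmf prod.swap (dlaw e)" unfolding e by (simp add: pmf_eqI)
qed

lemma p1_pmf_eq: "p1_pmf n \<rho> \<gamma> \<alpha> \<beta> = NM"
  unfolding NM_def PM_def unfolding p1_pmf_def adjacency_def[abs_def] ordered_pairs_def dlaw_def ..

lemma pr_eq:
  "pr FF (i,j) = K i j" "pr TF (i,j) = K i j * (mu i * nu j)"
  "pr FT (i,j) = K i j * (mu j * nu i)" "pr TT (i,j) = K i j * (a * eta i * eta j)"
  by (simp_all add: pr_def pmf_dlaw)

lemma pr_le:
  "pr FF (i,j) \<le> 1" "pr TF (i,j) \<le> mu i * nu j"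
  "pr FT (i,j) \<le> mu j * nu i" "pr TT (i,j) \<le> a * eta i * eta j"
  unfolding pr_eq using K_le_1[of i j] by (auto intro!: mult_left_le_one_le)

definition h :: real where "h = (\<Sum>i<n. eta i)"
definition m :: real where "m = (\<Sum>i<n. mu i)"
definition v :: real where "v = (\<Sum>i<n. nu i)"
definition p :: real where "p = (\<Sum>i<n. mu i * eta i)"
definition q :: real where "q = (\<Sum>i<n. nu i * eta i)"
definition m2 :: real where "m2 = (\<Sum>i<n. (mu i)^2)"
definition v2 :: real where "v2 = (\<Sum>i<n. (nu i)^2)"
definition h2 :: real where "h2 = (\<Sum>i<n. (eta i)^2)"

lemma mean4_a_le: "mean4 TT FF FT FF \<le> a * (h * (h * (v * m)))"
  unfolding mean4_def h_def v_def m_def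
proof (rule sum_distinct4_le_sep)
  fix i j k l
  have "pr TT (i,j) * pr FF (j,k) * pr FT (k,l) * pr FF (l,i) \<le> (a * eta i * eta j) * 1 * (mu l * nu k) * 1"
    by (intro mult_mono pr_le) auto
  thus "pr TT (i,j) * pr FF (j,k) * pr FT (k,l) * pr FF (l,i) \<le> a * (eta i * (eta j * (nu k * mu l)))"
    by (simp add: mult_ac)
qed auto

lemma mean4_b_le: "mean4 TF TF FF TF \<le> 1 * (h * (h * (v * m)))"
  unfolding mean4_def h_def v_def m_def
proof (rule sum_distinct4_le_sep)
  fix i j k l
  have "pr TF (i,j) * pr TF (j,k) * pr FF (k,l) * pr TF (l,i) \<le> (mu i * nu j) * (mu j * nu k) * 1 * (mu l * nu i)"
    by (intro mult_mono pr_le) auto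
  thus "pr TF (i,j) * pr TF (j,k) * pr FF (k,l) * pr TF (l,i) \<le> 1 * (eta i * (eta j * (nu k * mu l)))"
    by (simp add: mult_ac eta_def)
qed auto

text \<open>Both cycle types carry the same four factors \<open>K\<close> and the same weight eta_i
  eta_j nu_k mu_l; the reciprocal edge adds exactly exp rho. This is the identity that makes U
  centred.\<close>

lemma mean4_a_eq: "mean4 TT FF FT FF = a * mean4 TF TF FF TF"
  unfolding mean4_def sum_distrib_left
  by (rule sum.cong) (auto simp: pr_eq eta_def mult_ac)

text \<open>\<open>C i k\<close> bounds the sum over the free vertex and depends only on the two
  ends of the path, so that the triple sum can factorise.\<close>

lemma adj_bound_le:
  assumes c3: "\<And>i j k. i < n \<Longrightarrow> j < n \<Longrightarrow> k < n \<Longrightarrow> coef3 s3 s4 i j k \<le> C i k"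
    and b: "\<And>i j k. i < n \<Longrightarrow> j < n \<Longrightarrow> k < n \<Longrightarrow> (C i k)^2 * (P i j * Q j k) \<le> c * (f i * (g j * w k))"
    and P: "\<And>i j. pr s1 (i,j) \<le> P i j" and Q: "\<And>i j. pr s2 (i,j) \<le> Q i j"
    and "c \<ge> 0" "\<And>i. f i \<ge> 0" "\<And>i. g i \<ge> 0" "\<And>i. w i \<ge> 0"
  shows "adj_bound s1 s2 s3 s4 \<le> c * ((\<Sum>i<n. f i) * ((\<Sum>i<n. g i) * (\<Sum>i<n. w i)))"
  unfolding adj_bound_def
proof (rule sum_distinct3_le_sep)
  fix i j k assume ijk: "i < n" "j < n" "k < n"
  have P0: "0 \<le> P i j" using pr_nonneg[of s1 "(i,j)"] P[of i j] by linarith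
  have "(coef3 s3 s4 i j k)^2 * (pr s1 (i, j) * pr s2 (j, k)) \<le> (C i k)^2 * (P i j * Q j k)"
    by (intro mult_mono power_mono c3 ijk P Q coef3_nonneg P0 mult_nonneg_nonneg) auto
  also have "\<dots> \<le> c * (f i * (g j * w k))" by (rule b[OF ijk])
  finally show "(coef3 s3 s4 i j k)^2 * (pr s1 (i, j) * pr s2 (j, k)) \<le> c * (f i * (g j * w k))" .
qed (use assms in auto)

lemma pr_mult_le:
  assumes "pr s (i,j) \<le> P" "pr s' (k,l) \<le> Q" "P * Q \<le> R"
  shows "pr s (i,j) * pr s' (k,l) \<le> R"
proof -
  have "pr s (i,j) * pr s' (k,l) \<le> P * Q"
    using assms(1,2) by (intro mult_mono) (auto intro: order_trans[OF pr_nonneg])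
  thus ?thesis using assms(3) by linarith
qed

section \<open>Adjacent centred pairs in the two cycle types\<close>

lemma adj_bound_a1: "adj_bound TT FF FT FF \<le> (a * m^2) * (h * (h * v2))"
  unfolding h_def v2_def
proof (rule adj_bound_le[where C="\<lambda>i k. nu k * m" and P="\<lambda>i j. a * eta i * eta j" and Q="\<lambda>_ _. 1"])
  show "coef3 FT FF i j k \<le> nu k * m" for i j k
    unfolding m_def by (rule coef3_le_sep) (auto intro!: pr_mult_le[OF pr_le(3) pr_le(1)])
qed (auto simp: pr_le pr_le(4)[unfolded mult.assoc] power_mult_distrib mult_ac)

lemma adj_bound_a2: "adj_bound FF FT FF TT \<le> (a^2 * h^2) * (h2 * (v * m))"
  unfolding h2_def v_def m_def
proof (rule adj_bound_le[where C="\<lambda>i k. (a * eta i) * h" and P="\<lambda>i j. 1" and Q="\<lambda>j k. mu k * nu j"])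
  show "coef3 FF TT i j k \<le> (a * eta i) * h" for i j k
    unfolding h_def by (rule coef3_le_sep) (auto intro!: pr_mult_le[OF pr_le(1) pr_le(4)])
qed (auto simp: pr_le pr_le(4)[unfolded mult.assoc] power_mult_distrib mult_ac)

lemma adj_bound_a3: "adj_bound FT FF TT FF \<le> (a^2 * h^2) * (v * (m * h2))"
  unfolding h2_def v_def m_def
proof (rule adj_bound_le[where C="\<lambda>i k. (a * eta k) * h" and P="\<lambda>i j. mu j * nu i" and Q="\<lambda>j k. 1"])
  show "coef3 TT FF i j k \<le> (a * eta k) * h" for i j k
    unfolding h_def by (rule coef3_le_sep) (auto intro!: pr_mult_le[OF pr_le(4) pr_le(1)])
qed (auto simp: pr_le pr_le(4)[unfolded mult.assoc] power_mult_distrib mult_ac)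

lemma adj_bound_a4: "adj_bound FF TT FF FT \<le> (a * v^2) * (m2 * (h * h))"
  unfolding h_def m2_def
proof (rule adj_bound_le[where C="\<lambda>i k. mu i * v" and P="\<lambda>i j. 1" and Q="\<lambda>i j. a * eta i * eta j"])
  show "coef3 FF FT i j k \<le> mu i * v" for i j k
    unfolding v_def by (rule coef3_le_sep) (auto intro!: pr_mult_le[OF pr_le(1) pr_le(3)])
qed (auto simp: pr_le pr_le(4)[unfolded mult.assoc] power_mult_distrib mult_ac)

lemma adj_bound_b1: "adj_bound TF TF FF TF \<le> m^2 * (q * (h * v))"
  unfolding h_def v_def q_def
proof (rule adj_bound_le[where C="\<lambda>i k. nu i * m" and P="\<lambda>i j. mu i * nu j" and Q="\<lambda>i j. mu i * nu j"])
  show "coef3 FF TF i j k \<le> nu i * m" for i j k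
    unfolding m_def by (rule coef3_le_sep) (auto intro!: pr_mult_le[OF pr_le(1) pr_le(2)])
qed (auto simp: pr_le pr_le(4)[unfolded mult.assoc] power_mult_distrib eta_def power2_eq_square mult_ac)

lemma coef3_TF_TF: "coef3 TF TF i j k \<le> (mu k * nu i) * h"
  unfolding h_def by (rule coef3_le_sep) (auto intro!: pr_mult_le[OF pr_le(2) pr_le(2)] simp: eta_def)

lemma adj_bound_b2: "adj_bound TF FF TF TF \<le> h^2 * (q * (v * m2))"
  unfolding v_def q_def m2_def
  by (rule adj_bound_le[where C="\<lambda>i k. (mu k * nu i) * h" and P="\<lambda>i j. mu i * nu j" and Q="\<lambda>i j. 1", OF coef3_TF_TF])
     (auto simp: pr_le power_mult_distrib eta_def power2_eq_square mult_ac)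

lemma adj_bound_b3: "adj_bound FF TF TF TF \<le> h^2 * (v2 * (m * p))"
  unfolding m_def p_def v2_def
  by (rule adj_bound_le[where C="\<lambda>i k. (mu k * nu i) * h" and P="\<lambda>i j. 1" and Q="\<lambda>i j. mu i * nu j", OF coef3_TF_TF])
     (auto simp: pr_le power_mult_distrib eta_def power2_eq_square mult_ac)

lemma adj_bound_b4: "adj_bound TF TF TF FF \<le> v^2 * (m * (h * p))"
  unfolding h_def m_def p_def
proof (rule adj_bound_le[where C="\<lambda>i k. mu k * v" and P="\<lambda>i j. mu i * nu j" and Q="\<lambda>i j. mu i * nu j"])
  show "coef3 TF FF i j k \<le> mu k * v" for i j k
    unfolding v_def by (rule coef3_le_sep) (auto intro!: pr_mult_le[OF pr_le(2) pr_le(1)])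
qed (auto simp: pr_le pr_le(4)[unfolded mult.assoc] power_mult_distrib eta_def power2_eq_square mult_ac)

end

section \<open>The sparse regime\<close>

text \<open>The parameter \<open>\<tau>\<close> dominates every quantity that (G1), (G2) and (SP1) send to 0.\<close>

locale p1_small = p1_model +
  fixes mx nx ex \<tau> :: real
  assumes tau: "0 < \<tau>" "\<tau> \<le> 1/100"
    and mu_le: "\<And>i. i < n \<Longrightarrow> mu i \<le> mx"
    and nu_le: "\<And>i. i < n \<Longrightarrow> nu i \<le> nx"
    and eta_le: "\<And>i. i < n \<Longrightarrow> eta i \<le> ex"
    and mx_tau: "mx \<le> \<tau>" and nx_tau: "nx \<le> \<tau>" and aex: "a * ex^2 \<le> \<tau>" and ex_le: "ex \<le> mx * nx"
    and h_ge: "1 \<le> \<tau> * h" and ah_ge: "1 \<le> \<tau> * (a * h^2)"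
    and sp: "mx^2 * nx^2 \<le> \<tau> * (p * q)"
begin

lemma tau_nonneg [simp]: "0 \<le> \<tau>" "\<tau> \<le> 1" using tau by auto

lemma h_pos: "h > 0" using h_ge tau by (metis less_le_trans zero_less_mult_pos zero_less_one)
lemma h_ge_1: "1 \<le> h" using h_ge mult_right_mono[OF tau_nonneg(2), of h] h_pos by linarith

lemma n_pos: "n > 0"
proof (rule ccontr)
  assume "\<not> n > 0" hence "h = 0" unfolding h_def by simp
  thus False using h_pos by simp
qed

lemma mx_pos: "mx > 0" using mu_le[OF n_pos] mu_pos[of 0] by linarith
lemma nx_pos: "nx > 0" using nu_le[OF n_pos] nu_pos[of 0] by linarith
lemma ex_pos: "ex > 0" using eta_le[OF n_pos] eta_pos[of 0] by linarith

lemma mx_le_1: "mx \<le> 1" and nx_le_1: "nx \<le> 1" using mx_tau nx_tau tau by auto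

lemma sums_nonneg [simp]: "h \<ge> 0" "m \<ge> 0" "v \<ge> 0" "p \<ge> 0" "q \<ge> 0" "m2 \<ge> 0" "v2 \<ge> 0" "h2 \<ge> 0" "mx \<ge> 0" "nx \<ge> 0" "ex \<ge> 0"
  using mx_pos nx_pos ex_pos
  by (auto simp: h_def m_def v_def p_def q_def m2_def v2_def h2_def intro!: sum_nonneg)

section \<open>Inequalities between the weighted sums\<close>

lemma sum_mult_le:
  assumes "\<And>i. i < n \<Longrightarrow> f i \<le> c" "\<And>i. g i \<ge> (0::real)"
  shows "(\<Sum>i<n. f i * g i) \<le> c * (\<Sum>i<n. g i)"
  unfolding sum_distrib_left by (intro sum_mono mult_right_mono) (use assms in auto)

lemma h_le_v: "h \<le> mx * v" unfolding h_def v_def eta_def by (rule sum_mult_le) (auto simp: mu_le)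
lemma h_le_m: "h \<le> nx * m" unfolding h_def m_def eta_def
  using sum_mult_le[of nu nx mu] by (auto simp: nu_le mult.commute)
lemma p_le_h: "p \<le> mx * h" unfolding p_def h_def by (rule sum_mult_le) (auto simp: mu_le)
lemma q_le_h: "q \<le> nx * h" unfolding q_def h_def by (rule sum_mult_le) (auto simp: nu_le)
lemma p_le_m: "p \<le> ex * m" unfolding p_def m_def
  using sum_mult_le[of eta ex mu] by (auto simp: eta_le mult.commute)
lemma m2_le: "m2 \<le> mx * m" unfolding m2_def m_def power2_eq_square by (rule sum_mult_le) (auto simp: mu_le)
lemma v2_le: "v2 \<le> nx * v" unfolding v2_def v_def power2_eq_square by (rule sum_mult_le) (auto simp: nu_le)
lemma h2_le: "h2 \<le> ex * h" unfolding h2_def h_def power2_eq_square by (rule sum_mult_le) (auto simp: eta_le)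

text \<open>Cauchy-Schwarz for the splitting of eta into mu sqrt nu and sqrt nu; exchanging mu and
  nu gives the companion bound.\<close>

lemma h_sq_le_pv: "h^2 \<le> p * v"
proof -
  have "(\<Sum>i<n. (mu i * sqrt (nu i)) * sqrt (nu i))^2 \<le> (\<Sum>i<n. (mu i * sqrt (nu i))^2) * (\<Sum>i<n. (sqrt (nu i))^2)"
    by (rule Cauchy_Schwarz_ineq_sum)
  moreover have "(mu i * sqrt (nu i)) * sqrt (nu i) = eta i" for i
    by (simp add: eta_def mult.assoc)
  moreover have "(mu i * sqrt (nu i))^2 = mu i * eta i" for i
    by (simp add: eta_def power_mult_distrib power2_eq_square)
  ultimately show ?thesis by (simp add: h_def p_def v_def)
qed

lemma h_sq_le_qm: "h^2 \<le> q * m"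
proof -
  have "(\<Sum>i<n. (nu i * sqrt (mu i)) * sqrt (mu i))^2 \<le> (\<Sum>i<n. (nu i * sqrt (mu i))^2) * (\<Sum>i<n. (sqrt (mu i))^2)"
    by (rule Cauchy_Schwarz_ineq_sum)
  moreover have "(nu i * sqrt (mu i)) * sqrt (mu i) = eta i" for i
    by (simp add: eta_def mult.assoc)
  moreover have "(nu i * sqrt (mu i))^2 = nu i * eta i" for i
    by (simp add: eta_def power_mult_distrib power2_eq_square)
  ultimately show ?thesis by (simp add: h_def q_def m_def)
qed

lemma one_le_tau_m: "1 \<le> \<tau> * m"
  using h_le_m h_ge_1 mult_right_mono[OF nx_tau sums_nonneg(2)] by linarith
lemma one_le_tau_v: "1 \<le> \<tau> * v"
  using h_le_v h_ge_1 mult_right_mono[OF mx_tau sums_nonneg(3)] by linarith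
lemma m_ge_1: "1 \<le> m" using one_le_tau_m mult_right_mono[OF tau_nonneg(2) sums_nonneg(2)] by linarith
lemma v_ge_1: "1 \<le> v" using one_le_tau_v mult_right_mono[OF tau_nonneg(2) sums_nonneg(3)] by linarith
lemma one_le_tau_mv: "1 \<le> \<tau> * (m * v)"
proof -
  have "1 * 1 \<le> (\<tau> * m) * v" by (rule mult_mono) (use one_le_tau_m v_ge_1 in auto)
  thus ?thesis by (simp add: mult_ac)
qed
lemma one_le_tau_h_sq: "1 \<le> \<tau> * h^2"
proof -
  have "1 * 1 \<le> (\<tau> * h) * h" by (rule mult_mono) (use h_ge h_ge_1 in auto)
  thus ?thesis by (simp add: mult_ac power2_eq_square)
qed
lemma h_pow4_le: "h^2 * h^2 \<le> (p * v) * (q * m)" by (rule mult_mono) (use h_sq_le_pv h_sq_le_qm in auto)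
lemma h_le_tpv: "h \<le> \<tau> * (p * v)"
proof -
  have "h * 1 \<le> h * (\<tau> * h)" by (rule mult_left_mono) (use h_ge in auto)
  also have "\<dots> = \<tau> * h^2" by (simp add: power2_eq_square)
  also have "\<dots> \<le> \<tau> * (p * v)" by (rule mult_left_mono[OF h_sq_le_pv]) simp
  finally show ?thesis by simp
qed
lemma h_le_tqm: "h \<le> \<tau> * (q * m)"
proof -
  have "h * 1 \<le> h * (\<tau> * h)" by (rule mult_left_mono) (use h_ge in auto)
  also have "\<dots> = \<tau> * h^2" by (simp add: power2_eq_square)
  also have "\<dots> \<le> \<tau> * (q * m)" by (rule mult_left_mono[OF h_sq_le_qm]) simp
  finally show ?thesis by simp
qed
lemma mx_le_tau_m: "mx \<le> \<tau> * m" using mx_le_1 one_le_tau_m by linarith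
lemma nx_le_tau_v: "nx \<le> \<tau> * v" using nx_le_1 one_le_tau_v by linarith
lemma ex_le_tau_h: "ex \<le> \<tau> * h"
proof -
  have "mx * nx \<le> 1 * 1" by (rule mult_mono) (use mx_le_1 nx_le_1 in auto)
  thus ?thesis using ex_le h_ge by linarith
qed
lemma mx_nx_le_tau: "mx * nx \<le> \<tau>"
proof -
  have "mx * nx \<le> \<tau> * 1" by (rule mult_mono) (use mx_tau nx_le_1 in auto)
  thus ?thesis by simp
qed
lemma mx_sq_nx_sq_le_tau: "mx^2 * nx^2 \<le> \<tau>"
proof -
  have "(mx * nx) * (mx * nx) \<le> \<tau> * 1" by (rule mult_mono) (use mx_nx_le_tau tau in auto)
  thus ?thesis by (simp add: power2_eq_square mult_ac)
qed
lemma ex_sq_le_tau: "ex^2 \<le> \<tau>"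
proof -
  have "ex^2 \<le> (mx * nx)^2" by (rule power_mono[OF ex_le]) simp
  thus ?thesis using mx_sq_nx_sq_le_tau by (simp add: power_mult_distrib)
qed
lemma h_sq_le_ex_mv: "h^2 \<le> ex * (m * v)"
proof -
  have "p * v \<le> (ex * m) * v" by (rule mult_right_mono[OF p_le_m]) simp
  thus ?thesis using h_sq_le_pv by (simp add: mult_ac)
qed
text \<open>(G1) controls \<open>a * ex^2\<close>, not \<open>a * ex * h\<close>. Multiplying by
  \<open>ex\<close> brings in the controlled quantity, h >= 1 and h^2 <= ex m v supply the
  right-hand side, and \<open>ex\<close> is cancelled again.\<close>

lemma a_ex_h_le: "a * ex * h \<le> \<tau> * (m * v)"
proof -
  have "(a * ex * h) * ex \<le> \<tau> * h"
    using mult_right_mono[OF aex sums_nonneg(1)] by (simp add: power2_eq_square mult_ac)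
  also have "\<dots> \<le> \<tau> * (h * h)" using h_ge_1 mult_left_mono[of 1 h h] by (intro mult_left_mono) auto
  also have "\<dots> \<le> \<tau> * (ex * (m * v))" using h_sq_le_ex_mv by (intro mult_left_mono) (auto simp: power2_eq_square)
  finally have "(a * ex * h) * ex \<le> (\<tau> * (m * v)) * ex" by (simp add: mult_ac)
  thus ?thesis using ex_pos by (rule mult_right_le_imp_le)
qed

section \<open>Second moments of the nonlinear terms\<close>

definition M1 :: real where "M1 = a * h^2 * (m^2 * v^2)"
definition M2 :: real where "M2 = a^2 * (m^2 * v^2) * (p * q)"
lemma M_nonneg [simp]: "M1 \<ge> 0" "M2 \<ge> 0" by (simp_all add: M1_def M2_def)

text \<open>The constant is 7 * (768 + 4 * 27) = 6132.\<close>

lemma rest_le_mult: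
  assumes "mean4 s1 s2 s3 s4 \<le> T" "adj_bound s1 s2 s3 s4 \<le> T" "adj_bound s2 s3 s4 s1 \<le> T"
    "adj_bound s3 s4 s1 s2 \<le> T" "adj_bound s4 s1 s2 s3 \<le> T"
  shows "EN (\<lambda>A. (rest s1 s2 s3 s4 A)^2) \<le> 6132 * T"
proof -
  have "7 * (768 * x + 27 * (b1 + b2 + b3 + b4)) \<le> 6132 * T"
    if "x \<le> T" "b1 \<le> T" "b2 \<le> T" "b3 \<le> T" "b4 \<le> T" for x b1 b2 b3 b4
    using that by argo
  from order_trans[OF rest_second_moment_le this[OF assms]] show ?thesis .
qed

text \<open>Each bound falls short of \<open>M1\<close> by one small ratio: 1 / (m v) for the mean,
  and v2 / v^2, m2 / m^2 or a h2 / (m v) for the adjacent pairs.\<close>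

lemma rest_a_second_moment_le: "EN (\<lambda>A. (rest TT FF FT FF A)^2) \<le> 6132 * (\<tau> * M1)"
proof -
  have t0: "a * (h * (h * (v * m))) \<le> \<tau> * M1"
  proof -
    have "(a * h^2 * (v * m)) * 1 \<le> (a * h^2 * (v * m)) * (\<tau> * (m * v))"
      by (rule mult_left_mono[OF one_le_tau_mv]) auto
    thus ?thesis by (simp add: M1_def power2_eq_square mult_ac)
  qed
  have t1: "(a * m^2) * (h * (h * v2)) \<le> \<tau> * M1"
  proof -
    have "v2 \<le> (\<tau> * v) * v" using v2_le mult_right_mono[OF nx_le_tau_v sums_nonneg(3)] by linarith
    hence "(a * m^2 * h^2) * v2 \<le> (a * m^2 * h^2) * ((\<tau> * v) * v)" by (rule mult_left_mono) auto
    thus ?thesis by (simp add: M1_def power2_eq_square mult_ac)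
  qed
  have t4: "(a * v^2) * (m2 * (h * h)) \<le> \<tau> * M1"
  proof -
    have "m2 \<le> (\<tau> * m) * m" using m2_le mult_right_mono[OF mx_le_tau_m sums_nonneg(2)] by linarith
    hence "(a * v^2 * h^2) * m2 \<le> (a * v^2 * h^2) * ((\<tau> * m) * m)" by (rule mult_left_mono) auto
    thus ?thesis by (simp add: M1_def power2_eq_square mult_ac)
  qed
  have t2: "(a^2 * h^2) * (h2 * (v * m)) \<le> \<tau> * M1"
  proof -
    have "a * h2 \<le> a * (ex * h)" by (rule mult_left_mono[OF h2_le]) simp
    hence "a * h2 \<le> \<tau> * (m * v)" using a_ex_h_le by (simp only: mult.assoc)
    hence "(a * h^2 * (m * v)) * (a * h2) \<le> (a * h^2 * (m * v)) * (\<tau> * (m * v))" by (rule mult_left_mono) auto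
    thus ?thesis by (simp add: M1_def power2_eq_square mult_ac)
  qed
  have t3: "(a^2 * h^2) * (v * (m * h2)) \<le> \<tau> * M1" using t2 by (simp add: mult_ac)
  show ?thesis
    by (rule rest_le_mult[OF order_trans[OF mean4_a_le t0] order_trans[OF adj_bound_a1 t1] order_trans[OF adj_bound_a2 t2]
          order_trans[OF adj_bound_a3 t3] order_trans[OF adj_bound_a4 t4]])
qed

text \<open>The inequalities h^2 <= p v and h^2 <= q m trade powers of h for the factor p q of
  \<open>M2\<close>; what remains is again one small ratio per term.\<close>

lemma rest_b_second_moment_le: "a^2 * EN (\<lambda>A. (rest TF TF FF TF A)^2) \<le> 6132 * (\<tau> * M2)"
proof -
  define N where "N = m^2 * v^2 * (p * q)"
  have t0: "h * (h * (v * m)) \<le> \<tau> * N"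
  proof -
    have "h^2 * 1 \<le> h^2 * (\<tau> * h^2)" by (rule mult_left_mono[OF one_le_tau_h_sq]) simp
    also have "\<dots> = \<tau> * (h^2 * h^2)" by simp
    also have "\<dots> \<le> \<tau> * ((p * v) * (q * m))" by (rule mult_left_mono[OF h_pow4_le]) simp
    finally have "(h^2 * 1) * (v * m) \<le> (\<tau> * ((p * v) * (q * m))) * (v * m)" by (rule mult_right_mono) auto
    thus ?thesis by (simp add: N_def power2_eq_square mult_ac)
  qed
  have t1: "m^2 * (q * (h * v)) \<le> \<tau> * N"
  proof -
    have "(m^2 * q * v) * h \<le> (m^2 * q * v) * (\<tau> * (p * v))" by (rule mult_left_mono[OF h_le_tpv]) auto
    thus ?thesis by (simp add: N_def power2_eq_square mult_ac)
  qed
  have t4: "v^2 * (m * (h * p)) \<le> \<tau> * N"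
  proof -
    have "(v^2 * m * p) * h \<le> (v^2 * m * p) * (\<tau> * (q * m))" by (rule mult_left_mono[OF h_le_tqm]) auto
    thus ?thesis by (simp add: N_def power2_eq_square mult_ac)
  qed
  have t2: "h^2 * (q * (v * m2)) \<le> \<tau> * N"
  proof -
    have "m2 \<le> (\<tau> * m) * m" using m2_le mult_right_mono[OF mx_le_tau_m sums_nonneg(2)] by linarith
    hence "h^2 * m2 \<le> (p * v) * ((\<tau> * m) * m)" by (intro mult_mono h_sq_le_pv) auto
    hence "(q * v) * (h^2 * m2) \<le> (q * v) * ((p * v) * ((\<tau> * m) * m))" by (rule mult_left_mono) auto
    thus ?thesis by (simp add: N_def power2_eq_square mult_ac)
  qed
  have t3: "h^2 * (v2 * (m * p)) \<le> \<tau> * N"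
  proof -
    have "v2 \<le> (\<tau> * v) * v" using v2_le mult_right_mono[OF nx_le_tau_v sums_nonneg(3)] by linarith
    hence "h^2 * v2 \<le> (q * m) * ((\<tau> * v) * v)" by (intro mult_mono h_sq_le_qm) auto
    hence "(m * p) * (h^2 * v2) \<le> (m * p) * ((q * m) * ((\<tau> * v) * v))" by (rule mult_left_mono) auto
    thus ?thesis by (simp add: N_def power2_eq_square mult_ac)
  qed
  have "EN (\<lambda>A. (rest TF TF FF TF A)^2) \<le> 6132 * (\<tau> * N)"
    by (rule rest_le_mult[OF order_trans[OF mean4_b_le] order_trans[OF adj_bound_b1 t1] order_trans[OF adj_bound_b2 t2]
          order_trans[OF adj_bound_b3 t3] order_trans[OF adj_bound_b4 t4]]) (use t0 in simp)
  hence "a^2 * EN (\<lambda>A. (rest TF TF FF TF A)^2) \<le> a^2 * (6132 * (\<tau> * N))" by (rule mult_left_mono) simp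
  thus ?thesis by (simp add: M2_def N_def mult_ac)
qed

section \<open>Asymptotics of the completion coefficients\<close>

lemma om_le: assumes "i < n" "j < n" shows "om i j \<le> 2 * \<tau>"
proof -
  have "mu i * nu j \<le> mx * nx" "mu j * nu i \<le> mx * nx"
    using assms by (auto intro!: mult_mono mu_le nu_le)
  moreover have "mx * nx \<le> \<tau> * \<tau>" by (rule mult_mono) (use mx_tau nx_tau in auto)
  moreover have "\<tau> * \<tau> \<le> \<tau> * (1/100)" by (rule mult_left_mono) (use tau in auto)
  moreover have "a * eta i * eta j \<le> \<tau>"
  proof -
    have "a * (eta i * eta j) \<le> a * (ex * ex)" using assms by (intro mult_left_mono mult_mono eta_le) auto
    also have "\<dots> \<le> \<tau>" using aex by (simp add: power2_eq_square)
    finally show ?thesis by (simp add: mult.assoc)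
  qed
  ultimately show ?thesis unfolding om_def using tau by linarith
qed

lemma K_ge: assumes "i < n" "j < n" shows "K i j \<ge> 1 - 2 * \<tau>"
  using one_minus_K_le[of i j] om_le[OF assms] by linarith

lemma K_half: assumes "i < n" "j < n" shows "K i j \<ge> 1/2"
  using K_ge[OF assms] tau by linarith

lemma K3_ge:
  assumes "i < n" "j < n" "k < n" "l < n"
  shows "K j k * K k l * K l i \<ge> 1 - 6 * \<tau>"
proof -
  have 1: "1 - 2*\<tau> \<ge> 0" using tau by auto
  have "(1 - 2*\<tau>) * (1 - 2*\<tau>) * (1 - 2*\<tau>) \<le> K j k * K k l * K l i"
    by (intro mult_mono K_ge assms) (use 1 in auto)
  moreover have "1 - 6 * \<tau> \<le> (1 - 2*\<tau>) * (1 - 2*\<tau>) * (1 - 2*\<tau>)"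
  proof -
    have "(1 - 2*\<tau>) * (1 - 2*\<tau>) * (1 - 2*\<tau>) - (1 - 6*\<tau>) = \<tau> * \<tau> * (12 - 8 * \<tau>)" by (simp add: algebra_simps)
    moreover have "\<tau> * \<tau> * (12 - 8 * \<tau>) \<ge> 0" using tau by (intro mult_nonneg_nonneg) auto
    ultimately show ?thesis by linarith
  qed
  ultimately show ?thesis by linarith
qed

lemma K3_le: "K j k * K k l * K l i \<le> 1"
proof -
  have "K j k * K k l * K l i \<le> 1 * 1 * 1" by (intro mult_mono K_le_1) auto
  thus ?thesis by simp
qed

text \<open>The relative error 11 \<open>\<tau>\<close> consists of 5 \<open>\<tau>\<close> for
  excluding the vertices in use and 6 \<open>\<tau>\<close> for the three factors \<open>K\<close>,
  each at least 1 - 2 \<open>\<tau>\<close>.\<close>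

lemma coef2_approx:
  assumes P: "\<And>k l. pr s2 (j,k) * pr s3 (k,l) * pr s4 (l,i) = (K j k * K k l * K l i) * (c * (f k * g l))"
    and c: "c \<ge> 0" and f: "\<And>l. f l \<ge> 0" and g: "\<And>l. g l \<ge> 0"
    and ij: "(i,j) \<in> distinct2 n"
    and F: "F = (\<Sum>l<n. f l)" and G: "G = (\<Sum>l<n. g l)"
    and fs: "\<And>l. l < n \<Longrightarrow> f l \<le> \<tau> * F" and gs: "\<And>l. l < n \<Longrightarrow> g l \<le> \<tau> * G"
  shows "\<bar>coef2 s2 s3 s4 (i,j) - c * (F * G)\<bar> \<le> 11 * \<tau> * (c * (F * G))"
    and "coef2 s2 s3 s4 (i,j) \<le> c * (F * G)"
proof -
  have ij': "i < n" "j < n" using ij by (auto simp: distinct2_def)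
  have cfg: "c * (f k * g l) \<ge> 0" for k l using c f g by simp
  show up: "coef2 s2 s3 s4 (i,j) \<le> c * (F * G)"
    unfolding F G
  proof (rule coef2_le_sep)
    show "pr s2 (j,k) * pr s3 (k,l) * pr s4 (l,i) \<le> c * (f k * g l)" for k l
      unfolding P by (rule mult_left_le_one_le) (use cfg K3_le in auto)
  qed (use c f g in auto)
  have FG: "F * G \<ge> 0" unfolding F G using f g by (intro mult_nonneg_nonneg sum_nonneg) auto
  have "(1 - 5 * \<tau>) * ((1 - 6*\<tau>) * c) * (F * G) \<le> coef2 s2 s3 s4 (i,j)"
    unfolding F G
  proof (rule coef2_ge_sep[OF _ _ f g ij])
    show "(1 - 6*\<tau>) * c * (f k * g l) \<le> pr s2 (j,k) * pr s3 (k,l) * pr s4 (l,i)" if "k < n" "l < n" for k l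
      unfolding P using mult_right_mono[OF K3_ge[OF ij' that] cfg[of k l]] by (simp add: mult_ac)
  qed (use tau c fs gs F G in auto)
  moreover have "(1 - 11 * \<tau>) * (c * (F * G)) \<le> (1 - 5 * \<tau>) * ((1 - 6*\<tau>) * c) * (F * G)"
  proof -
    have "(1 - 11 * \<tau>) * (c * (F * G)) \<le> ((1 - 5 * \<tau>) * (1 - 6*\<tau>)) * (c * (F * G))"
      by (rule mult_right_mono[OF _ mult_nonneg_nonneg[OF c FG]]) (simp add: algebra_simps)
    thus ?thesis by (simp add: mult_ac)
  qed
  ultimately have "(1 - 11 * \<tau>) * (c * (F * G)) \<le> coef2 s2 s3 s4 (i,j)" by linarith
  hence "c * (F * G) - 11 * \<tau> * (c * (F * G)) \<le> coef2 s2 s3 s4 (i,j)" by (simp add: left_diff_distrib)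
  moreover have "c * (F * G) \<ge> 0" using c FG by (rule mult_nonneg_nonneg)
  hence "11 * \<tau> * (c * (F * G)) \<ge> 0" by (intro mult_nonneg_nonneg[of "11 * \<tau>"]) auto
  ultimately show "\<bar>coef2 s2 s3 s4 (i,j) - c * (F * G)\<bar> \<le> 11 * \<tau> * (c * (F * G))" using up by linarith
qed

lemma mu_small: "l < n \<Longrightarrow> mu l \<le> \<tau> * m" using mu_le mx_le_tau_m by force
lemma nu_small: "l < n \<Longrightarrow> nu l \<le> \<tau> * v" using nu_le nx_le_tau_v by force
lemma eta_small: "l < n \<Longrightarrow> eta l \<le> \<tau> * h" using eta_le ex_le_tau_h by force

lemma coef2_FF_FT_FF:
  assumes "(i,j) \<in> distinct2 n"
  shows "\<bar>coef2 FF FT FF (i,j) - 1 * (v * m)\<bar> \<le> 11 * \<tau> * (1 * (v * m))" "coef2 FF FT FF (i,j) \<le> 1 * (v * m)"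
proof -
  have e: "pr FF (j,k) * pr FT (k,l) * pr FF (l,i) = (K j k * K k l * K l i) * (1 * (nu k * mu l))" for k l
    by (simp add: pr_eq)
  show "\<bar>coef2 FF FT FF (i,j) - 1 * (v * m)\<bar> \<le> 11 * \<tau> * (1 * (v * m))" "coef2 FF FT FF (i,j) \<le> 1 * (v * m)"
    by (rule coef2_approx[OF e _ _ _ assms v_def m_def nu_small mu_small]; simp)+
qed

lemma coef2_FF_TT_FF:
  assumes "(i,j) \<in> distinct2 n"
  shows "\<bar>coef2 FF TT FF (i,j) - a * (h * h)\<bar> \<le> 11 * \<tau> * (a * (h * h))" "coef2 FF TT FF (i,j) \<le> a * (h * h)"
proof -
  have e: "pr FF (j,k) * pr TT (k,l) * pr FF (l,i) = (K j k * K k l * K l i) * (a * (eta k * eta l))" for k l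
    by (simp add: pr_eq)
  show "\<bar>coef2 FF TT FF (i,j) - a * (h * h)\<bar> \<le> 11 * \<tau> * (a * (h * h))" "coef2 FF TT FF (i,j) \<le> a * (h * h)"
    by (rule coef2_approx[OF e _ _ _ assms h_def h_def eta_small eta_small]; simp)+
qed

lemma coef2_TF_FF_TF:
  assumes "(i,j) \<in> distinct2 n"
  shows "\<bar>coef2 TF FF TF (i,j) - (mu j * nu i) * (v * m)\<bar> \<le> 11 * \<tau> * ((mu j * nu i) * (v * m))"
proof -
  have e: "pr TF (j,k) * pr FF (k,l) * pr TF (l,i) = (K j k * K k l * K l i) * ((mu j * nu i) * (nu k * mu l))" for k l
    by (simp add: pr_eq)
  show ?thesis by (rule coef2_approx(1)[OF e _ _ _ assms v_def m_def nu_small mu_small]; simp)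
qed

lemma coef2_FF_TF_TF:
  assumes "(i,j) \<in> distinct2 n"
  shows "\<bar>coef2 FF TF TF (i,j) - nu i * (m * h)\<bar> \<le> 11 * \<tau> * (nu i * (m * h))"
proof -
  have e: "pr FF (j,k) * pr TF (k,l) * pr TF (l,i) = (K j k * K k l * K l i) * (nu i * (mu k * eta l))" for k l
    by (simp add: pr_eq eta_def)
  show ?thesis by (rule coef2_approx(1)[OF e _ _ _ assms m_def h_def mu_small eta_small]; simp)
qed

lemma coef2_TF_TF_FF:
  assumes "(i,j) \<in> distinct2 n"
  shows "\<bar>coef2 TF TF FF (i,j) - mu j * (h * v)\<bar> \<le> 11 * \<tau> * (mu j * (h * v))"
proof -
  have e: "pr TF (j,k) * pr TF (k,l) * pr FF (l,i) = (K j k * K k l * K l i) * (mu j * (eta k * nu l))" for k l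
    by (simp add: pr_eq eta_def)
  show ?thesis by (rule coef2_approx(1)[OF e _ _ _ assms h_def v_def eta_small nu_small]; simp)
qed

text \<open>This and the next two coefficients belong to an empty edge. Its linear term goes
  entirely into the remainder, so an upper bound without matching asymptotics is enough.\<close>

lemma coef2_FT_FF_TT_le:
  assumes "(i,j) \<in> distinct2 n"
  shows "coef2 FT FF TT (i,j) \<le> (nu j * (a * eta i)) * (m * h)"
proof -
  have e: "coef2 FT FF TT (i,j) = (\<Sum>(k,l)\<in>{(k,l). (i,j,k,l) \<in> distinct4 n}. pr FT (j,k) * pr FF (k,l) * pr TT (l,i))"
    by (simp add: coef2_def)
  have s: "pr FT (j,k) * pr FF (k,l) * pr TT (l,i) \<le> (nu j * (a * eta i)) * (mu k * eta l)" for k l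
  proof -
    have "pr FT (j,k) * pr FF (k,l) * pr TT (l,i) \<le> (mu k * nu j) * 1 * (a * eta l * eta i)"
      by (intro mult_mono pr_le) auto
    thus ?thesis by (simp add: mult_ac)
  qed
  show ?thesis unfolding m_def h_def by (rule coef2_le_sep[OF s]) auto
qed

lemma coef2_TT_FF_FT_le:
  assumes "(i,j) \<in> distinct2 n"
  shows "coef2 TT FF FT (i,j) \<le> (mu i * (a * eta j)) * (h * v)"
proof -
  have s: "pr TT (j,k) * pr FF (k,l) * pr FT (l,i) \<le> (mu i * (a * eta j)) * (eta k * nu l)" for k l
  proof -
    have "pr TT (j,k) * pr FF (k,l) * pr FT (l,i) \<le> (a * eta j * eta k) * 1 * (mu i * nu l)"
      by (intro mult_mono pr_le) auto
    thus ?thesis by (simp add: mult_ac)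
  qed
  show ?thesis unfolding v_def h_def by (rule coef2_le_sep[OF s]) auto
qed

lemma coef2_TF_TF_TF_le:
  assumes "(i,j) \<in> distinct2 n"
  shows "coef2 TF TF TF (i,j) \<le> (mu j * nu i) * (h * h)"
proof -
  have s: "pr TF (j,k) * pr TF (k,l) * pr TF (l,i) \<le> (mu j * nu i) * (eta k * eta l)" for k l
  proof -
    have "pr TF (j,k) * pr TF (k,l) * pr TF (l,i) \<le> (mu j * nu k) * (mu k * nu l) * (mu l * nu i)"
      by (intro mult_mono pr_le) auto
    thus ?thesis by (simp add: mult_ac eta_def)
  qed
  show ?thesis unfolding h_def by (rule coef2_le_sep[OF s]) auto
qed

end

section \<open>Approximation by a linear statistic\<close>

lemma sum_list_squared_le: "(sum_list xs)^2 \<le> real (length xs) * sum_list (map (\<lambda>x. x^2) (xs :: real list))"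
  using sum_squared_le_sum_of_squares[of "\<lambda>i. xs ! i" "{..<length xs}"]
  by (simp add: sum_list_sum_nth atLeast0LessThan mult.commute)

lemma sum_split_diagonal:
  fixes F :: "nat \<times> nat \<Rightarrow> real"
  shows "(\<Sum>i<n. \<Sum>j<n. F (i,j)) = (\<Sum>e\<in>distinct2 n. F e) + (\<Sum>i<n. F (i,i))"
proof -
  have u: "{..<n} \<times> {..<n} = distinct2 n \<union> (\<lambda>i. (i,i)) ` {..<n}" by (auto simp: distinct2_def)
  have "(\<Sum>i<n. \<Sum>j<n. F (i,j)) = (\<Sum>e\<in>{..<n} \<times> {..<n}. F e)"
    by (simp add: sum.cartesian_product)
  also have "\<dots> = (\<Sum>e\<in>distinct2 n. F e) + (\<Sum>e\<in>(\<lambda>i. (i,i)) ` {..<n}. F e)"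
    unfolding u by (rule sum.union_disjoint) (simp_all, auto simp: distinct2_def)
  also have "(\<Sum>e\<in>(\<lambda>i. (i,i)) ` {..<n}. F e) = (\<Sum>i<n. F (i,i))"
    by (subst sum.reindex) (auto simp: inj_on_def)
  finally show ?thesis .
qed

context p1_model begin

lemma K_sym: "K j i = K i j" by (simp add: K_def om_def algebra_simps)

text \<open>An FT edge is a TF edge read backwards. This moves the linear term of the one asymmetric
  edge in \<open>Qa\<close> onto the same indicators as those of the three asymmetric edges in
  \<open>Qb\<close>.\<close>

lemma cind_swap: "cind FT (prod.swap e) (state A (prod.swap e)) = cind TF e (state A e)"
  by (cases e) (auto simp: cind_def ind_def state_def pr_eq K_sym)

lemma single_FT: "single FT s2 s3 s4 A = (\<Sum>e\<in>distinct2 n. coef2 s2 s3 s4 (prod.swap e) * cind TF e (state A e))"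
proof -
  have "single FT s2 s3 s4 A = (\<Sum>e\<in>distinct2 n. coef2 s2 s3 s4 (prod.swap e) * cind FT (prod.swap e) (state A (prod.swap e)))"
    unfolding single_def
    by (rule sum.reindex_bij_witness[where i=prod.swap and j=prod.swap]) (auto simp: distinct2_def)
  thus ?thesis by (simp add: cind_swap)
qed

text \<open>For the edge (x, y) the leading coefficient is a h^2 from \<open>Qa\<close> minus a
  (mu_y nu_x m v + nu_x m h + mu_y v h) from the three asymmetric edges of \<open>Qb\<close>. Adding
  and subtracting a h^2 completes the second part to a product.\<close>

definition kap :: "nat \<times> nat \<Rightarrow> real" where
  "kap e = a * (2 * h^2 - (h + mu (snd e) * v) * (h + nu (fst e) * m))"

text \<open>The exact coefficient whose leading part is \<open>kap\<close>. The swap reverses the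
  edge coming from \<open>Qa\<close>.\<close>

definition coefY :: "nat \<times> nat \<Rightarrow> real" where
  "coefY e = coef2 FF TT FF (prod.swap e) - a * (coef2 TF FF TF e + coef2 FF TF TF e + coef2 TF TF FF e)"

definition lin :: "(nat \<Rightarrow> nat \<Rightarrow> bool) \<Rightarrow> real" where
  "lin A = (\<Sum>e\<in>distinct2 n. (v * m) * cind TT e (state A e)) + (\<Sum>e\<in>distinct2 n. kap e * cind TF e (state A e))"

lemma cyc_a_eq: "cyc n TT FF FT FF A = mean4 TT FF FT FF + single TT FF FT FF A + single FF FT FF TT A
    + single FT FF TT FF A + single FF TT FF FT A + rest TT FF FT FF A"
  by (simp add: rest_def)

text \<open>The means cancel by \<open>mean4_a_eq\<close>. Reciprocal and asymmetric edges leave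
  only the error of their coefficients, while the linear terms of empty edges, two from
  \<open>Qa\<close> and one from \<open>Qb\<close>, stay in full.\<close>

lemma U_minus_lin_eq:
  "Ustat n \<rho> A - lin A = (\<Sum>e\<in>distinct2 n. (coef2 FF FT FF e - v * m) * cind TT e (state A e))
     + (\<Sum>e\<in>distinct2 n. (coefY e - kap e) * cind TF e (state A e))
     + single FF FT FF TT A + single FF TT FF FT A - a * single FF TF TF TF A
     + rest TT FF FT FF A - a * rest TF TF FF TF A"
proof -
  have b: "cyc n TF TF FF TF A = mean4 TF TF FF TF + single TF TF FF TF A + single TF FF TF TF A
    + single FF TF TF TF A + single TF TF TF FF A + rest TF TF FF TF A"
    by (simp add: rest_def)
  have Y: "(\<Sum>e\<in>distinct2 n. coefY e * cind TF e (state A e))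
     = single FT FF TT FF A - a * (single TF TF FF TF A + single TF FF TF TF A + single TF TF TF FF A)"
    unfolding single_FT unfolding single_def coefY_def
    by (simp add: algebra_simps sum.distrib sum_subtractf sum_distrib_left)
  have X: "(\<Sum>e\<in>distinct2 n. coef2 FF FT FF e * cind TT e (state A e)) = single TT FF FT FF A"
    by (simp add: single_def)
  have "Ustat n \<rho> A = cyc n TT FF FT FF A - a * cyc n TF TF FF TF A"
    by (simp add: Ustat_def Qa_eq_cyc Qb_eq_cyc a_def)
  also have "\<dots> = single TT FF FT FF A + (single FT FF TT FF A - a * (single TF TF FF TF A + single TF FF TF TF A + single TF TF TF FF A))
     + single FF FT FF TT A + single FF TT FF FT A - a * single FF TF TF TF A
     + rest TT FF FT FF A - a * rest TF TF FF TF A"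
    unfolding cyc_a_eq b mean4_a_eq by (simp add: algebra_simps)
  finally show ?thesis unfolding lin_def
    by (simp add: left_diff_distrib sum_subtractf X Y)
qed

end

context p1_small begin

text \<open>Expanding the square gives h^2 m + 2 h^2 m + q m^2. Besides the upper bound derived from
  it, the exact value is used in \<open>sum_kap_ge\<close>, where the coefficients of h^4 have to be
  compared.\<close>

lemma sum_mu_sq: "(\<Sum>i<n. mu i * (h + nu i * m)^2) = 3 * h^2 * m + q * m^2"
proof -
  have "(\<Sum>i<n. mu i * (h + nu i * m)^2) = (\<Sum>i<n. h^2 * mu i + 2 * h * m * eta i + m^2 * (nu i * eta i))"
    by (rule sum.cong) (auto simp: eta_def power2_eq_square algebra_simps)
  also have "\<dots> = h^2 * m + 2 * h * m * h + m^2 * q"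
    by (simp only: sum.distrib sum_distrib_left[symmetric] m_def[symmetric] h_def[symmetric] q_def[symmetric])
  finally show ?thesis by (simp add: power2_eq_square)
qed

lemma sum_nu_sq: "(\<Sum>i<n. nu i * (h + mu i * v)^2) = 3 * h^2 * v + p * v^2"
proof -
  have "(\<Sum>i<n. nu i * (h + mu i * v)^2) = (\<Sum>i<n. h^2 * nu i + 2 * h * v * eta i + v^2 * (mu i * eta i))"
    by (rule sum.cong) (auto simp: eta_def power2_eq_square algebra_simps)
  also have "\<dots> = h^2 * v + 2 * h * v * h + v^2 * p"
    by (simp only: sum.distrib sum_distrib_left[symmetric] v_def[symmetric] h_def[symmetric] p_def[symmetric])
  finally show ?thesis by (simp add: power2_eq_square)
qed

lemma sum_mu_sq_le: "(\<Sum>i<n. mu i * (h + nu i * m)^2) \<le> 4 * (q * m^2)"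
proof -
  have "h^2 * m \<le> (q * m) * m" by (rule mult_right_mono[OF h_sq_le_qm]) simp
  thus ?thesis unfolding sum_mu_sq by (simp add: power2_eq_square mult_ac)
qed

lemma sum_nu_sq_le: "(\<Sum>i<n. nu i * (h + mu i * v)^2) \<le> 4 * (p * v^2)"
proof -
  have "h^2 * v \<le> (p * v) * v" by (rule mult_right_mono[OF h_sq_le_pv]) simp
  thus ?thesis unfolding sum_nu_sq by (simp add: power2_eq_square mult_ac)
qed

lemma pr_var_le: "pr s e * (1 - pr s e) \<le> pr s e" "pr s e * (1 - pr s e) \<le> 1 - pr s e"
  using mult_left_mono[of "1 - pr s e" 1 "pr s e"] mult_right_mono[of "pr s e" 1 "1 - pr s e"] by simp_all

lemma weighted_le:
  assumes "\<And>i j. i < n \<Longrightarrow> j < n \<Longrightarrow> (i,j) \<in> distinct2 n \<Longrightarrow> (w (i,j))^2 * B i j \<le> c * (f i * g j)"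
    and "\<And>i j. pr s (i,j) * (1 - pr s (i,j)) \<le> B i j"
    and "c \<ge> 0" "\<And>i. f i \<ge> 0" "\<And>i. g i \<ge> 0"
  shows "EN (\<lambda>A. (\<Sum>e\<in>distinct2 n. w e * cind s e (state A e))^2)
     \<le> 4 * (c * ((\<Sum>i<n. f i) * (\<Sum>i<n. g i)))"
proof -
  have "EN (\<lambda>A. (\<Sum>e\<in>distinct2 n. w e * cind s e (state A e))^2)
     \<le> 4 * (\<Sum>e\<in>distinct2 n. (w e)^2 * (pr s e * (1 - pr s e)))" by (rule single_state_le)
  \<comment> \<open>\<open>sum_distinct2_le_sep\<close> asks for its bound at all pairs, including
    the diagonal, where nothing is assumed about \<open>w\<close>; the conditional makes the summand
    0 there.\<close>
  also have "(\<Sum>e\<in>distinct2 n. (w e)^2 * (pr s e * (1 - pr s e))) \<le>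
     (\<Sum>e\<in>distinct2 n. if e \<in> distinct2 n then (w e)^2 * (pr s e * (1 - pr s e)) else 0)"
    by (intro sum_mono) auto
  also have "\<dots> \<le> c * ((\<Sum>i<n. f i) * (\<Sum>i<n. g i))"
  proof (rule sum_distinct2_le_sep)
    fix i j assume ij: "i < n" "j < n"
    have "(w (i,j))^2 * (pr s (i,j) * (1 - pr s (i,j))) \<le> (w (i,j))^2 * B i j"
      by (rule mult_left_mono) (use assms(2) in auto)
    thus "(if (i,j) \<in> distinct2 n then (w (i,j))^2 * (pr s (i,j) * (1 - pr s (i,j))) else 0) \<le> c * (f i * g j)"
      using assms(1)[OF ij] assms(3-5) by (auto intro: order_trans)
  qed (use assms in auto)
  finally show ?thesis by simp
qed

lemma tau_sq: "\<tau>^2 \<le> \<tau> / 100"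
  using mult_left_mono[OF tau(2), of \<tau>] by (simp add: power2_eq_square)

lemma reciprocal_coef_error_le: "EN (\<lambda>A. (\<Sum>e\<in>distinct2 n. (coef2 FF FT FF e - v * m) * cind TT e (state A e))^2) \<le> 5 * (\<tau> * M1)"
proof -
  have "EN (\<lambda>A. (\<Sum>e\<in>distinct2 n. (coef2 FF FT FF e - v * m) * cind TT e (state A e))^2)
     \<le> 4 * ((121 * \<tau>^2 * (v * m)^2 * a) * ((\<Sum>i<n. eta i) * (\<Sum>i<n. eta i)))"
  proof (rule weighted_le[where B="\<lambda>i j. a * eta i * eta j"])
    fix i j assume "(i,j) \<in> distinct2 n"
    have "\<bar>coef2 FF FT FF (i,j) - v * m\<bar> \<le> 11 * \<tau> * (v * m)" using coef2_FF_FT_FF(1)[OF \<open>(i,j) \<in> distinct2 n\<close>] by simp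
    hence "(coef2 FF FT FF (i,j) - v * m)^2 \<le> (11 * \<tau> * (v * m))^2"
      by (rule power2_le_iff_abs_le[THEN iffD2, rotated]) (intro mult_nonneg_nonneg; simp)
    hence "(coef2 FF FT FF (i,j) - v * m)^2 * (a * eta i * eta j) \<le> (11 * \<tau> * (v * m))^2 * (a * eta i * eta j)"
      by (rule mult_right_mono) auto
    thus "(coef2 FF FT FF (i,j) - v * m)^2 * (a * eta i * eta j) \<le> 121 * \<tau>^2 * (v * m)^2 * a * (eta i * eta j)"
      by (simp add: power_mult_distrib mult_ac)
  qed (auto intro: order_trans[OF pr_var_le(1)] simp: pr_le[unfolded mult.assoc] mult.assoc)
  also have "\<dots> = 484 * (\<tau>^2 * M1)"
    unfolding h_def[symmetric] M1_def by (simp add: power2_eq_square mult_ac)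
  also have "\<dots> \<le> 484 * (\<tau> / 100 * M1)"
    by (intro mult_left_mono mult_right_mono tau_sq) auto
  also have "\<dots> \<le> 5 * (\<tau> * M1)" by simp
  finally show ?thesis .
qed

text \<open>All four estimates have relative errors, and the sizes of their leading terms add up,
  without the cancellation present in \<open>kap\<close>, to a (h + mu_j v) (h + nu_i m). The error
  is measured against this product, which may be far larger than |kap|.\<close>

lemma coefY_approx:
  assumes "(i,j) \<in> distinct2 n"
  shows "\<bar>coefY (i,j) - kap (i,j)\<bar> \<le> 11 * \<tau> * (a * ((h + mu j * v) * (h + nu i * m)))"
proof -
  have sw: "(j,i) \<in> distinct2 n" using assms by (auto simp: distinct2_def)
  define c0 c1 c2 c4 where "c0 = coef2 FF TT FF (j,i)" and "c1 = coef2 TF FF TF (i,j)"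
    and "c2 = coef2 FF TF TF (i,j)" and "c4 = coef2 TF TF FF (i,j)"
  define t0 t1 t2 t4 where "t0 = a * (h * h)" and "t1 = (mu j * nu i) * (v * m)"
    and "t2 = nu i * (m * h)" and "t4 = mu j * (h * v)"
  have b0: "\<bar>c0 - t0\<bar> \<le> 11 * \<tau> * t0" unfolding c0_def t0_def by (rule coef2_FF_TT_FF(1)[OF sw])
  have b1: "\<bar>c1 - t1\<bar> \<le> 11 * \<tau> * t1" unfolding c1_def t1_def by (rule coef2_TF_FF_TF[OF assms])
  have b2: "\<bar>c2 - t2\<bar> \<le> 11 * \<tau> * t2" unfolding c2_def t2_def by (rule coef2_FF_TF_TF[OF assms])
  have b4: "\<bar>c4 - t4\<bar> \<le> 11 * \<tau> * t4" unfolding c4_def t4_def by (rule coef2_TF_TF_FF[OF assms])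
  have "coefY (i,j) - kap (i,j) = (c0 - t0) - a * ((c1 - t1) + (c2 - t2) + (c4 - t4))"
    unfolding coefY_def kap_def c0_def c1_def c2_def c4_def t0_def t1_def t2_def t4_def
    by (simp add: algebra_simps power2_eq_square)
  hence "\<bar>coefY (i,j) - kap (i,j)\<bar> \<le> \<bar>c0 - t0\<bar> + a * \<bar>(c1 - t1) + (c2 - t2) + (c4 - t4)\<bar>"
    using abs_triangle_ineq4[of "c0 - t0" "a * ((c1 - t1) + (c2 - t2) + (c4 - t4))"] by (simp add: abs_mult)
  also have "\<dots> \<le> 11 * \<tau> * t0 + a * (11 * \<tau> * t1 + 11 * \<tau> * t2 + 11 * \<tau> * t4)"
    by (intro add_mono mult_left_mono b0) (use b1 b2 b4 in auto)
  also have "\<dots> = 11 * \<tau> * (a * ((h + mu j * v) * (h + nu i * m)))"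
    unfolding t0_def t1_def t2_def t4_def by (simp add: algebra_simps)
  finally show ?thesis .
qed

text \<open>The constant is 4 * 121 * 16 = 7744, with 16 from the two weighted sums of squares;
  \<open>tau_sq\<close> divides it by 100.\<close>

lemma asymmetric_coef_error_le: "EN (\<lambda>A. (\<Sum>e\<in>distinct2 n. (coefY e - kap e) * cind TF e (state A e))^2) \<le> 78 * (\<tau> * M2)"
proof -
  have "EN (\<lambda>A. (\<Sum>e\<in>distinct2 n. (coefY e - kap e) * cind TF e (state A e))^2)
     \<le> 4 * ((121 * \<tau>^2 * a^2) * ((\<Sum>i<n. mu i * (h + nu i * m)^2) * (\<Sum>j<n. nu j * (h + mu j * v)^2)))"
  proof (rule weighted_le[where B="\<lambda>i j. mu i * nu j"])
    fix i j assume ij: "(i,j) \<in> distinct2 n"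
    have "(coefY (i,j) - kap (i,j))^2 \<le> (11 * \<tau> * (a * ((h + mu j * v) * (h + nu i * m))))^2"
      by (rule power2_le_iff_abs_le[THEN iffD2, OF _ coefY_approx[OF ij]]) (intro mult_nonneg_nonneg add_nonneg_nonneg; simp)
    hence "(coefY (i,j) - kap (i,j))^2 * (mu i * nu j) \<le> (11 * \<tau> * (a * ((h + mu j * v) * (h + nu i * m))))^2 * (mu i * nu j)"
      by (rule mult_right_mono) auto
    thus "(coefY (i,j) - kap (i,j))^2 * (mu i * nu j) \<le> 121 * \<tau>^2 * a^2 * ((mu i * (h + nu i * m)^2) * (nu j * (h + mu j * v)^2))"
      by (simp add: power_mult_distrib mult_ac)
  qed (auto intro: order_trans[OF pr_var_le(1)] simp: pr_le)
  also have "\<dots> \<le> 4 * ((121 * \<tau>^2 * a^2) * ((4 * (q * m^2)) * (4 * (p * v^2))))"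
    by (intro mult_left_mono mult_mono sum_mu_sq_le sum_nu_sq_le) (auto intro!: sum_nonneg)
  also have "\<dots> = 7744 * (\<tau>^2 * M2)"
    unfolding M2_def by (simp add: power2_eq_square mult_ac)
  also have "\<dots> \<le> 7744 * (\<tau> / 100 * M2)"
    by (intro mult_left_mono mult_right_mono tau_sq) auto
  also have "\<dots> \<le> 78 * (\<tau> * M2)" by simp
  finally show ?thesis .
qed

text \<open>For an empty edge the variance is at most 1 - K <= om, a sum of three weights of
  different shape. Each gets its own separable bound, hence 4 * 3 = 12.\<close>

lemma weighted_om_le:
  assumes w: "\<And>i j. (i,j) \<in> distinct2 n \<Longrightarrow> 0 \<le> w (i,j) \<and> w (i,j) \<le> W i j"
    and b1: "\<And>i j. i < n \<Longrightarrow> j < n \<Longrightarrow> (W i j)^2 * (mu i * nu j) \<le> c1 * (f1 i * g1 j)"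
    and b2: "\<And>i j. i < n \<Longrightarrow> j < n \<Longrightarrow> (W i j)^2 * (mu j * nu i) \<le> c2 * (f2 i * g2 j)"
    and b3: "\<And>i j. i < n \<Longrightarrow> j < n \<Longrightarrow> (W i j)^2 * (a * eta i * eta j) \<le> c3 * (f3 i * g3 j)"
    and c: "c1 \<ge> 0" "c2 \<ge> 0" "c3 \<ge> 0"
    and fg: "\<And>i. f1 i \<ge> 0" "\<And>i. f2 i \<ge> 0" "\<And>i. f3 i \<ge> 0" "\<And>i. g1 i \<ge> 0" "\<And>i. g2 i \<ge> 0" "\<And>i. g3 i \<ge> 0"
    and T: "c1 * ((\<Sum>i<n. f1 i) * (\<Sum>i<n. g1 i)) \<le> T" "c2 * ((\<Sum>i<n. f2 i) * (\<Sum>i<n. g2 i)) \<le> T" "c3 * ((\<Sum>i<n. f3 i) * (\<Sum>i<n. g3 i)) \<le> T"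
  shows "EN (\<lambda>A. (\<Sum>e\<in>distinct2 n. w e * cind FF e (state A e))^2) \<le> 12 * T"
proof -
  have "EN (\<lambda>A. (\<Sum>e\<in>distinct2 n. w e * cind FF e (state A e))^2)
     \<le> 4 * (\<Sum>e\<in>distinct2 n. (w e)^2 * (pr FF e * (1 - pr FF e)))" by (rule single_state_le)
  also have "(\<Sum>e\<in>distinct2 n. (w e)^2 * (pr FF e * (1 - pr FF e)))
     \<le> (\<Sum>e\<in>distinct2 n. (\<lambda>(i,j). (W i j)^2 * (mu i * nu j)) e + (\<lambda>(i,j). (W i j)^2 * (mu j * nu i)) e + (\<lambda>(i,j). (W i j)^2 * (a * eta i * eta j)) e)"
  proof (rule sum_mono)
    fix e assume e: "e \<in> distinct2 n"
    obtain i j where ij: "e = (i,j)" by (cases e)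
    have "(w (i,j))^2 * (pr FF (i,j) * (1 - pr FF (i,j))) \<le> (W i j)^2 * om i j"
    proof (rule mult_mono)
      show "(w (i,j))^2 \<le> (W i j)^2" using w[of i j] e ij by (auto intro: power_mono)
      have "pr FF (i,j) * (1 - pr FF (i,j)) \<le> 1 - K i j" using pr_var_le(2)[of FF "(i,j)"] by (simp add: pr_eq)
      thus "pr FF (i,j) * (1 - pr FF (i,j)) \<le> om i j" using one_minus_K_le[of i j] by linarith
    qed auto
    thus "(w e)^2 * (pr FF e * (1 - pr FF e)) \<le> (\<lambda>(i,j). (W i j)^2 * (mu i * nu j)) e + (\<lambda>(i,j). (W i j)^2 * (mu j * nu i)) e + (\<lambda>(i,j). (W i j)^2 * (a * eta i * eta j)) e"
      by (simp add: ij om_def distrib_left)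
  qed
  also have "\<dots> = (\<Sum>e\<in>distinct2 n. (\<lambda>(i,j). (W i j)^2 * (mu i * nu j)) e) + (\<Sum>e\<in>distinct2 n. (\<lambda>(i,j). (W i j)^2 * (mu j * nu i)) e) + (\<Sum>e\<in>distinct2 n. (\<lambda>(i,j). (W i j)^2 * (a * eta i * eta j)) e)"
    by (simp only: sum.distrib)
  also have "\<dots> \<le> T + T + T"
  proof (intro add_mono)
    show "(\<Sum>e\<in>distinct2 n. (\<lambda>(i,j). (W i j)^2 * (mu i * nu j)) e) \<le> T"
      by (rule order_trans[OF sum_distinct2_le_sep T(1)]) (use b1 c fg in auto)
    show "(\<Sum>e\<in>distinct2 n. (\<lambda>(i,j). (W i j)^2 * (mu j * nu i)) e) \<le> T"
      by (rule order_trans[OF sum_distinct2_le_sep T(2)]) (use b2 c fg in auto)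
    show "(\<Sum>e\<in>distinct2 n. (\<lambda>(i,j). (W i j)^2 * (a * eta i * eta j)) e) \<le> T"
      by (rule order_trans[OF sum_distinct2_le_sep T(3)]) (use b3 c fg in auto)
  qed
  finally show ?thesis by simp
qed

text \<open>The three parts of \<open>om\<close> leave the small factors mx^2 nx^2, ex^2 and a ex^2
  respectively; the rest is at most \<open>M2\<close> because h^2 <= p v.\<close>

lemma null_single_a1_le: "EN (\<lambda>A. (single FF FT FF TT A)^2) \<le> 12 * (\<tau> * M2)"
  unfolding single_def
proof (rule weighted_om_le[where W="\<lambda>i j. (nu j * (a * eta i)) * (m * h)"
      and ?c1.0="a^2 * m^2 * h^2 * (mx^2 * nx^2)" and ?f1.0="\<lambda>i. nu i * eta i" and ?g1.0=nu
      and ?c2.0="a^2 * m^2 * h^2 * ex^2" and ?f2.0=nu and ?g2.0="\<lambda>i. nu i * eta i"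
      and ?c3.0="a^2 * m^2 * h^2 * (a * ex^2) * nx" and ?f3.0=eta and ?g3.0="\<lambda>i. nu i * eta i"])
  show "0 \<le> coef2 FT FF TT (i,j) \<and> coef2 FT FF TT (i,j) \<le> (nu j * (a * eta i)) * (m * h)"
    if "(i,j) \<in> distinct2 n" for i j using coef2_FT_FF_TT_le[OF that] coef2_nonneg by simp
  fix i j assume ij: "i < n" "j < n"
  have sq: "(mu i)^2 \<le> mx^2" "(nu j)^2 \<le> nx^2" "(eta i)^2 \<le> ex^2"
    using ij by (auto intro!: power_mono mu_le nu_le eta_le)
  have c: "0 \<le> a^2 * m^2 * h^2" by simp
  have "(mu i)^2 * (nu j)^2 \<le> mx^2 * nx^2" by (rule mult_mono) (use sq in auto)
  from mult_right_mono[OF this, of "nu i * eta i * nu j"] mult_left_mono[OF _ c]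
  have "(a^2 * m^2 * h^2) * ((mu i)^2 * (nu j)^2 * (nu i * eta i * nu j)) \<le> (a^2 * m^2 * h^2) * (mx^2 * nx^2 * (nu i * eta i * nu j))" by simp
  thus "((nu j * (a * eta i)) * (m * h))^2 * (mu i * nu j) \<le> a^2 * m^2 * h^2 * (mx^2 * nx^2) * (nu i * eta i * nu j)"
    by (simp add: power_mult_distrib eta_def power2_eq_square mult_ac)
  from mult_right_mono[OF sq(3), of "nu i * (nu j * eta j)"] mult_left_mono[OF _ c]
  have "(a^2 * m^2 * h^2) * ((eta i)^2 * (nu i * (nu j * eta j))) \<le> (a^2 * m^2 * h^2) * (ex^2 * (nu i * (nu j * eta j)))" by simp
  thus "((nu j * (a * eta i)) * (m * h))^2 * (mu j * nu i) \<le> a^2 * m^2 * h^2 * ex^2 * (nu i * (nu j * eta j))"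
    by (simp add: power_mult_distrib eta_def power2_eq_square mult_ac)
  have "(eta i)^2 * nu j \<le> ex^2 * nx" by (rule mult_mono) (use sq nu_le ij in auto)
  from mult_right_mono[OF this, of "a * (eta i * (nu j * eta j))"] mult_left_mono[OF _ c]
  have "(a^2 * m^2 * h^2) * ((eta i)^2 * nu j * (a * (eta i * (nu j * eta j)))) \<le> (a^2 * m^2 * h^2) * (ex^2 * nx * (a * (eta i * (nu j * eta j))))" by simp
  thus "((nu j * (a * eta i)) * (m * h))^2 * (a * eta i * eta j) \<le> a^2 * m^2 * h^2 * (a * ex^2) * nx * (eta i * (nu j * eta j))"
    by (simp add: power_mult_distrib power2_eq_square mult_ac)
next
  have base: "a^2 * m^2 * h^2 * (q * v) \<le> M2"
  proof -
    have "(a^2 * m^2 * q * v) * h^2 \<le> (a^2 * m^2 * q * v) * (p * v)" by (rule mult_left_mono[OF h_sq_le_pv]) auto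
    thus ?thesis by (simp add: M2_def power2_eq_square mult_ac)
  qed
  have gen: "t * (a^2 * m^2 * h^2 * (q * v)) \<le> \<tau> * M2" if "t \<le> \<tau>" for t
    by (rule mult_mono[OF that base]) auto
  show "a^2 * m^2 * h^2 * (mx^2 * nx^2) * ((\<Sum>i<n. nu i * eta i) * (\<Sum>i<n. nu i)) \<le> \<tau> * M2"
    unfolding q_def[symmetric] v_def[symmetric] using gen[OF mx_sq_nx_sq_le_tau] by (simp add: mult_ac)
  show "a^2 * m^2 * h^2 * ex^2 * ((\<Sum>i<n. nu i) * (\<Sum>i<n. nu i * eta i)) \<le> \<tau> * M2"
    unfolding q_def[symmetric] v_def[symmetric] using gen[OF ex_sq_le_tau] by (simp add: mult_ac)
  have nh: "nx * h \<le> v"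
    using mult_mono[OF nx_le_1 h_le_v] mult_right_mono[OF mx_le_1, of v] by simp
  have "a^2 * m^2 * h^2 * (a * ex^2) * nx * (h * q) = a^2 * m^2 * h^2 * (a * ex^2) * q * (nx * h)"
    by (simp add: mult_ac)
  also have "\<dots> \<le> a^2 * m^2 * h^2 * (a * ex^2) * q * v"
    by (rule mult_left_mono[OF nh]) auto
  also have "\<dots> = (a * ex^2) * (a^2 * m^2 * h^2 * (q * v))" by (simp add: mult_ac)
  also have "\<dots> \<le> \<tau> * M2" by (rule gen[OF aex])
  finally show "a^2 * m^2 * h^2 * (a * ex^2) * nx * ((\<Sum>i<n. eta i) * (\<Sum>i<n. nu i * eta i)) \<le> \<tau> * M2"
    unfolding q_def[symmetric] h_def[symmetric] .
qed auto

lemma null_single_a2_le: "EN (\<lambda>A. (single FF TT FF FT A)^2) \<le> 12 * (\<tau> * M2)"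
  unfolding single_def
proof (rule weighted_om_le[where W="\<lambda>i j. (mu i * (a * eta j)) * (h * v)"
      and ?c1.0="a^2 * v^2 * h^2 * (mx^2 * nx^2)" and ?f1.0=mu and ?g1.0="\<lambda>i. mu i * eta i"
      and ?c2.0="a^2 * v^2 * h^2 * ex^2" and ?f2.0="\<lambda>i. mu i * eta i" and ?g2.0=mu
      and ?c3.0="a^2 * v^2 * h^2 * (a * ex^2) * mx" and ?f3.0="\<lambda>i. mu i * eta i" and ?g3.0=eta])
  show "0 \<le> coef2 TT FF FT (i,j) \<and> coef2 TT FF FT (i,j) \<le> (mu i * (a * eta j)) * (h * v)"
    if "(i,j) \<in> distinct2 n" for i j using coef2_TT_FF_FT_le[OF that] coef2_nonneg by simp
  fix i j assume ij: "i < n" "j < n"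
  have sq: "(mu i)^2 \<le> mx^2" "(nu j)^2 \<le> nx^2" "(eta j)^2 \<le> ex^2"
    using ij by (auto intro!: power_mono mu_le nu_le eta_le)
  have c: "0 \<le> a^2 * v^2 * h^2" by simp
  have "(mu i)^2 * (nu j)^2 \<le> mx^2 * nx^2" by (rule mult_mono) (use sq in auto)
  from mult_right_mono[OF this, of "mu i * (mu j * eta j)"] mult_left_mono[OF _ c]
  have "(a^2 * v^2 * h^2) * ((mu i)^2 * (nu j)^2 * (mu i * (mu j * eta j))) \<le> (a^2 * v^2 * h^2) * (mx^2 * nx^2 * (mu i * (mu j * eta j)))" by simp
  thus "((mu i * (a * eta j)) * (h * v))^2 * (mu i * nu j) \<le> a^2 * v^2 * h^2 * (mx^2 * nx^2) * (mu i * (mu j * eta j))"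
    by (simp add: power_mult_distrib eta_def power2_eq_square mult_ac)
  from mult_right_mono[OF sq(3), of "mu i * eta i * mu j"] mult_left_mono[OF _ c]
  have "(a^2 * v^2 * h^2) * ((eta j)^2 * (mu i * eta i * mu j)) \<le> (a^2 * v^2 * h^2) * (ex^2 * (mu i * eta i * mu j))" by simp
  thus "((mu i * (a * eta j)) * (h * v))^2 * (mu j * nu i) \<le> a^2 * v^2 * h^2 * ex^2 * (mu i * eta i * mu j)"
    by (simp add: power_mult_distrib eta_def power2_eq_square mult_ac)
  have "(eta j)^2 * mu i \<le> ex^2 * mx" by (rule mult_mono) (use sq mu_le ij in auto)
  from mult_right_mono[OF this, of "a * (mu i * eta i * eta j)"] mult_left_mono[OF _ c]
  have "(a^2 * v^2 * h^2) * ((eta j)^2 * mu i * (a * (mu i * eta i * eta j))) \<le> (a^2 * v^2 * h^2) * (ex^2 * mx * (a * (mu i * eta i * eta j)))" by simp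
  thus "((mu i * (a * eta j)) * (h * v))^2 * (a * eta i * eta j) \<le> a^2 * v^2 * h^2 * (a * ex^2) * mx * (mu i * eta i * eta j)"
    by (simp add: power_mult_distrib power2_eq_square mult_ac)
next
  have base: "a^2 * v^2 * h^2 * (p * m) \<le> M2"
  proof -
    have "(a^2 * v^2 * p * m) * h^2 \<le> (a^2 * v^2 * p * m) * (q * m)" by (rule mult_left_mono[OF h_sq_le_qm]) auto
    thus ?thesis by (simp add: M2_def power2_eq_square mult_ac)
  qed
  have gen: "t * (a^2 * v^2 * h^2 * (p * m)) \<le> \<tau> * M2" if "t \<le> \<tau>" for t
    by (rule mult_mono[OF that base]) auto
  show "a^2 * v^2 * h^2 * (mx^2 * nx^2) * ((\<Sum>i<n. mu i) * (\<Sum>i<n. mu i * eta i)) \<le> \<tau> * M2"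
    unfolding p_def[symmetric] m_def[symmetric] using gen[OF mx_sq_nx_sq_le_tau] by (simp add: mult_ac)
  show "a^2 * v^2 * h^2 * ex^2 * ((\<Sum>i<n. mu i * eta i) * (\<Sum>i<n. mu i)) \<le> \<tau> * M2"
    unfolding p_def[symmetric] m_def[symmetric] using gen[OF ex_sq_le_tau] by (simp add: mult_ac)
  have nh: "mx * h \<le> m"
    using mult_mono[OF mx_le_1 h_le_m] mult_right_mono[OF nx_le_1, of m] by simp
  have "a^2 * v^2 * h^2 * (a * ex^2) * mx * (p * h) = a^2 * v^2 * h^2 * (a * ex^2) * p * (mx * h)"
    by (simp add: mult_ac)
  also have "\<dots> \<le> a^2 * v^2 * h^2 * (a * ex^2) * p * m"
    by (rule mult_left_mono[OF nh]) auto
  also have "\<dots> = (a * ex^2) * (a^2 * v^2 * h^2 * (p * m))" by (simp add: mult_ac)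
  also have "\<dots> \<le> \<tau> * M2" by (rule gen[OF aex])
  finally show "a^2 * v^2 * h^2 * (a * ex^2) * mx * ((\<Sum>i<n. mu i * eta i) * (\<Sum>i<n. eta i)) \<le> \<tau> * M2"
    unfolding p_def[symmetric] h_def[symmetric] .
qed auto

text \<open>Here the variance may be bounded by 1: the coefficient itself contains mu_j nu_i, and v2
  m2 <= mx nx v m supplies the factor \<open>\<tau>\<close>.\<close>

lemma null_single_b_le: "a^2 * EN (\<lambda>A. (single FF TF TF TF A)^2) \<le> 4 * (\<tau> * M2)"
proof -
  have "EN (\<lambda>A. (single FF TF TF TF A)^2) \<le> 4 * ((h * h)^2 * ((\<Sum>i<n. (nu i)^2) * (\<Sum>i<n. (mu i)^2)))"
    unfolding single_def
  proof (rule weighted_le[where B="\<lambda>_ _. 1"])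
    fix i j assume ij: "(i,j) \<in> distinct2 n"
    have "(coef2 TF TF TF (i,j))^2 \<le> ((mu j * nu i) * (h * h))^2"
      by (rule power_mono[OF coef2_TF_TF_TF_le[OF ij] coef2_nonneg])
    thus "(coef2 TF TF TF (i,j))^2 * 1 \<le> (h * h)^2 * ((nu i)^2 * (mu j)^2)"
      by (simp add: power_mult_distrib mult_ac)
  next
    show "pr FF (i, j) * (1 - pr FF (i, j)) \<le> 1" for i j
      using pr_var_le(1)[of FF "(i,j)"] pr_le_1[of FF "(i,j)"] by linarith
  qed auto
  hence A: "a^2 * EN (\<lambda>A. (single FF TF TF TF A)^2) \<le> a^2 * (4 * ((h * h)^2 * (v2 * m2)))"
    unfolding v2_def[symmetric] m2_def[symmetric] by (rule mult_left_mono) simp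
  have "v2 * m2 \<le> (nx * v) * (mx * m)" by (intro mult_mono v2_le m2_le) auto
  also have "\<dots> = (mx * nx) * (v * m)" by simp
  also have "\<dots> \<le> \<tau> * (v * m)" by (rule mult_right_mono[OF mx_nx_le_tau]) auto
  finally have "(h^2 * h^2) * (v2 * m2) \<le> ((p * v) * (q * m)) * (\<tau> * (v * m))"
    by (rule mult_mono[OF h_pow4_le]) auto
  hence "(4 * a^2) * ((h^2 * h^2) * (v2 * m2)) \<le> (4 * a^2) * (((p * v) * (q * m)) * (\<tau> * (v * m)))"
    by (rule mult_left_mono) simp
  thus ?thesis using A by (simp add: M2_def power2_eq_square mult_ac)
qed

lemma U_minus_lin_le: "EN (\<lambda>A. (Ustat n \<rho> A - lin A)^2) \<le> 50000 * (\<tau> * (M1 + M2))"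
proof -
  define X1 where "X1 A = (\<Sum>e\<in>distinct2 n. (coef2 FF FT FF e - v * m) * cind TT e (state A e))" for A
  define X2 where "X2 A = (\<Sum>e\<in>distinct2 n. (coefY e - kap e) * cind TF e (state A e))" for A
  define X3 where "X3 = single FF FT FF TT"
  define X4 where "X4 = single FF TT FF FT"
  define X5 where "X5 = single FF TF TF TF"
  define X6 where "X6 = rest TT FF FT FF"
  define X7 where "X7 = rest TF TF FF TF"
  have "(Ustat n \<rho> A - lin A)^2 \<le> 7 * ((X1 A)^2 + ((X2 A)^2 + ((X3 A)^2 + ((X4 A)^2 + (a^2 * (X5 A)^2 + ((X6 A)^2 + a^2 * (X7 A)^2))))))" for A
  proof -
    have "Ustat n \<rho> A - lin A = sum_list [X1 A, X2 A, X3 A, X4 A, - a * X5 A, X6 A, - a * X7 A]"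
      unfolding U_minus_lin_eq X1_def X2_def X3_def X4_def X5_def X6_def X7_def by simp
    thus ?thesis using sum_list_squared_le[of "[X1 A, X2 A, X3 A, X4 A, - a * X5 A, X6 A, - a * X7 A]"]
      by (simp add: power_mult_distrib)
  qed
  hence "EN (\<lambda>A. (Ustat n \<rho> A - lin A)^2) \<le> EN (\<lambda>A. 7 * ((X1 A)^2 + ((X2 A)^2 + ((X3 A)^2 + ((X4 A)^2 + (a^2 * (X5 A)^2 + ((X6 A)^2 + a^2 * (X7 A)^2)))))))"
    by (rule EN_mono)
  also have "\<dots> = 7 * (EN (\<lambda>A. (X1 A)^2) + (EN (\<lambda>A. (X2 A)^2) + (EN (\<lambda>A. (X3 A)^2) + (EN (\<lambda>A. (X4 A)^2)
      + (a^2 * EN (\<lambda>A. (X5 A)^2) + (EN (\<lambda>A. (X6 A)^2) + a^2 * EN (\<lambda>A. (X7 A)^2)))))))"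
    by (simp add: EN_add)
  also have "\<dots> \<le> 7 * (5 * (\<tau> * M1) + (78 * (\<tau> * M2) + (12 * (\<tau> * M2) + (12 * (\<tau> * M2) + (4 * (\<tau> * M2) + (6132 * (\<tau> * M1) + 6132 * (\<tau> * M2)))))))"
    by (intro mult_left_mono add_mono)
       (use reciprocal_coef_error_le asymmetric_coef_error_le null_single_a1_le null_single_a2_le null_single_b_le rest_a_second_moment_le rest_b_second_moment_le in \<open>simp_all add: X1_def X2_def X3_def X4_def X5_def X6_def X7_def\<close>)
  \<comment> \<open>These are 7 * (5 + 6132) and 7 * (78 + 12 + 12 + 4 + 6132).\<close>
  also have "\<dots> = 42959 * (\<tau> * M1) + 43666 * (\<tau> * M2)" by simp
  also have "\<dots> \<le> 50000 * (\<tau> * M1) + 50000 * (\<tau> * M2)"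
    by (intro add_mono mult_right_mono) auto
  finally show ?thesis by (simp add: distrib_left)
qed

section \<open>Mean and variance of \<open>Qa\<close>\<close>

definition Q0 :: real where "Q0 = a * h^2 * (v * m)"

text \<open>\<open>Q0\<close> is the leading order of the mean of \<open>Qa\<close>, so this bound
  and the next say that the noise is of smaller order than the signal. Here the gain is the large
  quantity a h^2 of (G2).\<close>

lemma M1_le_Q0: "M1 \<le> \<tau> * Q0^2"
proof -
  have "M1 * 1 \<le> M1 * (\<tau> * (a * h^2))" by (rule mult_left_mono[OF ah_ge]) simp
  thus ?thesis by (simp add: M1_def Q0_def power2_eq_square mult_ac)
qed

text \<open>The ratio p q / h^4 is small: p q <= mx nx h^2, and h >= 1 supplies the other
  power.\<close>

lemma M2_le_Q0: "M2 \<le> \<tau> * Q0^2"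
proof -
  have "p * q \<le> (mx * h) * (nx * h)" by (intro mult_mono p_le_h q_le_h) auto
  also have "\<dots> = (mx * nx) * h^2" by (simp add: power2_eq_square)
  also have "\<dots> \<le> \<tau> * h^2" by (rule mult_right_mono[OF mx_nx_le_tau]) simp
  also have "\<dots> \<le> \<tau> * (h^2 * h^2)"
    using one_le_power[OF h_ge_1, of 2] mult_left_mono[of 1 "h^2" "h^2"] by (intro mult_left_mono) auto
  finally have "a^2 * (m^2 * v^2) * (p * q) \<le> a^2 * (m^2 * v^2) * (\<tau> * (h^2 * h^2))"
    by (rule mult_left_mono) simp
  thus ?thesis by (simp add: M2_def Q0_def power2_eq_square mult_ac)
qed

text \<open>Comparison with \<open>Q0^2\<close> is so generous that the linear terms of
  \<open>Qa\<close> can be bounded one by one, with no cancellation against \<open>Qb\<close>. The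
  total 5 * (4 + 4 + 12 + 12 + 6132) is rounded up.\<close>

lemma Qa_variance_le: "EN (\<lambda>A. (Qa n A - EN (Qa n))^2) \<le> 40000 * (\<tau> * Q0^2)"
proof -
  define X1 where "X1 = single TT FF FT FF"
  define X2 where "X2 = single FT FF TT FF"
  define X3 where "X3 = single FF FT FF TT"
  define X4 where "X4 = single FF TT FF FT"
  define X6 where "X6 = rest TT FF FT FF"
  define T where "T = \<tau> * Q0^2"
  have T: "T \<ge> 0" by (simp add: T_def)
  have b1: "EN (\<lambda>A. (X1 A)^2) \<le> 4 * T"
  proof -
    have "EN (\<lambda>A. (X1 A)^2) \<le> 4 * (((v * m)^2 * a) * ((\<Sum>i<n. eta i) * (\<Sum>i<n. eta i)))"
      unfolding X1_def single_def
    proof (rule weighted_le[where B="\<lambda>i j. a * eta i * eta j"])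
      fix i j assume ij: "(i,j) \<in> distinct2 n"
      have "(coef2 FF FT FF (i,j))^2 \<le> (v * m)^2"
        by (rule power_mono[OF _ coef2_nonneg]) (use coef2_FF_FT_FF(2)[OF ij] in simp)
      from mult_right_mono[OF this, of "a * eta i * eta j"]
      show "(coef2 FF FT FF (i,j))^2 * (a * eta i * eta j) \<le> (v * m)^2 * a * (eta i * eta j)"
        by (simp add: mult_ac)
    qed (auto intro: order_trans[OF pr_var_le(1)] simp: pr_le[unfolded mult.assoc] mult.assoc)
    also have "\<dots> = 4 * M1" unfolding h_def[symmetric] M1_def by (simp add: power2_eq_square mult_ac)
    finally show ?thesis using M1_le_Q0 unfolding T_def by linarith
  qed
  have b2: "EN (\<lambda>A. (X2 A)^2) \<le> 4 * T"
  proof -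
    have "EN (\<lambda>A. (X2 A)^2) \<le> 4 * ((a * (h * h))^2 * ((\<Sum>i<n. nu i) * (\<Sum>j<n. mu j)))"
      unfolding X2_def single_def
    proof (rule weighted_le[where B="\<lambda>i j. mu j * nu i"])
      fix i j assume ij: "(i,j) \<in> distinct2 n"
      have "(coef2 FF TT FF (i,j))^2 \<le> (a * (h * h))^2"
        by (rule power_mono[OF coef2_FF_TT_FF(2)[OF ij] coef2_nonneg])
      from mult_right_mono[OF this, of "mu j * nu i"]
      show "(coef2 FF TT FF (i,j))^2 * (mu j * nu i) \<le> (a * (h * h))^2 * (nu i * mu j)"
        by (simp add: mult_ac)
    qed (auto intro: order_trans[OF pr_var_le(1)] simp: pr_le)
    also have "\<dots> = 4 * ((a * (h * h))^2 * (v * m) * 1)" unfolding v_def m_def by simp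
    also have "\<dots> \<le> 4 * ((a * (h * h))^2 * (v * m) * (\<tau> * (m * v)))"
      by (intro mult_left_mono one_le_tau_mv) auto
    also have "\<dots> = 4 * T" by (simp add: T_def Q0_def power2_eq_square mult_ac)
    finally show ?thesis .
  qed
  have tM1: "\<tau> * M1 \<le> T" using mult_right_mono[OF tau_nonneg(2) M_nonneg(1)] M1_le_Q0 by (simp add: T_def)
  have tM2: "\<tau> * M2 \<le> T" using mult_right_mono[OF tau_nonneg(2) M_nonneg(2)] M2_le_Q0 by (simp add: T_def)
  have b3: "EN (\<lambda>A. (X3 A)^2) \<le> 12 * T" using null_single_a1_le tM2 unfolding X3_def by linarith
  have b4: "EN (\<lambda>A. (X4 A)^2) \<le> 12 * T" using null_single_a2_le tM2 unfolding X4_def by linarith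
  have b6: "EN (\<lambda>A. (X6 A)^2) \<le> 6132 * T" using rest_a_second_moment_le tM1 unfolding X6_def by linarith
  have "(Qa n A - EN (Qa n))^2 \<le> 5 * ((X1 A)^2 + ((X2 A)^2 + ((X3 A)^2 + ((X4 A)^2 + (X6 A)^2))))" for A
  proof -
    have "Qa n A - EN (Qa n) = sum_list [X1 A, X2 A, X3 A, X4 A, X6 A]"
      unfolding Qa_eq_cyc EN_cyc cyc_a_eq X1_def X2_def X3_def X4_def X6_def by simp
    thus ?thesis using sum_list_squared_le[of "[X1 A, X2 A, X3 A, X4 A, X6 A]"] by simp
  qed
  hence "EN (\<lambda>A. (Qa n A - EN (Qa n))^2) \<le> EN (\<lambda>A. 5 * ((X1 A)^2 + ((X2 A)^2 + ((X3 A)^2 + ((X4 A)^2 + (X6 A)^2)))))"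
    by (rule EN_mono)
  also have "\<dots> = 5 * (EN (\<lambda>A. (X1 A)^2) + (EN (\<lambda>A. (X2 A)^2) + (EN (\<lambda>A. (X3 A)^2) + (EN (\<lambda>A. (X4 A)^2) + EN (\<lambda>A. (X6 A)^2)))))"
    by (simp add: EN_add)
  also have "\<dots> \<le> 5 * (4 * T + (4 * T + (12 * T + (12 * T + 6132 * T))))"
    by (intro mult_left_mono add_mono b1 b2 b3 b4 b6) auto
  also have "\<dots> \<le> 40000 * T" using T by simp
  finally show ?thesis by (simp add: T_def)
qed

lemma Qa_mean_ge: "EN (Qa n) \<ge> Q0 / 2"
proof -
  have "EN (Qa n) = mean4 TT FF FT FF" by (simp add: Qa_eq_cyc EN_cyc)
  also have "\<dots> = (\<Sum>e\<in>distinct2 n. pr TT e * coef2 FF FT FF e)"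
    unfolding mean4_def coef2_def
    by (subst sum_distinct4_fibre2) (simp add: sum_distrib_left case_prod_beta mult_ac)
  finally have e: "EN (Qa n) = (\<Sum>e\<in>distinct2 n. pr TT e * coef2 FF FT FF e)" .
  \<comment> \<open>98/100 bounds \<open>K\<close> from below, 89/100 is 1 - 11/100 from the
    relative error of the coefficient, and 87/100 is below their product.\<close>
  have f1: "(\<Sum>e\<in>distinct2 n. (\<lambda>(i,j). (a * (v * m) * (87/100)) * (eta i * eta j)) e) \<le> (\<Sum>e\<in>distinct2 n. pr TT e * coef2 FF FT FF e)"
  proof (rule sum_mono)
    fix e assume e: "e \<in> distinct2 n"
    obtain i j where ij: "e = (i,j)" by (cases e)
    have ijn: "i < n" "j < n" using e ij by (auto simp: distinct2_def)
    have vm: "v * m \<ge> 0" by simp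
    have "11 * \<tau> * (v * m) \<le> (11/100) * (v * m)" by (rule mult_right_mono) (use tau vm in auto)
    hence c: "(89/100) * (v * m) \<le> coef2 FF FT FF (i,j)" using abs_le_D2[OF coef2_FF_FT_FF(1)[OF e[unfolded ij]]] unfolding mult_1 by linarith
    have "(98/100) \<le> K i j" using K_ge[OF ijn] tau by linarith
    hence k: "(98/100) * (a * eta i * eta j) \<le> pr TT (i,j)" unfolding pr_eq by (rule mult_right_mono) auto
    have "((98/100) * (a * eta i * eta j)) * ((89/100) * (v * m)) \<le> pr TT (i,j) * coef2 FF FT FF (i,j)"
      by (rule mult_mono[OF k c]) auto
    moreover have "(a * (v * m) * (87/100)) * (eta i * eta j) \<le> ((98/100) * (a * eta i * eta j)) * ((89/100) * (v * m))"
    proof -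
      have "(87/100) * (a * (v * m) * (eta i * eta j)) \<le> (98/100*(89/100)) * (a * (v * m) * (eta i * eta j))"
        by (rule mult_right_mono) auto
      thus ?thesis by (simp add: mult_ac)
    qed
    ultimately have "(a * (v * m) * (87/100)) * (eta i * eta j) \<le> pr TT (i,j) * coef2 FF FT FF (i,j)"
      by (rule order_trans[rotated])
    thus "(\<lambda>(i,j). (a * (v * m) * (87/100)) * (eta i * eta j)) e \<le> pr TT e * coef2 FF FT FF e"
      unfolding ij prod.case .
  qed
  have f2: "(\<Sum>e\<in>distinct2 n. (\<lambda>(i,j). (a * (v * m) * (87/100)) * (eta i * eta j)) e)
      = (a * (v * m) * (87/100)) * (\<Sum>(i,j)\<in>distinct2 n. eta i * eta j)"
    by (simp add: sum_distrib_left case_prod_beta)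
  have f3: "(\<Sum>(i,j)\<in>distinct2 n. eta i * eta j) = h^2 - h2"
  proof -
    have "(\<Sum>i<n. \<Sum>j<n. eta i * eta j) = (\<Sum>e\<in>distinct2 n. eta (fst e) * eta (snd e)) + h2"
      using sum_split_diagonal[of "\<lambda>e. eta (fst e) * eta (snd e)" n] by (simp add: h2_def power2_eq_square)
    moreover have "(\<Sum>i<n. \<Sum>j<n. eta i * eta j) = h^2"
      by (simp add: h_def power2_eq_square sum_product)
    ultimately show ?thesis by (simp add: case_prod_beta)
  qed
  have f4: "(a * (v * m) * (87/100)) * ((99/100) * h^2) \<le> (a * (v * m) * (87/100)) * (h^2 - h2)"
  proof (rule mult_left_mono)
    have "h2 \<le> (\<tau> * h) * h" using h2_le mult_right_mono[OF ex_le_tau_h sums_nonneg(1)] by linarith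
    also have "\<dots> \<le> (1/100) * h^2" using mult_right_mono[OF tau(2), of "h^2"] by (simp add: power2_eq_square)
    finally show "(99/100) * h^2 \<le> h^2 - h2" by simp
  qed simp
  have f5: "Q0 / 2 \<le> (a * (v * m) * (87/100)) * ((99/100) * h^2)"
  proof -
    have "(1/2) * Q0 \<le> (87/100 * (99/100)) * Q0" by (rule mult_right_mono) (auto simp: Q0_def)
    thus ?thesis by (simp add: Q0_def mult_ac)
  qed
  show ?thesis unfolding e by (rule order_trans[OF order_trans[OF f5 f4]]) (rule f1[unfolded f2 f3])
qed

end

section \<open>Variance and increments of the linear statistic\<close>

text \<open>An identity rather than a bound: the central limit theorem asks for total variance
  exactly 1, so the linear statistic must be divided by its exact standard deviation.\<close>

lemma Pi_pmf_sum_second_moment: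
  fixes p :: "'d \<Rightarrow> 's::finite pmf" and X :: "'d \<Rightarrow> 's \<Rightarrow> real"
  assumes D: "finite D" and mean: "\<And>d. d \<in> D \<Longrightarrow> measure_pmf.expectation (p d) (X d) = 0"
  shows "measure_pmf.expectation (Pi_pmf D dflt p) (\<lambda>f. (\<Sum>d\<in>D. X d (f d))^2)
     = (\<Sum>d\<in>D. measure_pmf.expectation (p d) (\<lambda>s. (X d s)^2))"
proof -
  let ?E = "measure_pmf.expectation (Pi_pmf D dflt p)"
  have int: "integrable (measure_pmf (Pi_pmf D dflt p)) h" for h :: "_ \<Rightarrow> real"
    by (rule integrable_Pi_pmf[OF D])
  have cross: "?E (\<lambda>f. X d (f d) * X d' (f d')) = (if d = d' then measure_pmf.expectation (p d) (\<lambda>s. (X d s)^2) else 0)"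
    if d: "d \<in> D" "d' \<in> D" for d d'
  proof (cases "d = d'")
    case True
    have "?E (\<lambda>f. X d (f d) * X d' (f d')) = ?E (\<lambda>f. \<Prod>c\<in>{d}. (X c (f c))^2)"
      by (simp add: True power2_eq_square)
    also have "\<dots> = (\<Prod>c\<in>{d}. measure_pmf.expectation (p c) (\<lambda>s. (X c s)^2))"
      by (rule expectation_prod_Pi_pmf_subset[OF D]) (use d in auto)
    finally show ?thesis using True by simp
  next
    case False
    have "?E (\<lambda>f. X d (f d) * X d' (f d')) = ?E (\<lambda>f. \<Prod>c\<in>{d,d'}. X c (f c))"
      using False by simp
    also have "\<dots> = (\<Prod>c\<in>{d,d'}. measure_pmf.expectation (p c) (X c))"
      by (rule expectation_prod_Pi_pmf_subset[OF D]) (use d in auto)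
    also have "\<dots> = 0" using False mean[OF d(1)] by simp
    finally show ?thesis using False by simp
  qed
  have "?E (\<lambda>f. (\<Sum>d\<in>D. X d (f d))^2) = ?E (\<lambda>f. \<Sum>d\<in>D. \<Sum>d'\<in>D. X d (f d) * X d' (f d'))"
    by (simp add: power2_eq_square sum_product)
  also have "\<dots> = (\<Sum>d\<in>D. \<Sum>d'\<in>D. ?E (\<lambda>f. X d (f d) * X d' (f d')))"
    by (simp add: Bochner_Integration.integral_sum int)
  also have "\<dots> = (\<Sum>d\<in>D. \<Sum>d'\<in>D. if d = d' then measure_pmf.expectation (p d) (\<lambda>s. (X d s)^2) else 0)"
    by (intro sum.cong refl cross)
  also have "\<dots> = (\<Sum>d\<in>D. measure_pmf.expectation (p d) (\<lambda>s. (X d s)^2))"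
    using D by simp
  finally show ?thesis .
qed

lemma sum_distinct2_ordered:
  fixes g :: "nat \<times> nat \<Rightarrow> real"
  shows "(\<Sum>e\<in>distinct2 n. g e) = (\<Sum>d\<in>ordered_pairs n. g d + g (prod.swap d))"
proof -
  have u: "distinct2 n = ordered_pairs n \<union> prod.swap ` ordered_pairs n"
    by (auto simp: distinct2_def ordered_pairs_def image_iff)
  have "(\<Sum>e\<in>distinct2 n. g e) = (\<Sum>d\<in>ordered_pairs n. g d) + (\<Sum>d\<in>prod.swap ` ordered_pairs n. g d)"
    unfolding u by (rule sum.union_disjoint) (simp_all, auto simp: ordered_pairs_def)
  also have "(\<Sum>d\<in>prod.swap ` ordered_pairs n. g d) = (\<Sum>d\<in>ordered_pairs n. g (prod.swap d))"
    by (subst sum.reindex) (auto simp: inj_on_def)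
  finally show ?thesis by (simp add: sum.distrib)
qed

text \<open>The value 0 has probability at least 1/2, so by Cauchy-Schwarz on the remaining mass the
  squared mean is at most half of the second moment: centring loses at most one half.\<close>

lemma four_point_variance:
  fixes p0 p1 p2 p3 c1 c2 c3 :: real
  assumes "p0 + p1 + p2 + p3 = 1" "p0 \<ge> 1/2" "p1 \<ge> 0" "p2 \<ge> 0" "p3 \<ge> 0"
  defines "M \<equiv> c1 * p1 + c2 * p2 + c3 * p3"
  shows "p0 * (0 - M)^2 + p1 * (c1 - M)^2 + p2 * (c2 - M)^2 + p3 * (c3 - M)^2 \<ge> (c1^2 * p1 + c2^2 * p2 + c3^2 * p3) / 2"
proof -
  let ?S = "c1^2 * p1 + c2^2 * p2 + c3^2 * p3"
  have "p0 * (0 - M)^2 + p1 * (c1 - M)^2 + p2 * (c2 - M)^2 + p3 * (c3 - M)^2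
     = (p0 + p1 + p2 + p3) * M^2 - 2 * M * (c1 * p1 + c2 * p2 + c3 * p3) + ?S"
    by (simp add: power2_eq_square algebra_simps)
  also have "\<dots> = ?S - M^2" using assms(1) by (simp add: M_def[symmetric] power2_eq_square)
  finally have e: "p0 * (0 - M)^2 + p1 * (c1 - M)^2 + p2 * (c2 - M)^2 + p3 * (c3 - M)^2 = ?S - M^2" .
  \<comment> \<open>Lagrange's identity for the weights p1, p2, p3.\<close>
  have "(p1 + p2 + p3) * ?S - M^2 = p1 * p2 * (c1 - c2)^2 + p1 * p3 * (c1 - c3)^2 + p2 * p3 * (c2 - c3)^2"
    unfolding M_def by (simp add: power2_eq_square algebra_simps)
  also have "\<dots> \<ge> 0" using assms by (intro add_nonneg_nonneg mult_nonneg_nonneg) auto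
  finally have "M^2 \<le> (p1 + p2 + p3) * ?S" by simp
  also have "\<dots> \<le> (1/2) * ?S"
    by (rule mult_right_mono) (use assms in \<open>auto intro!: add_nonneg_nonneg mult_nonneg_nonneg\<close>)
  finally show ?thesis unfolding e by argo
qed

context p1_model begin

text \<open>Contribution of one unordered dyad to \<open>lin\<close>. A reciprocal dyad is met in
  both directions, hence the 2; an asymmetric one enters with the \<open>kap\<close> of its own
  direction.\<close>

definition xi :: "nat \<times> nat \<Rightarrow> bool \<times> bool \<Rightarrow> real" where
  "xi d s = 2 * (v * m) * cind TT d s + kap d * cind TF d s + kap (prod.swap d) * cind FT d s"

lemma cind_swap_TT: "cind TT (prod.swap e) (state A (prod.swap e)) = cind TT e (state A e)"
  by (cases e) (auto simp: cind_def ind_def state_def pr_eq K_sym)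

lemma cind_swap_TF: "cind TF (prod.swap e) (state A (prod.swap e)) = cind FT e (state A e)"
  by (cases e) (auto simp: cind_def ind_def state_def pr_eq K_sym)

lemma lin_adjacency: "lin (adjacency f) = (\<Sum>d\<in>ordered_pairs n. xi d (f d))"
proof -
  have st: "state (adjacency f) d = f d" if "d \<in> ordered_pairs n" for d
    using that by (auto simp: ordered_pairs_def state_def adjacency_def)
  show ?thesis unfolding lin_def sum_distinct2_ordered sum.distrib[symmetric]
    by (rule sum.cong) (auto simp: cind_swap_TT cind_swap_TF st xi_def algebra_simps)
qed

lemma Ed_xi: "Ed d (xi d) = 0"
  unfolding xi_def by (simp add: Bochner_Integration.integral_add Ed_cind)

lemma Ed_states:
  "Ed e \<phi> = pr FF e * \<phi> FF + pr TF e * \<phi> TF + pr FT e * \<phi> FT + pr TT e * \<phi> TT" for \<phi> :: "_ \<Rightarrow> real"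
  by (subst integral_measure_pmf_real[of UNIV]) (auto simp: UNIV_bool2 pr_def algebra_simps)

lemma pr_total: "pr FF e + pr TF e + pr FT e + pr TT e = 1"
  using Ed_states[of e "\<lambda>_. 1"] by simp

definition lin_var :: real where "lin_var = EN (\<lambda>A. (lin A)^2)"

lemma lin_var_eq: "lin_var = (\<Sum>d\<in>ordered_pairs n. Ed d (\<lambda>s. (xi d s)^2))"
proof -
  have "lin_var = measure_pmf.expectation PM (\<lambda>f. (\<Sum>d\<in>ordered_pairs n. xi d (f d))^2)"
    unfolding lin_var_def NM_def by (simp add: lin_adjacency)
  also have "\<dots> = (\<Sum>d\<in>ordered_pairs n. Ed d (\<lambda>s. (xi d s)^2))"
    unfolding PM_def by (rule Pi_pmf_sum_second_moment) (simp_all add: Ed_xi)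
  finally show ?thesis .
qed

lemma EN_U: "EN (Ustat n \<rho>) = 0"
proof -
  have "EN (Ustat n \<rho>) = EN (Qa n) - a * EN (Qb n)"
    unfolding Ustat_def a_def[symmetric] by (simp add: EN_diff)
  thus ?thesis unfolding Qa_eq_cyc Qb_eq_cyc EN_cyc mean4_a_eq by simp
qed

end

context p1_small begin

lemma h2_le_h_sq: "h2 \<le> (1/100) * h^2"
proof -
  have "h2 \<le> (\<tau> * h) * h" using h2_le mult_right_mono[OF ex_le_tau_h sums_nonneg(1)] by linarith
  also have "\<dots> \<le> (1/100) * h^2" using mult_right_mono[OF tau(2), of "h^2"] by (simp add: power2_eq_square)
  finally show ?thesis .
qed

lemma xi_var_ge:
  assumes "d \<in> ordered_pairs n"
  shows "Ed d (\<lambda>s. (xi d s)^2) \<ge> ((kap d)^2 * pr TF d + (kap (prod.swap d))^2 * pr FT d + (2 * (v * m))^2 * pr TT d) / 2"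
proof -
  obtain i j where d: "d = (i,j)" by (cases d)
  have ij: "i < n" "j < n" using assms d by (auto simp: ordered_pairs_def)
  \<comment> \<open>Up to this mean, \<open>xi\<close> takes the value 0 on the empty state, which
    has probability at least 1/2 by \<open>K_half\<close>; this is the situation of
    \<open>four_point_variance\<close>.\<close>
  define M where "M = kap d * pr TF d + kap (prod.swap d) * pr FT d + 2 * (v * m) * pr TT d"
  have x: "xi d FF = 0 - M" "xi d TF = kap d - M" "xi d FT = kap (prod.swap d) - M" "xi d TT = 2 * (v * m) - M"
    by (simp_all add: xi_def M_def cind_def ind_def algebra_simps)
  show ?thesis unfolding Ed_states x M_def
    by (rule four_point_variance[OF pr_total]) (use K_half[OF ij] in \<open>auto simp: d pr_eq\<close>)
qed

text \<open>The factor 1/4 is 1/2 from centring times 1/2 from \<open>K\<close>. The square (2 v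
  m)^2 of a dyad is shared by its two directions, which leaves 2 (v m)^2 for each.\<close>

lemma lin_var_ge_sum:
  "lin_var \<ge> (1/4) * (\<Sum>e\<in>distinct2 n. 2 * (v * m)^2 * (a * (eta (fst e) * eta (snd e))) + (kap e)^2 * (mu (fst e) * nu (snd e)))"
proof -
  let ?G = "\<lambda>e. 2 * (v * m)^2 * (a * (eta (fst e) * eta (snd e))) + (kap e)^2 * (mu (fst e) * nu (snd e))"
  have "(1/4) * (\<Sum>e\<in>distinct2 n. ?G e) = (\<Sum>d\<in>ordered_pairs n. (1/4) * (?G d + ?G (prod.swap d)))"
    by (simp only: sum_distinct2_ordered[of ?G n] sum_distrib_left)
  also have "\<dots> \<le> lin_var" unfolding lin_var_eq
  proof (rule sum_mono)
    fix d assume d: "d \<in> ordered_pairs n"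
    obtain i j where ij: "d = (i,j)" by (cases d)
    have ijn: "i < n" "j < n" using d ij by (auto simp: ordered_pairs_def)
    have "(1/2) * (mu i * nu j) \<le> pr TF d" "(1/2) * (mu j * nu i) \<le> pr FT d" "(1/2) * (a * eta i * eta j) \<le> pr TT d"
      unfolding ij pr_eq by (intro mult_right_mono K_half[OF ijn]; simp)+
    hence "((kap d)^2 * ((1/2) * (mu i * nu j)) + (kap (prod.swap d))^2 * ((1/2) * (mu j * nu i)) + (2 * (v * m))^2 * ((1/2) * (a * eta i * eta j))) / 2
      \<le> ((kap d)^2 * pr TF d + (kap (prod.swap d))^2 * pr FT d + (2 * (v * m))^2 * pr TT d) / 2"
      by (intro divide_right_mono add_mono mult_left_mono) auto
    also have "\<dots> \<le> Ed d (\<lambda>s. (xi d s)^2)" by (rule xi_var_ge[OF d])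
    finally show "(1/4) * (?G d + ?G (prod.swap d)) \<le> Ed d (\<lambda>s. (xi d s)^2)"
      unfolding ij by (simp add: power_mult_distrib algebra_simps)
  qed
  finally show ?thesis .
qed

text \<open>The sum is bounded twice, through q and through p. The product of the two bounds is mx^3
  nx^3 p q, where (SP1) absorbs mx^2 nx^2 and mx nx gives one more \<open>\<tau>\<close>; a square
  root finishes.\<close>

lemma sum_eta_cubed: "(\<Sum>i<n. eta i * (eta i)^2) \<le> \<tau> * (p * q)"
proof -
  let ?W = "\<Sum>i<n. eta i * (eta i)^2"
  have W0: "?W \<ge> 0" by (intro sum_nonneg) auto
  have sq: "(mu i)^2 \<le> mx^2" "(nu i)^2 \<le> nx^2" if "i < n" for i
    using that by (auto intro!: power_mono mu_le nu_le)
  have A: "?W \<le> (mx^2 * nx) * q" unfolding q_def sum_distrib_left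
  proof (rule sum_mono)
    fix i assume "i \<in> {..<n}" hence i: "i < n" by simp
    have "(mu i)^2 * nu i \<le> mx^2 * nx" by (intro mult_mono sq nu_le i) auto
    from mult_right_mono[OF this, of "nu i * eta i"]
    show "eta i * (eta i)^2 \<le> mx^2 * nx * (nu i * eta i)" by (simp add: eta_def power2_eq_square mult_ac)
  qed
  have B: "?W \<le> (nx^2 * mx) * p" unfolding p_def sum_distrib_left
  proof (rule sum_mono)
    fix i assume "i \<in> {..<n}" hence i: "i < n" by simp
    have "(nu i)^2 * mu i \<le> nx^2 * mx" by (intro mult_mono sq mu_le i) auto
    from mult_right_mono[OF this, of "mu i * eta i"]
    show "eta i * (eta i)^2 \<le> nx^2 * mx * (mu i * eta i)" by (simp add: eta_def power2_eq_square mult_ac)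
  qed
  have "?W * ?W \<le> ((mx^2 * nx) * q) * ((nx^2 * mx) * p)" by (rule mult_mono[OF A B]) (use W0 in auto)
  also have "\<dots> = ((mx * nx) * (mx^2 * nx^2)) * (p * q)" by (simp add: power2_eq_square mult_ac)
  also have "\<dots> \<le> (\<tau> * (\<tau> * (p * q))) * (p * q)"
    by (intro mult_right_mono mult_mono mx_nx_le_tau sp) auto
  finally have "?W^2 \<le> (\<tau> * (p * q))^2" by (simp add: power2_eq_square mult_ac)
  thus ?thesis by (rule power2_le_imp_le) auto
qed

text \<open>The product X of the two brackets is at least h^2, and then |2 h^2 - X| <= X.\<close>

lemma kap_abs: "\<bar>kap (i,j)\<bar> \<le> a * ((h + mu j * v) * (h + nu i * m))"
proof -
  have "h * h \<le> (h + mu j * v) * (h + nu i * m)" by (intro mult_mono) auto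
  hence "\<bar>2 * h^2 - (h + mu j * v) * (h + nu i * m)\<bar> \<le> (h + mu j * v) * (h + nu i * m)"
    by (simp add: power2_eq_square abs_le_iff)
  from mult_left_mono[OF this, of a] show ?thesis unfolding kap_def by (simp add: abs_mult)
qed

lemma kap_sq_le: "(kap (i,j))^2 \<le> a^2 * ((h + mu j * v)^2 * (h + nu i * m)^2)"
proof -
  have "(kap (i,j))^2 \<le> (a * ((h + mu j * v) * (h + nu i * m)))^2"
    by (rule power2_le_iff_abs_le[THEN iffD2, OF _ kap_abs]) (intro mult_nonneg_nonneg add_nonneg_nonneg; simp)
  thus ?thesis by (simp add: power_mult_distrib)
qed

text \<open>Up to the factor a^2, expanding the square gives 4 h^4 m v, a cross term -16 h^4 m v
  because both brackets have weighted mean 2 h, and the product of the two second moments, which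
  contains 9 h^4 m v. The resulting -3 h^4 m v is outweighed by 3 h^2 m v (q m + p v), and
  \<open>M2\<close> survives in full.\<close>

lemma sum_kap_ge: "(\<Sum>i<n. \<Sum>j<n. (kap (i,j))^2 * (mu i * nu j)) \<ge> M2"
proof -
  define F where "F i = h + nu i * m" for i
  define G where "G j = h + mu j * v" for j
  have f1: "(\<Sum>i<n. mu i * F i) = 2 * h * m"
  proof -
    have "(\<Sum>i<n. mu i * F i) = (\<Sum>i<n. h * mu i + m * eta i)"
      by (rule sum.cong) (auto simp: F_def eta_def algebra_simps)
    thus ?thesis by (simp only: sum.distrib sum_distrib_left[symmetric] m_def[symmetric] h_def[symmetric]) simp
  qed
  have g1: "(\<Sum>i<n. nu i * G i) = 2 * h * v"
  proof -
    have "(\<Sum>i<n. nu i * G i) = (\<Sum>i<n. h * nu i + v * eta i)"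
      by (rule sum.cong) (auto simp: G_def eta_def algebra_simps)
    thus ?thesis by (simp only: sum.distrib sum_distrib_left[symmetric] v_def[symmetric] h_def[symmetric]) simp
  qed
  have f2: "(\<Sum>i<n. mu i * (F i)^2) = 3 * h^2 * m + q * m^2" unfolding F_def by (rule sum_mu_sq)
  have g2: "(\<Sum>i<n. nu i * (G i)^2) = 3 * h^2 * v + p * v^2" unfolding G_def by (rule sum_nu_sq)
  have "(\<Sum>i<n. \<Sum>j<n. (kap (i,j))^2 * (mu i * nu j))
     = (\<Sum>i<n. \<Sum>j<n. a^2 * ((4 * h^2 * h^2) * (mu i * nu j) - (4 * h^2) * ((mu i * F i) * (nu j * G j)) + (mu i * (F i)^2) * (nu j * (G j)^2)))"
    by (intro sum.cong refl) (simp add: kap_def F_def[symmetric] G_def[symmetric] power_mult_distrib, simp add: power2_eq_square algebra_simps)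
  also have "\<dots> = a^2 * ((4 * h^2 * h^2) * (m * v) - (4 * h^2) * ((2 * h * m) * (2 * h * v)) + (3 * h^2 * m + q * m^2) * (3 * h^2 * v + p * v^2))"
    by (simp only: sum_distrib_left[symmetric] sum_distrib_right[symmetric] sum.distrib sum_subtractf f1 g1 f2 g2
        m_def[symmetric] v_def[symmetric])
  also have "\<dots> = a^2 * (m * v) * (3 * (h^2 * (q * m - h^2)) + 3 * (h^2 * (p * v - h^2)) + 3 * (h^2 * h^2)) + M2"
    by (simp add: M2_def power2_eq_square algebra_simps)
  finally have e: "(\<Sum>i<n. \<Sum>j<n. (kap (i,j))^2 * (mu i * nu j)) = \<dots>" .
  have "a^2 * (m * v) * (3 * (h^2 * (q * m - h^2)) + 3 * (h^2 * (p * v - h^2)) + 3 * (h^2 * h^2)) \<ge> 0"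
    using h_sq_le_qm h_sq_le_pv by (intro mult_nonneg_nonneg add_nonneg_nonneg) auto
  thus ?thesis unfolding e by linarith
qed

text \<open>The variance sums over distinct pairs, so the diagonal must be subtracted from
  \<open>sum_kap_ge\<close>. Splitting each bracket by (x + y)^2 <= 2 (x^2 + y^2) yields four sums
  with the prefactor 4 a^2, each at most \<open>\<tau>\<close> m^2 v^2 p q; hence 16.\<close>

lemma sum_kap_diagonal_le: "(\<Sum>i<n. (kap (i,i))^2 * (mu i * nu i)) \<le> 16 * (\<tau> * M2)"
proof -
  define N where "N = m^2 * v^2 * (p * q)"
  have sqs: "(x + y)^2 \<le> 2 * (x^2 + y^2)" for x y :: real
    using sum_squares_bound[of x y] by (simp add: power2_sum)
  have "(kap (i,i))^2 * (mu i * nu i) \<le> (4 * a^2) * (h^2 * h^2 * eta i + h^2 * m^2 * (nu i * (nu i * eta i)) + h^2 * v^2 * (mu i * (mu i * eta i)) + m^2 * v^2 * (eta i * (eta i)^2))" for i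
  proof -
    have "(h + mu i * v)^2 * (h + nu i * m)^2 \<le> (2 * (h^2 + (mu i * v)^2)) * (2 * (h^2 + (nu i * m)^2))"
      by (intro mult_mono sqs) auto
    hence "a^2 * ((h + mu i * v)^2 * (h + nu i * m)^2) \<le> a^2 * ((2 * (h^2 + (mu i * v)^2)) * (2 * (h^2 + (nu i * m)^2)))"
      by (rule mult_left_mono) simp
    with kap_sq_le[of i i] have "(kap (i,i))^2 \<le> a^2 * ((2 * (h^2 + (mu i * v)^2)) * (2 * (h^2 + (nu i * m)^2)))" by linarith
    from mult_right_mono[OF this, of "mu i * nu i"]
    have "(kap (i,i))^2 * (mu i * nu i) \<le> a^2 * ((2 * (h^2 + (mu i * v)^2)) * (2 * (h^2 + (nu i * m)^2))) * (mu i * nu i)" by simp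
    also have "\<dots> = (4 * a^2) * (h^2 * h^2 * eta i + h^2 * m^2 * (nu i * (nu i * eta i)) + h^2 * v^2 * (mu i * (mu i * eta i)) + m^2 * v^2 * (eta i * (eta i)^2))"
      by (simp add: eta_def power2_eq_square algebra_simps)
    finally show ?thesis .
  qed
  hence "(\<Sum>i<n. (kap (i,i))^2 * (mu i * nu i)) \<le> (\<Sum>i<n. (4 * a^2) * (h^2 * h^2 * eta i + h^2 * m^2 * (nu i * (nu i * eta i)) + h^2 * v^2 * (mu i * (mu i * eta i)) + m^2 * v^2 * (eta i * (eta i)^2)))"
    by (intro sum_mono)
  also have "\<dots> = (4 * a^2) * (h^2 * h^2 * h + h^2 * m^2 * (\<Sum>i<n. nu i * (nu i * eta i)) + h^2 * v^2 * (\<Sum>i<n. mu i * (mu i * eta i)) + m^2 * v^2 * (\<Sum>i<n. eta i * (eta i)^2))"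
    unfolding h_def by (simp only: sum_distrib_left[symmetric] sum.distrib)
  also have "\<dots> \<le> (4 * a^2) * (\<tau> * N + \<tau> * N + \<tau> * N + \<tau> * N)"
  proof (intro mult_left_mono add_mono)
    have "h \<le> \<tau> * (v * m)"
    proof -
      have "mx * v \<le> \<tau> * v" by (rule mult_right_mono[OF mx_tau]) simp
      moreover have "v * 1 \<le> v * m" by (rule mult_left_mono[OF m_ge_1]) simp
      hence "\<tau> * v \<le> \<tau> * (v * m)" by (intro mult_left_mono) auto
      ultimately show ?thesis using h_le_v by linarith
    qed
    hence "(h^2 * h^2) * h \<le> ((p * v) * (q * m)) * (\<tau> * (v * m))" by (intro mult_mono[OF h_pow4_le]) auto
    thus "h^2 * h^2 * h \<le> \<tau> * N" by (simp add: N_def power2_eq_square mult_ac)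
    have "(\<Sum>i<n. nu i * (nu i * eta i)) \<le> nx * q" unfolding q_def by (rule sum_mult_le) (auto simp: nu_le)
    also have "\<dots> \<le> (\<tau> * v) * q" by (rule mult_right_mono[OF nx_le_tau_v]) simp
    finally have "(h^2 * m^2) * (\<Sum>i<n. nu i * (nu i * eta i)) \<le> ((p * v) * m^2) * ((\<tau> * v) * q)"
      by (intro mult_mono h_sq_le_pv) (auto intro!: sum_nonneg)
    thus "h^2 * m^2 * (\<Sum>i<n. nu i * (nu i * eta i)) \<le> \<tau> * N" by (simp add: N_def power2_eq_square mult_ac)
    have "(\<Sum>i<n. mu i * (mu i * eta i)) \<le> mx * p" unfolding p_def by (rule sum_mult_le) (auto simp: mu_le)
    also have "\<dots> \<le> (\<tau> * m) * p" by (rule mult_right_mono[OF mx_le_tau_m]) simp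
    finally have "(h^2 * v^2) * (\<Sum>i<n. mu i * (mu i * eta i)) \<le> ((q * m) * v^2) * ((\<tau> * m) * p)"
      by (intro mult_mono h_sq_le_qm) (auto intro!: sum_nonneg)
    thus "h^2 * v^2 * (\<Sum>i<n. mu i * (mu i * eta i)) \<le> \<tau> * N" by (simp add: N_def power2_eq_square mult_ac)
    have "(m^2 * v^2) * (\<Sum>i<n. eta i * (eta i)^2) \<le> (m^2 * v^2) * (\<tau> * (p * q))"
      by (rule mult_left_mono[OF sum_eta_cubed]) simp
    thus "m^2 * v^2 * (\<Sum>i<n. eta i * (eta i)^2) \<le> \<tau> * N" by (simp add: N_def mult_ac)
  qed simp
  also have "\<dots> = 16 * (\<tau> * M2)" by (simp add: M2_def N_def)
  finally show ?thesis .
qed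

text \<open>84/100 is 1 - 16 \<open>\<tau>\<close> at \<open>\<tau>\<close> = 1/100, and 198/100
  comes from the diagonal loss h2 <= h^2 / 100. A quarter of either exceeds 1/5.\<close>

lemma lin_var_ge: "M1 + M2 \<le> 5 * lin_var"
proof -
  have "(\<Sum>e\<in>distinct2 n. (kap e)^2 * (mu (fst e) * nu (snd e))) \<ge> M2 - 16 * (\<tau> * M2)"
    using sum_split_diagonal[of "\<lambda>e. (kap e)^2 * (mu (fst e) * nu (snd e))" n] sum_kap_ge sum_kap_diagonal_le by simp
  moreover have "16 * (\<tau> * M2) \<le> (16/100) * M2"
    using mult_right_mono[OF tau(2), of M2] by simp
  ultimately have k: "(\<Sum>e\<in>distinct2 n. (kap e)^2 * (mu (fst e) * nu (snd e))) \<ge> (84/100) * M2" by linarith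
  have x: "(\<Sum>e\<in>distinct2 n. eta (fst e) * eta (snd e)) \<ge> (99/100) * h^2"
  proof -
    have "(\<Sum>i<n. \<Sum>j<n. eta i * eta j) = (\<Sum>e\<in>distinct2 n. eta (fst e) * eta (snd e)) + h2"
      using sum_split_diagonal[of "\<lambda>e. eta (fst e) * eta (snd e)" n] by (simp add: h2_def power2_eq_square)
    moreover have "(\<Sum>i<n. \<Sum>j<n. eta i * eta j) = h^2"
      by (simp add: h_def power2_eq_square sum_product)
    ultimately show ?thesis using h2_le_h_sq by linarith
  qed
  have "(2 * (v * m)^2 * a) * (\<Sum>e\<in>distinct2 n. eta (fst e) * eta (snd e)) \<ge> (2 * (v * m)^2 * a) * ((99/100) * h^2)"
    by (rule mult_left_mono[OF x]) simp
  hence x': "(2 * (v * m)^2 * a) * (\<Sum>e\<in>distinct2 n. eta (fst e) * eta (snd e)) \<ge> (198/100) * M1"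
    by (simp add: M1_def power_mult_distrib mult_ac)
  have "(\<Sum>e\<in>distinct2 n. 2 * (v * m)^2 * (a * (eta (fst e) * eta (snd e))) + (kap e)^2 * (mu (fst e) * nu (snd e)))
     = (2 * (v * m)^2 * a) * (\<Sum>e\<in>distinct2 n. eta (fst e) * eta (snd e)) + (\<Sum>e\<in>distinct2 n. (kap e)^2 * (mu (fst e) * nu (snd e)))"
    by (simp add: sum.distrib sum_distrib_left mult.assoc)
  hence "lin_var \<ge> (1/4) * ((198/100) * M1 + (84/100) * M2)" using lin_var_ge_sum x' k by argo
  thus ?thesis using M_nonneg by argo
qed

text \<open>v m is small against sqrt \<open>M1\<close> because a h^2 is large, and
  \<open>kap\<close> is at most 4 a mx nx v m, which (SP1) makes small against sqrt
  \<open>M2\<close>. The constant is 2 + 4 + 4.\<close>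

lemma xi_bound:
  assumes d: "d \<in> ordered_pairs n"
  shows "\<bar>xi d s\<bar> \<le> 10 * sqrt (\<tau> * (M1 + M2))"
proof -
  let ?R = "sqrt (\<tau> * (M1 + M2))"
  have vm: "v * m \<le> ?R"
  proof (rule real_le_rsqrt)
    have "(m^2 * v^2) * 1 \<le> (m^2 * v^2) * (\<tau> * (a * h^2))" by (rule mult_left_mono[OF ah_ge]) simp
    hence "(v * m)^2 \<le> \<tau> * M1" by (simp add: M1_def power_mult_distrib mult_ac)
    moreover have "\<tau> * M1 \<le> \<tau> * (M1 + M2)" by (rule mult_left_mono) auto
    ultimately show "(v * m)^2 \<le> \<tau> * (M1 + M2)" by linarith
  qed
  have kap: "\<bar>kap (i,j)\<bar> \<le> 4 * ?R" if "i < n" "j < n" for i j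
  proof -
    have "mu j * v \<le> mx * v" "nu i * m \<le> nx * m" by (intro mult_right_mono mu_le nu_le that; simp)+
    hence "h + mu j * v \<le> 2 * (mx * v)" "h + nu i * m \<le> 2 * (nx * m)" using h_le_v h_le_m by linarith+
    hence "(h + mu j * v) * (h + nu i * m) \<le> (2 * (mx * v)) * (2 * (nx * m))" by (intro mult_mono) auto
    hence "a * ((h + mu j * v) * (h + nu i * m)) \<le> a * ((2 * (mx * v)) * (2 * (nx * m)))" by (rule mult_left_mono) simp
    also have "a * ((2 * (mx * v)) * (2 * (nx * m))) = 4 * (a * (mx * nx) * (v * m))" by simp
    finally have 1: "\<bar>kap (i,j)\<bar> \<le> 4 * (a * (mx * nx) * (v * m))" by (rule order_trans[OF kap_abs])
    have "a * (mx * nx) * (v * m) \<le> ?R"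
    proof (rule real_le_rsqrt)
      have "(a^2 * (m^2 * v^2)) * (mx^2 * nx^2) \<le> (a^2 * (m^2 * v^2)) * (\<tau> * (p * q))" by (rule mult_left_mono[OF sp]) simp
      hence "(a * (mx * nx) * (v * m))^2 \<le> \<tau> * M2" by (simp add: M2_def power_mult_distrib mult_ac)
      moreover have "\<tau> * M2 \<le> \<tau> * (M1 + M2)" by (rule mult_left_mono) auto
      ultimately show "(a * (mx * nx) * (v * m))^2 \<le> \<tau> * (M1 + M2)" by linarith
    qed
    thus ?thesis using 1 by linarith
  qed
  obtain i j where ij: "d = (i,j)" by (cases d)
  have ijn: "i < n" "j < n" using d ij by (auto simp: ordered_pairs_def)
  have c: "\<bar>cind t d s\<bar> \<le> 1" for t
    using pr_nonneg[of t d] pr_le_1[of t d] by (auto simp: cind_def ind_def)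
  have cm: "\<bar>x * cind t d s\<bar> \<le> \<bar>x\<bar>" for x t
    unfolding abs_mult using mult_left_mono[OF c, of "\<bar>x\<bar>"] by simp
  have "\<bar>xi d s\<bar> \<le> \<bar>2 * (v * m) * cind TT d s\<bar> + \<bar>kap d * cind TF d s\<bar> + \<bar>kap (prod.swap d) * cind FT d s\<bar>"
    unfolding xi_def by linarith
  also have "\<dots> \<le> \<bar>2 * (v * m)\<bar> + \<bar>kap d\<bar> + \<bar>kap (prod.swap d)\<bar>" by (intro add_mono cm)
  also have "\<dots> \<le> 2 * ?R + 4 * ?R + 4 * ?R"
    by (intro add_mono) (use vm kap ijn ij in \<open>auto simp: abs_mult\<close>)
  finally show ?thesis by simp
qed

lemma lin_var_le: "lin_var \<le> 128 * (M1 + M2)"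
proof -
  define X1 where "X1 A = (\<Sum>e\<in>distinct2 n. (v * m) * cind TT e (state A e))" for A
  define X2 where "X2 A = (\<Sum>e\<in>distinct2 n. kap e * cind TF e (state A e))" for A
  have "EN (\<lambda>A. (X1 A)^2) \<le> 4 * (((v * m)^2 * a) * ((\<Sum>i<n. eta i) * (\<Sum>i<n. eta i)))"
    unfolding X1_def
    by (rule weighted_le[where B="\<lambda>i j. a * eta i * eta j"])
       (auto intro: order_trans[OF pr_var_le(1)] simp: pr_le[unfolded mult.assoc] mult_ac)
  hence 1: "EN (\<lambda>A. (X1 A)^2) \<le> 4 * M1"
    unfolding h_def[symmetric] M1_def by (simp add: power2_eq_square mult_ac)
  have "EN (\<lambda>A. (X2 A)^2) \<le> 4 * (a^2 * ((\<Sum>i<n. mu i * (h + nu i * m)^2) * (\<Sum>j<n. nu j * (h + mu j * v)^2)))"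
    unfolding X2_def
  proof (rule weighted_le[where B="\<lambda>i j. mu i * nu j"])
    fix i j
    from mult_right_mono[OF kap_sq_le[of i j], of "mu i * nu j"]
    show "(kap (i,j))^2 * (mu i * nu j) \<le> a^2 * ((mu i * (h + nu i * m)^2) * (nu j * (h + mu j * v)^2))"
      by (simp add: mult_ac)
  qed (auto intro: order_trans[OF pr_var_le(1)] simp: pr_le)
  also have "\<dots> \<le> 4 * (a^2 * ((4 * (q * m^2)) * (4 * (p * v^2))))"
    by (intro mult_left_mono mult_mono sum_mu_sq_le sum_nu_sq_le) (auto intro!: sum_nonneg)
  also have "\<dots> = 64 * M2" unfolding M2_def by (simp add: mult_ac)
  finally have 2: "EN (\<lambda>A. (X2 A)^2) \<le> 64 * M2" .
  have "(lin A)^2 \<le> 2 * ((X1 A)^2 + (X2 A)^2)" for A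
    using sum_list_squared_le[of "[X1 A, X2 A]"] by (simp add: lin_def X1_def X2_def)
  hence "lin_var \<le> EN (\<lambda>A. 2 * ((X1 A)^2 + (X2 A)^2))" unfolding lin_var_def by (rule EN_mono)
  also have "\<dots> = 2 * (EN (\<lambda>A. (X1 A)^2) + EN (\<lambda>A. (X2 A)^2))" by (simp add: EN_add)
  finally show ?thesis using 1 2 M_nonneg by argo
qed

end

section \<open>Asymptotic normality\<close>

lemma chebyshev_pmf:
  fixes M :: "'a pmf" and Z :: "'a \<Rightarrow> real"
  assumes fin: "finite (set_pmf M)" and \<delta>: "\<delta> > 0" and E: "measure_pmf.expectation M (\<lambda>x. (Z x)^2) \<le> C"
  shows "measure_pmf.prob M {x. \<bar>Z x\<bar> > \<delta>} \<le> C / \<delta>^2"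
proof -
  have int: "integrable (measure_pmf M) h" for h :: "'a \<Rightarrow> real"
    by (rule integrable_measure_pmf_finite[OF fin])
  have "measure_pmf.prob M {x. \<bar>Z x\<bar> > \<delta>} = measure_pmf.expectation M (indicator {x. \<bar>Z x\<bar> > \<delta>})"
    by simp
  also have "\<dots> \<le> measure_pmf.expectation M (\<lambda>x. (Z x)^2 / \<delta>^2)"
  proof (rule integral_mono[OF int int])
    fix x show "indicator {x. \<bar>Z x\<bar> > \<delta>} x \<le> (Z x)^2 / \<delta>^2"
    proof (cases "\<bar>Z x\<bar> > \<delta>")
      case True
      hence "\<delta>^2 \<le> (Z x)^2" using \<delta> by (simp add: abs_le_square_iff[symmetric])
      thus ?thesis using True \<delta> by simp
    qed simp
  qed
  also have "\<dots> = measure_pmf.expectation M (\<lambda>x. (Z x)^2) / \<delta>^2" by simp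
  also have "\<dots> \<le> C / \<delta>^2" using E by (simp add: divide_right_mono)
  finally show ?thesis .
qed

text \<open>With x = U / qa one has exp r qb = qa (1 - x), so the log ratio is r - ln (1 - x). Since
  |x| <= 2 M / S <= 1/4, both counts are positive and |ln (1 - x)| <= 1/4 + 1/2, so truncation at t
  >= |r| + 1 is inactive. The two errors come from the quadratic term of the logarithm and from
  replacing qa by its mean.\<close>

lemma trunc_log_ratio_expansion:
  fixes qa qb e \<sigma> r t M \<theta> :: real
  assumes pos: "e > 0" "\<sigma> > 0" and M: "M > 0" and \<theta>: "\<theta> \<le> 1/2"
    and G: "\<bar>(qa - exp r * qb) / \<sigma>\<bar> \<le> M" and w: "\<bar>qa / e - 1\<bar> \<le> \<theta>"
    and S: "8 * M \<le> e / \<sigma>" and t: "\<bar>r\<bar> + 1 \<le> t"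
  shows "\<bar>e / \<sigma> * (trunc_log_ratio qa qb t - r) - (qa - exp r * qb) / \<sigma>\<bar> \<le> 8 * M^2 / (e / \<sigma>) + 2 * M * \<theta>"
proof -
  define S where "S = e / \<sigma>"
  define g where "g = (qa - exp r * qb) / \<sigma>"
  define u where "u = qa / e"
  define x where "x = g / (S * u)"
  have Sp: "S > 0" using pos by (simp add: S_def)
  have S8: "8 * M \<le> S" using S by (simp add: S_def)
  have gM: "\<bar>g\<bar> \<le> M" using G by (simp add: g_def)
  have u: "u \<ge> 1/2" "\<bar>u - 1\<bar> \<le> \<theta>" using w \<theta> by (auto simp: u_def abs_le_iff)
  have qa: "qa = u * e" using pos by (simp add: u_def)
  have qap: "qa > 0" unfolding qa using u pos by simp
  have Suqa: "S * u = qa / \<sigma>" using pos by (simp add: S_def u_def)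
  have gx: "qa * x = qa - exp r * qb" unfolding x_def Suqa g_def using pos qap by simp
  have qb: "exp r * qb = qa * (1 - x)" using gx by (simp add: algebra_simps)
  have Su: "S * u \<ge> S / 2" using u Sp mult_left_mono[of "1/2" u S] by simp
  have xb: "\<bar>x\<bar> \<le> 2 * M / S"
  proof -
    have "\<bar>x\<bar> = \<bar>g\<bar> / (S * u)" unfolding x_def using Sp u by (simp add: abs_mult)
    also have "\<dots> \<le> M / (S / 2)" by (rule frac_le) (use gM M Su Sp in auto)
    finally show ?thesis by (simp add: mult.commute)
  qed
  have "2 * M / S \<le> 1/4" using S8 Sp by (simp add: divide_le_eq)
  hence x4: "\<bar>x\<bar> \<le> 1/4" using xb by linarith
  have x1: "1 - x > 0" using x4 by linarith
  have qbp: "qb > 0"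
  proof -
    have "exp r * qb > 0" unfolding qb using qap x1 by simp
    thus ?thesis by (simp add: zero_less_mult_iff)
  qed
  have qbe: "qb = qa * (1 - x) / exp r" using qb by (simp add: field_simps)
  have "qa / qb = exp r / (1 - x)" unfolding qbe using qap x1 by (simp add: field_simps)
  hence ln: "ln (qa / qb) = r - ln (1 - x)" using x1 by (simp add: ln_div)
  have lnx: "\<bar>ln (1 - x) + x\<bar> \<le> 2 * x^2"
    using abs_ln_one_plus_x_minus_x_bound[of "- x"] x4 by simp
  have x2: "2 * x^2 \<le> 1/2"
  proof -
    have "x^2 \<le> (1/4)^2" using x4 by (intro power2_le_iff_abs_le[THEN iffD2]) auto
    thus ?thesis by (simp add: power2_eq_square)
  qed
  have "\<bar>ln (qa / qb)\<bar> \<le> t" unfolding ln using lnx x2 x4 t by linarith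
  hence tl: "trunc_log_ratio qa qb t = r - ln (1 - x)"
    using qap qbp ln by (simp add: trunc_log_ratio_def trunc_H_def)
  have Sx: "S * x = g / u" unfolding x_def using Sp by simp
  have "S * (trunc_log_ratio qa qb t - r) - g = (S * (- (ln (1 - x) + x))) + (g / u - g)"
    unfolding tl Sx[symmetric] by (simp add: algebra_simps)
  also have "\<bar>\<dots>\<bar> \<le> S * \<bar>ln (1 - x) + x\<bar> + \<bar>g / u - g\<bar>"
    using abs_triangle_ineq[of "S * (- (ln (1 - x) + x))" "g / u - g"] Sp
    by (simp add: abs_mult abs_minus_cancel[of "ln (1-x) + x", symmetric] del: abs_minus_cancel)
  also have "\<dots> \<le> 8 * M^2 / S + 2 * M * \<theta>"
  proof (rule add_mono)
    have "x^2 \<le> (2 * M / S)^2" using xb M Sp by (intro power2_le_iff_abs_le[THEN iffD2]) auto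
    hence "\<bar>ln (1 - x) + x\<bar> \<le> 2 * (2 * M / S)^2" using lnx by linarith
    hence "S * \<bar>ln (1 - x) + x\<bar> \<le> S * (2 * (2 * M / S)^2)" using Sp by (intro mult_left_mono) auto
    also have "\<dots> = 8 * M^2 / S" using Sp by (simp add: power2_eq_square field_simps)
    finally show "S * \<bar>ln (1 - x) + x\<bar> \<le> 8 * M^2 / S" .
    have "g / u - g = g * ((1 - u) / u)" using u by (simp add: field_simps)
    hence "\<bar>g / u - g\<bar> = \<bar>g\<bar> * (\<bar>u - 1\<bar> / u)" using u by (simp add: abs_mult abs_minus_commute)
    also have "\<dots> \<le> M * (\<theta> / (1/2))"
      by (intro mult_mono gM frac_le) (use u M in auto)
    finally show "\<bar>g / u - g\<bar> \<le> 2 * M * \<theta>" by simp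
  qed
  finally show ?thesis unfolding S_def g_def .
qed

text \<open>A delta method: the expansion holds where the normalised U is at most M and qa is close
  to its mean, and Chebyshev bounds the complement. No fixed limit of r is involved, since the
  expansion is around the moving r n.\<close>

lemma clt_log_ratio:
  fixes P :: "nat \<Rightarrow> 'a pmf" and qa qb :: "nat \<Rightarrow> 'a \<Rightarrow> real" and e \<sigma> r t \<tau> :: "nat \<Rightarrow> real"
  assumes conv: "weak_conv_m (\<lambda>n. distr (measure_pmf (P n)) borel (\<lambda>x. (qa n x - exp (r n) * qb n x) / \<sigma> n)) N"
    and N: "real_distribution N"
    and ev: "\<forall>\<^sub>F n in sequentially. finite (set_pmf (P n)) \<and> e n > 0 \<and> \<sigma> n > 0 \<and> \<bar>r n\<bar> + 1 \<le> t n
       \<and> measure_pmf.expectation (P n) (\<lambda>x. ((qa n x - exp (r n) * qb n x) / \<sigma> n)^2) \<le> 1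
       \<and> measure_pmf.expectation (P n) (\<lambda>x. (qa n x / e n - 1)^2) \<le> \<tau> n
       \<and> (\<sigma> n)^2 \<le> \<tau> n * (e n)^2"
    and \<tau>: "\<tau> \<longlonglongrightarrow> 0"
  shows "weak_conv_m (\<lambda>n. distr (measure_pmf (P n)) borel (\<lambda>x. e n / \<sigma> n * (trunc_log_ratio (qa n x) (qb n x) (t n) - r n))) N"
proof (rule slutsky_pmf[OF conv N])
  fix \<delta> :: real assume \<delta>: "\<delta> > 0"
  let ?G = "\<lambda>n x. (qa n x - exp (r n) * qb n x) / \<sigma> n"
  let ?Y = "\<lambda>n x. e n / \<sigma> n * (trunc_log_ratio (qa n x) (qb n x) (t n) - r n)"
  let ?p = "\<lambda>n. measure_pmf.prob (P n) {x. \<bar>?Y n x - ?G n x\<bar> > \<delta>}"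
  show "?p \<longlonglongrightarrow> 0"
  proof (rule tendstoI)
    fix \<kappa> :: real assume \<kappa>: "\<kappa> > 0"
    \<comment> \<open>Chebyshev with second moment at most 1 leaves probability at most
      \<open>\<kappa>\<close> / 2 where the normalised U exceeds \<open>M\<close>.\<close>
    define M where "M = sqrt (2 / \<kappa>) + 1"
    have M: "M > 0" using \<kappa> by (simp add: M_def add_nonneg_pos)
    have M2: "1 / M^2 \<le> \<kappa> / 2"
    proof -
      have "(sqrt (2 / \<kappa>))^2 \<le> M^2" by (rule power_mono) (use \<kappa> in \<open>auto simp: M_def\<close>)
      hence "2 / \<kappa> \<le> M^2" using \<kappa> by simp
      thus ?thesis using \<kappa> M by (simp add: field_simps)
    qed
    \<comment> \<open>\<open>\<theta>\<close> and the \<open>S\<close> below make each of the two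
      errors of the expansion at most \<open>\<delta>\<close> / 2.\<close>
    define \<theta> where "\<theta> = min (1/2) (\<delta> / (4 * M))"
    have \<theta>: "\<theta> > 0" "\<theta> \<le> 1/2" using \<delta> M by (auto simp: \<theta>_def)
    have M\<theta>: "2 * M * \<theta> \<le> \<delta> / 2"
    proof -
      have "2 * M * \<theta> \<le> 2 * M * (\<delta> / (4 * M))" by (rule mult_left_mono) (use M in \<open>auto simp: \<theta>_def\<close>)
      thus ?thesis using M by simp
    qed
    define S where "S = max (8 * M) (16 * M^2 / \<delta>)"
    have Sp: "S > 0" using M by (simp add: S_def)
    have MS: "8 * M^2 / s \<le> \<delta> / 2" if "S \<le> s" for s
    proof -
      have "16 * M^2 / \<delta> \<le> s" using that by (simp add: S_def)
      moreover have "s > 0" using that Sp by linarith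
      ultimately show ?thesis using \<delta> by (simp add: field_simps)
    qed
    have e1: "\<forall>\<^sub>F n in sequentially. \<tau> n < \<kappa> / 4 * \<theta>^2"
      by (rule order_tendstoD(2)[OF \<tau>]) (use \<kappa> \<theta> in simp)
    have e2: "\<forall>\<^sub>F n in sequentially. \<tau> n < 1 / S^2"
      by (rule order_tendstoD(2)[OF \<tau>]) (use Sp in simp)
    show "\<forall>\<^sub>F n in sequentially. dist (?p n) 0 < \<kappa>"
      using ev e1 e2
    proof eventually_elim
      case (elim n)
      have pos: "e n > 0" "\<sigma> n > 0" and fin: "finite (set_pmf (P n))" using elim by auto
      have Se: "S \<le> e n / \<sigma> n"
      proof -
        have "(S * \<sigma> n)^2 \<le> (e n)^2"
        proof -
          have "\<tau> n * (e n)^2 \<le> 1 / S^2 * (e n)^2" by (rule mult_right_mono) (use elim in auto)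
          hence "(\<sigma> n)^2 \<le> 1 / S^2 * (e n)^2" using elim by linarith
          thus ?thesis using Sp by (simp add: power_mult_distrib field_simps)
        qed
        hence "S * \<sigma> n \<le> e n" by (rule power2_le_imp_le) (use pos in simp)
        thus ?thesis using pos by (simp add: le_divide_eq)
      qed
      have S8: "8 * M \<le> e n / \<sigma> n" using Se by (simp add: S_def)
      have sub: "{x. \<bar>?Y n x - ?G n x\<bar> > \<delta>} \<subseteq> {x. \<bar>?G n x\<bar> > M} \<union> {x. \<bar>qa n x / e n - 1\<bar> > \<theta>}"
      proof (rule ccontr)
        assume "\<not> ?thesis"
        then obtain x where x: "\<bar>?Y n x - ?G n x\<bar> > \<delta>" "\<bar>?G n x\<bar> \<le> M" "\<bar>qa n x / e n - 1\<bar> \<le> \<theta>" by fastforce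
        have "\<bar>?Y n x - ?G n x\<bar> \<le> 8 * M^2 / (e n / \<sigma> n) + 2 * M * \<theta>"
          by (rule trunc_log_ratio_expansion[OF pos M \<theta>(2) x(2,3) S8]) (use elim in simp)
        also have "\<dots> \<le> \<delta> / 2 + \<delta> / 2" by (rule add_mono[OF MS[OF Se] M\<theta>])
        finally show False using x(1) by simp
      qed
      have "?p n \<le> measure_pmf.prob (P n) ({x. \<bar>?G n x\<bar> > M} \<union> {x. \<bar>qa n x / e n - 1\<bar> > \<theta>})"
        by (rule measure_pmf.finite_measure_mono[OF sub]) simp
      also have "\<dots> \<le> measure_pmf.prob (P n) {x. \<bar>?G n x\<bar> > M} + measure_pmf.prob (P n) {x. \<bar>qa n x / e n - 1\<bar> > \<theta>}"
        by (rule measure_Un_le) auto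
      also have "\<dots> \<le> 1 / M^2 + \<tau> n / \<theta>^2"
        by (intro add_mono chebyshev_pmf fin M \<theta>(1)) (use elim in auto)
      also have "\<dots> < \<kappa> / 2 + \<kappa> / 2"
      proof (rule add_le_less_mono[OF M2])
        have "\<tau> n / \<theta>^2 < \<kappa> / 4" using elim \<theta> by (simp add: divide_less_eq)
        thus "\<tau> n / \<theta>^2 < \<kappa> / 2" using \<kappa> by linarith
      qed
      finally show ?case by (simp add: dist_real_def)
    qed
  qed
qed

context p1_small begin

lemma M1_pos: "M1 > 0"
  using h_pos m_ge_1 v_ge_1 unfolding M1_def by (intro mult_pos_pos) auto

lemma lin_var_pos: "lin_var > 0" using lin_var_ge M1_pos M_nonneg(2) by argo

definition U_var :: real where "U_var = EN (\<lambda>A. (Ustat n \<rho> A)^2)"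

lemma variance_U: "measure_pmf.variance NM (Ustat n \<rho>) = U_var"
  by (simp add: U_var_def EN_U)

text \<open>2 * (500 + 128) is rounded up to 2000, doubled by passing to \<open>Q0\<close>, and
  multiplied by 4 because \<open>Q0\<close> is at most twice the mean of \<open>Qa\<close>.\<close>

lemma U_var_le: "U_var \<le> 16000 * (\<tau> * (EN (Qa n))^2)"
proof -
  have "(Ustat n \<rho> A)^2 \<le> 2 * ((Ustat n \<rho> A - lin A)^2 + (lin A)^2)" for A
    using sum_list_squared_le[of "[Ustat n \<rho> A - lin A, lin A]"] by simp
  hence "U_var \<le> EN (\<lambda>A. 2 * ((Ustat n \<rho> A - lin A)^2 + (lin A)^2))" unfolding U_var_def by (rule EN_mono)
  also have "\<dots> = 2 * (EN (\<lambda>A. (Ustat n \<rho> A - lin A)^2) + lin_var)" by (simp add: EN_add lin_var_def)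
  also have "\<dots> \<le> 2 * (50000 * (\<tau> * (M1 + M2)) + 128 * (M1 + M2))"
    by (intro mult_left_mono add_mono U_minus_lin_le lin_var_le) auto
  also have "\<dots> \<le> 2 * (500 * (M1 + M2) + 128 * (M1 + M2))"
  proof -
    have "\<tau> * (M1 + M2) \<le> (1/100) * (M1 + M2)" by (rule mult_right_mono) (use tau in auto)
    thus ?thesis by simp
  qed
  also have "\<dots> \<le> 2000 * (M1 + M2)" using M_nonneg by simp
  also have "\<dots> \<le> 2000 * (\<tau> * Q0^2 + \<tau> * Q0^2)" by (intro mult_left_mono add_mono M1_le_Q0 M2_le_Q0) auto
  also have "\<dots> = 4000 * (\<tau> * Q0^2)" by simp
  also have "\<dots> \<le> 4000 * (\<tau> * (2 * EN (Qa n))^2)"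
  proof -
    have "Q0^2 \<le> (2 * EN (Qa n))^2" by (rule power_mono) (use Qa_mean_ge in \<open>auto simp: Q0_def\<close>)
    thus ?thesis by (intro mult_left_mono) auto
  qed
  also have "\<dots> = 16000 * (\<tau> * (EN (Qa n))^2)" by (simp add: power_mult_distrib)
  finally show ?thesis .
qed

lemma Q0_pos: "Q0 > 0" using h_pos m_ge_1 v_ge_1 unfolding Q0_def by (intro mult_pos_pos) auto
lemma Qa_mean_pos: "EN (Qa n) > 0" using Q0_pos Qa_mean_ge by linarith

lemma Qa_relative: "EN (\<lambda>A. (Qa n A / EN (Qa n) - 1)^2) \<le> 160000 * \<tau>"
proof -
  let ?e = "EN (Qa n)"
  have "EN (\<lambda>A. (Qa n A / ?e - 1)^2) = EN (\<lambda>A. (Qa n A - ?e)^2 / ?e^2)"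
    by (intro arg_cong[where f=EN] ext) (use Qa_mean_pos in \<open>simp add: power_divide[symmetric] diff_divide_distrib\<close>)
  also have "\<dots> = EN (\<lambda>A. (Qa n A - ?e)^2) / ?e^2" by simp
  also have "\<dots> \<le> 160000 * \<tau>"
  proof -
    have "Q0^2 \<le> (2 * ?e)^2" by (rule power_mono) (use Qa_mean_ge in \<open>auto simp: Q0_def\<close>)
    hence "40000 * (\<tau> * Q0^2) \<le> 40000 * (\<tau> * (2 * ?e)^2)" by (intro mult_left_mono) auto
    hence "EN (\<lambda>A. (Qa n A - ?e)^2) \<le> 160000 * \<tau> * ?e^2" using Qa_variance_le by (simp add: power_mult_distrib)
    thus ?thesis using Qa_mean_pos by (simp add: divide_le_eq)
  qed
  finally show ?thesis .
qed

text \<open>Below the threshold the error 50000 \<open>\<tau>\<close> (M1 + M2) is at most (M1 + M2)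
  / 20 <= \<open>lin_var\<close> / 4 and can be absorbed on the left. This is where one millionth
  comes from.\<close>

lemma lin_var_le_U_var:
  assumes "\<tau> \<le> 1/1000000"
  shows "lin_var \<le> 4 * U_var"
proof -
  have "(lin A)^2 \<le> 2 * ((Ustat n \<rho> A - lin A)^2 + (Ustat n \<rho> A)^2)" for A
    using sum_list_squared_le[of "[- (Ustat n \<rho> A - lin A), Ustat n \<rho> A]"] by (simp add: power2_commute)
  hence "lin_var \<le> EN (\<lambda>A. 2 * ((Ustat n \<rho> A - lin A)^2 + (Ustat n \<rho> A)^2))" unfolding lin_var_def by (rule EN_mono)
  also have "\<dots> = 2 * (EN (\<lambda>A. (Ustat n \<rho> A - lin A)^2) + U_var)" by (simp add: EN_add U_var_def)
  finally have 1: "lin_var \<le> 2 * (EN (\<lambda>A. (Ustat n \<rho> A - lin A)^2) + U_var)" .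
  have "\<tau> * (M1 + M2) \<le> (1/1000000) * (M1 + M2)" by (rule mult_right_mono) (use assms in auto)
  hence "50000 * (\<tau> * (M1 + M2)) \<le> (1/20) * (M1 + M2)" by simp
  hence "EN (\<lambda>A. (Ustat n \<rho> A - lin A)^2) \<le> (1/4) * lin_var" using U_minus_lin_le lin_var_ge by argo
  thus ?thesis using 1 by argo
qed

text \<open>No estimate of \<open>\<sigma> - \<sigma>1\<close> enters, only
  \<open>\<sigma>1 \<le> 2 * \<sigma>\<close>. After normalisation the squared distance is 2 - 2 c /
  (\<open>\<sigma>\<close> \<open>\<sigma>1\<close>); multiplied by \<open>\<sigma>\<close>
  \<open>\<sigma>1\<close> it is at most E(U - lin)^2, because twice a product is at most the sum of
  squares.\<close>

lemma normalized_diff: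
  assumes "\<tau> \<le> 1/1000000"
  shows "EN (\<lambda>A. (Ustat n \<rho> A / sqrt U_var - lin A / sqrt lin_var)^2) \<le> 500000 * \<tau>"
proof -
  define \<sigma> where "\<sigma> = sqrt U_var"
  define \<sigma>1 where "\<sigma>1 = sqrt lin_var"
  have U_var_pos: "U_var > 0" using lin_var_le_U_var[OF assms] lin_var_pos by argo
  have pos: "\<sigma> > 0" "\<sigma>1 > 0" using U_var_pos lin_var_pos by (simp_all add: \<sigma>_def \<sigma>1_def)
  have sq: "\<sigma>^2 = U_var" "\<sigma>1^2 = lin_var" using U_var_pos lin_var_pos by (simp_all add: \<sigma>_def \<sigma>1_def)
  define c where "c = EN (\<lambda>A. Ustat n \<rho> A * lin A)"
  let ?\<Delta> = "EN (\<lambda>A. (Ustat n \<rho> A - lin A)^2)"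
  have "(Ustat n \<rho> A - lin A)^2 = ((Ustat n \<rho> A)^2 + (lin A)^2) - 2 * (Ustat n \<rho> A * lin A)" for A
    by (simp add: power2_diff)
  hence \<Delta>: "?\<Delta> = U_var + lin_var - 2 * c"
    by (simp add: EN_add EN_diff U_var_def lin_var_def c_def)
  have "(Ustat n \<rho> A / \<sigma> - lin A / \<sigma>1)^2 = ((Ustat n \<rho> A)^2 / U_var + (lin A)^2 / lin_var) - 2 * ((Ustat n \<rho> A * lin A) / (\<sigma> * \<sigma>1))" for A
    by (simp add: power2_diff power_divide sq)
  hence "EN (\<lambda>A. (Ustat n \<rho> A / \<sigma> - lin A / \<sigma>1)^2) = U_var / U_var + lin_var / lin_var - 2 * (c / (\<sigma> * \<sigma>1))"
    by (simp add: EN_add EN_diff U_var_def lin_var_def c_def)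
  hence e: "EN (\<lambda>A. (Ustat n \<rho> A / \<sigma> - lin A / \<sigma>1)^2) = 2 - 2 * (c / (\<sigma> * \<sigma>1))"
    using U_var_pos lin_var_pos by simp
  have "2 * (\<sigma> * \<sigma>1) \<le> U_var + lin_var" using sum_squares_bound[of \<sigma> \<sigma>1] by (simp add: sq)
  hence "2 * (\<sigma> * \<sigma>1) - 2 * c \<le> ?\<Delta>" unfolding \<Delta> by simp
  moreover have "(2 - 2 * (c / (\<sigma> * \<sigma>1))) * (\<sigma> * \<sigma>1) = 2 * (\<sigma> * \<sigma>1) - 2 * c"
    using pos by (simp add: field_simps)
  ultimately have b: "(2 - 2 * (c / (\<sigma> * \<sigma>1))) * (\<sigma> * \<sigma>1) \<le> ?\<Delta>" by simp
  have "\<sigma>1^2 \<le> (2 * \<sigma>)^2" using lin_var_le_U_var[OF assms] by (simp add: sq power_mult_distrib)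
  hence "\<sigma>1 \<le> 2 * \<sigma>" by (rule power2_le_imp_le) (use pos in simp)
  hence "\<sigma>1 * \<sigma>1 \<le> (2 * \<sigma>) * \<sigma>1" by (rule mult_right_mono) (use pos in simp)
  hence s: "lin_var \<le> 2 * (\<sigma> * \<sigma>1)" using sq(2) by (simp add: power2_eq_square)
  have "?\<Delta> \<le> 50000 * (\<tau> * (M1 + M2))" by (rule U_minus_lin_le)
  also have "\<dots> \<le> 50000 * (\<tau> * (5 * lin_var))" by (intro mult_left_mono lin_var_ge) auto
  also have "\<dots> \<le> 50000 * (\<tau> * (5 * (2 * (\<sigma> * \<sigma>1))))" by (intro mult_left_mono s) auto
  finally have "(2 - 2 * (c / (\<sigma> * \<sigma>1))) * (\<sigma> * \<sigma>1) \<le> (500000 * \<tau>) * (\<sigma> * \<sigma>1)" using b by simp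
  hence "2 - 2 * (c / (\<sigma> * \<sigma>1)) \<le> 500000 * \<tau>" by (rule mult_right_le_imp_le) (use pos in simp)
  thus ?thesis using e unfolding \<sigma>_def \<sigma>1_def by simp
qed

lemma xi_normalized_bound:
  assumes "d \<in> ordered_pairs n"
  shows "\<bar>xi d s / sqrt lin_var\<bar> \<le> 30 * sqrt \<tau>"
proof -
  \<comment> \<open>The 5 of \<open>lin_var_ge\<close> is enlarged to the square 9, so that the root
    is 3 and the constant 30.\<close>
  have "\<tau> * (M1 + M2) \<le> \<tau> * (9 * lin_var)" using lin_var_ge lin_var_pos by (intro mult_left_mono) auto
  hence "sqrt (\<tau> * (M1 + M2)) \<le> sqrt (9 * (\<tau> * lin_var))" by simp
  also have "\<dots> = 3 * (sqrt \<tau> * sqrt lin_var)" by (simp add: real_sqrt_mult)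
  finally have "\<bar>xi d s\<bar> \<le> 30 * sqrt \<tau> * sqrt lin_var" using xi_bound[OF assms, of s] by simp
  thus ?thesis using lin_var_pos by (simp add: divide_le_eq)
qed

text \<open>Keeps rho inside the truncation range with room 1. Since h <= n ex and h is large, a
  ex^2 <= \<open>\<tau>\<close> forces 3 exp rho <= n^2; since h <= n and a h^2 is large, 3 <= n^2
  exp rho. The spare factor 3 >= e provides the room.\<close>

lemma rho_bound: "\<bar>\<rho>\<bar> + 1 \<le> 2 * ln (real n)"
proof -
  define N where "N = real n"
  have N: "N > 0" using n_pos by (simp add: N_def)
  have hN: "h \<le> N * ex"
  proof -
    have "h \<le> (\<Sum>i<n. ex)" unfolding h_def by (rule sum_mono) (auto simp: eta_le)
    thus ?thesis by (simp add: N_def)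
  qed
  have e1: "exp (1::real) \<le> 3" by (rule exp_le)
  have i3: "3 * \<tau> \<le> 1" using tau by simp
  have up: "a * exp 1 \<le> N^2"
  proof -
    have "1 \<le> \<tau> * (N * ex)" using h_ge mult_left_mono[OF hN tau_nonneg(1)] by linarith
    hence "1 * 1 \<le> (\<tau> * (N * ex)) * (\<tau> * (N * ex))" by (intro mult_mono) auto
    hence "a * 1 \<le> a * ((\<tau> * (N * ex)) * (\<tau> * (N * ex)))" by (intro mult_left_mono) auto
    also have "\<dots> = (a * ex^2) * (\<tau>^2 * N^2)" by (simp add: power2_eq_square mult_ac)
    also have "\<dots> \<le> \<tau> * (1 * N^2)"
      by (intro mult_mono aex) (use power_le_one[of \<tau> 2] in auto)
    finally have "a * 3 \<le> (\<tau> * N^2) * 3" by simp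
    also have "\<dots> \<le> N^2" using mult_right_mono[OF i3, of "N^2"] by simp
    finally have "a * 3 \<le> N^2" .
    with mult_left_mono[OF e1, of a] show ?thesis by (rule order_trans) simp
  qed
  have dn: "exp 1 \<le> a * N^2"
  proof -
    have "h^2 \<le> (N * ex)^2" by (rule power_mono[OF hN]) simp
    also have "\<dots> = N^2 * ex^2" by (simp add: power_mult_distrib)
    also have "\<dots> \<le> N^2 * 1" by (intro mult_left_mono) (use ex_sq_le_tau tau in auto)
    finally have "h^2 \<le> N^2" by simp
    hence "\<tau> * (a * h^2) \<le> \<tau> * (a * N^2)" by (intro mult_left_mono) auto
    hence "1 \<le> \<tau> * (a * N^2)" using ah_ge by linarith
    hence "3 \<le> 3 * \<tau> * (a * N^2)" by simp
    also have "\<dots> \<le> a * N^2" using mult_right_mono[OF i3, of "a * N^2"] by simp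
    finally show ?thesis using e1 by linarith
  qed
  have an: "a \<noteq> 0" using a_pos by (metis less_irrefl)
  have la: "ln a = \<rho>" by (simp add: a_def)
  have lN: "ln (N^2) = 2 * ln N" using N by (simp add: ln_realpow)
  have "ln (a * exp 1) \<le> ln (N^2)" using up N by (subst ln_le_cancel_iff) auto
  hence 1: "\<rho> + 1 \<le> 2 * ln N" by (simp add: ln_mult an la lN)
  have "ln (exp 1) \<le> ln (a * N^2)" using dn N by (subst ln_le_cancel_iff) auto
  hence 2: "1 \<le> \<rho> + 2 * ln N" using N by (simp add: ln_mult an la lN)
  show ?thesis using 1 2 unfolding N_def by linarith
qed

end

section \<open>The limit theorem\<close>

theorem theorem5:
  fixes \<rho> \<gamma> :: "nat \<Rightarrow> real" and \<alpha> \<beta> :: "nat \<Rightarrow> nat \<Rightarrow> real"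
    and \<mu> \<nu> \<eta> :: "nat \<Rightarrow> nat \<Rightarrow> real"
  assumes sum_\<alpha>: "\<And>n. (\<Sum>i<n. \<alpha> n i) = 0"
    and sum_\<beta>: "\<And>n. (\<Sum>i<n. \<beta> n i) = 0"
    and \<mu>_def: "\<And>n i. \<mu> n i = exp (\<gamma> n / 2 + \<alpha> n i)"
    and \<nu>_def: "\<And>n i. \<nu> n i = exp (\<gamma> n / 2 + \<beta> n i)"
    and \<eta>_def: "\<And>n i. \<eta> n i = \<mu> n i * \<nu> n i"
    (* (G1) *)
    and G1a: "(\<lambda>n. Max (\<mu> n ` {..<n})) \<longlonglongrightarrow> 0"
    and G1b: "(\<lambda>n. Max (\<nu> n ` {..<n})) \<longlonglongrightarrow> 0"
    and G1c: "(\<lambda>n. exp (\<rho> n / 2) * Max (\<eta> n ` {..<n})) \<longlonglongrightarrow> 0"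
    (* (G2) *)
    and G2a: "filterlim (\<lambda>n. exp (\<rho> n / 2) * (\<Sum>i<n. \<eta> n i)) at_top sequentially"
    and G2b: "filterlim (\<lambda>n. (\<Sum>i<n. \<eta> n i)) at_top sequentially"
    (* (SP1) *)
    and SP1: "(\<lambda>n. (Max (\<mu> n ` {..<n}))\<^sup>2 * (Max (\<nu> n ` {..<n}))\<^sup>2
                 / ((\<Sum>i<n. \<mu> n i * \<eta> n i) * (\<Sum>i<n. \<nu> n i * \<eta> n i))) \<longlonglongrightarrow> 0"
    (* (SP2), required only in Case (L) *)
    and SP2: "(\<exists>C>0. \<forall>\<^sub>F n in sequentially.
                 exp (\<rho> n) \<ge> C * exp (ln ((\<Sum>i<n. \<eta> n i)\<^sup>2
                     / ((\<Sum>i<n. \<mu> n i * \<eta> n i) * (\<Sum>i<n. \<nu> n i * \<eta> n i)))))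
              \<longrightarrow> (\<exists>c0 c1. 0 < c0 \<and> c0 < c1 \<and> (\<forall>\<^sub>F n in sequentially.
                     c0 \<le> (\<Sum>i<n. \<mu> n i) / (\<Sum>i<n. \<nu> n i)
                   \<and> (\<Sum>i<n. \<mu> n i) / (\<Sum>i<n. \<nu> n i) \<le> c1))"
  shows "(weak_conv_m
           (\<lambda>n. distr (measure_pmf (p1_pmf n (\<rho> n) (\<gamma> n) (\<alpha> n) (\<beta> n))) borel
              (\<lambda>A. Ustat n (\<rho> n) A
                   / sqrt (measure_pmf.variance (p1_pmf n (\<rho> n) (\<gamma> n) (\<alpha> n) (\<beta> n))
                             (Ustat n (\<rho> n)))))
           std_normal_distribution) \<and>
        (weak_conv_m
           (\<lambda>n. distr (measure_pmf (p1_pmf n (\<rho> n) (\<gamma> n) (\<alpha> n) (\<beta> n))) borel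
              (\<lambda>A. measure_pmf.expectation (p1_pmf n (\<rho> n) (\<gamma> n) (\<alpha> n) (\<beta> n)) (Qa n)
                   / sqrt (measure_pmf.variance (p1_pmf n (\<rho> n) (\<gamma> n) (\<alpha> n) (\<beta> n))
                             (Ustat n (\<rho> n)))
                   * (rho_hat n A - \<rho> n)))
           std_normal_distribution)"
proof -
  define mx where "mx n = Max (\<mu> n ` {..<n})" for n
  define nx where "nx n = Max (\<nu> n ` {..<n})" for n
  define ex where "ex n = Max (\<eta> n ` {..<n})" for n
  define A where "A n = exp (\<rho> n)" for n
  define H where "H n = (\<Sum>i<n. \<eta> n i)" for n
  define PP where "PP n = (\<Sum>i<n. \<mu> n i * \<eta> n i)" for n
  define QQ where "QQ n = (\<Sum>i<n. \<nu> n i * \<eta> n i)" for n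
  \<comment> \<open>The sum of all quantities that the hypotheses send to 0: it tends to 0 and, the
    terms being nonnegative for n > 0, dominates each of them.\<close>
  define \<tau> where "\<tau> n = mx n + nx n + A n * (ex n)\<^sup>2 + 1 / H n + 1 / (A n * (H n)\<^sup>2)
     + (mx n)\<^sup>2 * (nx n)\<^sup>2 / (PP n * QQ n)" for n
  have pos: "\<mu> n i > 0" "\<nu> n i > 0" "\<eta> n i > 0" for n i
    by (simp_all add: \<mu>_def \<nu>_def \<eta>_def)
  have le: "\<mu> n i \<le> mx n" "\<nu> n i \<le> nx n" "\<eta> n i \<le> ex n" if "i < n" for n i
    unfolding mx_def nx_def ex_def using that by (auto intro!: Max_ge)
  have A_pos: "A n > 0" for n by (simp add: A_def)
  have npos: "mx n > 0" "nx n > 0" "ex n > 0" "H n > 0" "PP n > 0" "QQ n > 0" if "n > 0" for n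
  proof -
    show "mx n > 0" "nx n > 0" "ex n > 0" using le[OF that] pos[of n 0] by linarith+
    have "{..<n} \<noteq> {}" using that by auto
    thus "H n > 0" "PP n > 0" "QQ n > 0"
      unfolding H_def PP_def QQ_def by (auto intro!: sum_pos mult_pos_pos pos)
  qed
  have expA: "(exp (\<rho> n / 2))\<^sup>2 = A n" for n
    by (simp add: A_def power2_eq_square exp_add[symmetric])
  have \<tau>_lim: "\<tau> \<longlonglongrightarrow> 0"
  proof -
    have 1: "(\<lambda>n. A n * (ex n)\<^sup>2) \<longlonglongrightarrow> 0"
    proof -
      have "(\<lambda>n. (exp (\<rho> n / 2) * ex n)\<^sup>2) \<longlonglongrightarrow> 0\<^sup>2"
        using G1c unfolding ex_def by (rule tendsto_power)
      moreover have "(exp (\<rho> n / 2) * ex n)\<^sup>2 = A n * (ex n)\<^sup>2" for n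
        by (simp add: power_mult_distrib expA)
      ultimately show ?thesis by simp
    qed
    have 2: "(\<lambda>n. 1 / H n) \<longlonglongrightarrow> 0"
      using tendsto_inverse_0_at_top[OF G2b] by (simp add: H_def divide_inverse)
    have 3: "(\<lambda>n. 1 / (A n * (H n)\<^sup>2)) \<longlonglongrightarrow> 0"
    proof -
      have "(\<lambda>n. (inverse (exp (\<rho> n / 2) * H n))\<^sup>2) \<longlonglongrightarrow> 0\<^sup>2"
        using tendsto_inverse_0_at_top[OF G2a] unfolding H_def by (rule tendsto_power)
      moreover have "(inverse (exp (\<rho> n / 2) * H n))\<^sup>2 = 1 / (A n * (H n)\<^sup>2)" for n
        by (simp add: power_divide power_mult_distrib expA inverse_eq_divide)
      ultimately show ?thesis by (simp only: zero_power2)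
    qed
    have "\<tau> \<longlonglongrightarrow> 0 + 0 + 0 + 0 + 0 + 0"
      unfolding \<tau>_def[abs_def]
      by (intro tendsto_add 1 2 3) (use G1a G1b SP1 in \<open>simp_all add: mx_def nx_def PP_def QQ_def\<close>)
    thus ?thesis by simp
  qed
  have model: "p1_model.mu (\<gamma> n) (\<alpha> n) = \<mu> n" "p1_model.nu (\<gamma> n) (\<beta> n) = \<nu> n"
    "p1_model.eta (\<gamma> n) (\<alpha> n) (\<beta> n) = \<eta> n" for n
    by (simp_all add: fun_eq_iff p1_model.mu_def p1_model.nu_def p1_model.eta_def \<mu>_def \<nu>_def \<eta>_def)
  have model': "p1_model.a (\<rho> n) = A n" "p1_model.h n (\<gamma> n) (\<alpha> n) (\<beta> n) = H n"
    "p1_model.p n (\<gamma> n) (\<alpha> n) (\<beta> n) = PP n" "p1_model.q n (\<gamma> n) (\<alpha> n) (\<beta> n) = QQ n" for n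
    by (simp_all add: p1_model.a_def p1_model.h_def p1_model.p_def p1_model.q_def model A_def H_def PP_def QQ_def)
  \<comment> \<open>One millionth is the threshold of \<open>lin_var_le_U_var\<close>. Positivity of
    \<open>n\<close> ensures that the maxima are taken over nonempty sets.\<close>
  have small: "\<forall>\<^sub>F n in sequentially.
      p1_small n (\<rho> n) (\<gamma> n) (\<alpha> n) (\<beta> n) (mx n) (nx n) (ex n) (\<tau> n) \<and> \<tau> n \<le> 1/1000000"
    using order_tendstoD(2)[OF \<tau>_lim, of "1/1000000", simplified] eventually_gt_at_top[of 0]
  proof eventually_elim
    case (elim n)
    note np = npos[OF elim(2)]
    have parts: "mx n \<le> \<tau> n" "nx n \<le> \<tau> n" "A n * (ex n)\<^sup>2 \<le> \<tau> n" "1 / H n \<le> \<tau> n" "1 / (A n * (H n)\<^sup>2) \<le> \<tau> n"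
      "(mx n)\<^sup>2 * (nx n)\<^sup>2 / (PP n * QQ n) \<le> \<tau> n"
    proof -
      have "mx n \<ge> 0" "nx n \<ge> 0" "A n * (ex n)\<^sup>2 \<ge> 0" "1 / H n \<ge> 0" "1 / (A n * (H n)\<^sup>2) \<ge> 0"
        "(mx n)\<^sup>2 * (nx n)\<^sup>2 / (PP n * QQ n) \<ge> 0"
        using np A_pos[of n] by (auto intro!: divide_nonneg_nonneg mult_nonneg_nonneg less_imp_le)
      thus "mx n \<le> \<tau> n" "nx n \<le> \<tau> n" "A n * (ex n)\<^sup>2 \<le> \<tau> n" "1 / H n \<le> \<tau> n" "1 / (A n * (H n)\<^sup>2) \<le> \<tau> n"
        "(mx n)\<^sup>2 * (nx n)\<^sup>2 / (PP n * QQ n) \<le> \<tau> n"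
        unfolding \<tau>_def by linarith+
    qed
    have "p1_small n (\<rho> n) (\<gamma> n) (\<alpha> n) (\<beta> n) (mx n) (nx n) (ex n) (\<tau> n)"
    proof (unfold_locales, unfold model model')
      show "0 < \<tau> n" using parts(1) np by linarith
      show "\<tau> n \<le> 1 / 100" using elim by simp
      show "ex n \<le> mx n * nx n" unfolding ex_def
      proof (rule Max.boundedI)
        fix y assume "y \<in> \<eta> n ` {..<n}"
        then obtain i where i: "i < n" "y = \<mu> n i * \<nu> n i" by (auto simp: \<eta>_def)
        show "y \<le> mx n * nx n" unfolding i(2)
          using pos[of n i] np by (intro mult_mono le i) auto
      qed (use elim in auto)
      show "1 \<le> \<tau> n * H n" using parts(4) np by (simp add: divide_le_eq)
      show "1 \<le> \<tau> n * (A n * (H n)\<^sup>2)" using parts(5) np A_pos[of n] by (simp add: divide_le_eq)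
      show "(mx n)\<^sup>2 * (nx n)\<^sup>2 \<le> \<tau> n * (PP n * QQ n)" using parts(6) np by (simp add: divide_le_eq)
    qed (use le parts in auto)
    thus ?case using elim by simp
  qed
  define P where "P n = p1_pmf n (\<rho> n) (\<gamma> n) (\<alpha> n) (\<beta> n)" for n
  define \<sigma> where "\<sigma> n = sqrt (measure_pmf.variance (P n) (Ustat n (\<rho> n)))" for n
  define e where "e n = measure_pmf.expectation (P n) (Qa n)" for n
  define L where "L n = p1_model.lin n (\<rho> n) (\<gamma> n) (\<alpha> n) (\<beta> n)" for n
  define s where "s n = sqrt (p1_model.lin_var n (\<rho> n) (\<gamma> n) (\<alpha> n) (\<beta> n))" for n
  define D where "D n = p1_model.dlaw (\<rho> n) (\<gamma> n) (\<alpha> n) (\<beta> n)" for n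
  define X where "X n = p1_model.xi n (\<rho> n) (\<gamma> n) (\<alpha> n) (\<beta> n)" for n
  \<comment> \<open>The locale \<open>p1_small\<close> is available only for large \<open>n\<close>,
    one \<open>n\<close> at a time; its results are exported here under one eventuality, in terms
    that make sense for every \<open>n\<close>.\<close>
  have facts: "\<forall>\<^sub>F n in sequentially. finite (set_pmf (P n)) \<and> e n > 0 \<and> \<sigma> n > 0 \<and> \<bar>\<rho> n\<bar> + 1 \<le> 2 * ln (real n)
       \<and> measure_pmf.expectation (P n) (\<lambda>x. (Ustat n (\<rho> n) x / \<sigma> n)\<^sup>2) \<le> 1
       \<and> measure_pmf.expectation (P n) (\<lambda>x. (Qa n x / e n - 1)\<^sup>2) \<le> 160000 * \<tau> n
       \<and> (\<sigma> n)\<^sup>2 \<le> 160000 * \<tau> n * (e n)\<^sup>2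
       \<and> measure_pmf.expectation (P n) (\<lambda>x. (Ustat n (\<rho> n) x / \<sigma> n - L n x / s n)\<^sup>2) \<le> 500000 * \<tau> n
       \<and> (\<forall>d\<in>ordered_pairs n. measure_pmf.expectation (D n d) (\<lambda>y. X n d y / s n) = 0 \<and> (\<forall>y. \<bar>X n d y / s n\<bar> \<le> 30 * sqrt (\<tau> n)))
       \<and> (\<Sum>d\<in>ordered_pairs n. measure_pmf.expectation (D n d) (\<lambda>y. (X n d y / s n)\<^sup>2)) = 1"
    using small
  proof eventually_elim
    case (elim n)
    interpret p1_small n "\<rho> n" "\<gamma> n" "\<alpha> n" "\<beta> n" "mx n" "nx n" "ex n" "\<tau> n" using elim by simp
    have t: "\<tau> n \<le> 1/1000000" using elim by simp
    have PN: "P n = NM" by (simp add: P_def p1_pmf_eq)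
    have U_var_pos: "U_var > 0" using lin_var_le_U_var[OF t] lin_var_pos by argo
    have sg: "\<sigma> n = sqrt U_var" unfolding \<sigma>_def PN variance_U ..
    have sn: "s n = sqrt lin_var" by (simp add: s_def)
    have Ls: "L n = lin" by (simp add: L_def)
    have DX: "D n = dlaw" "X n = xi" by (simp_all add: D_def X_def)
    have en: "e n = EN (Qa n)" by (simp add: e_def PN)
    have s2: "(sqrt lin_var)\<^sup>2 = lin_var" using lin_var_pos by simp
    show ?case unfolding PN sg sn Ls en DX
    proof (intro conjI ballI allI)
      show "finite (set_pmf NM)" by (rule finite_set_NM)
      show "EN (Qa n) > 0" by (rule Qa_mean_pos)
      show "0 < sqrt U_var" using U_var_pos by simp
      show "\<bar>\<rho> n\<bar> + 1 \<le> 2 * ln (real n)" by (rule rho_bound)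
      show "EN (\<lambda>x. (Ustat n (\<rho> n) x / sqrt U_var)\<^sup>2) \<le> 1"
        using U_var_pos by (simp add: power_divide U_var_def[symmetric])
      show "EN (\<lambda>x. (Qa n x / EN (Qa n) - 1)\<^sup>2) \<le> 160000 * \<tau> n" by (rule Qa_relative)
      \<comment> \<open>The constant is raised to 160000 so that one null sequence serves this bound
        and the one for Qa divided by its mean, as \<open>clt_log_ratio\<close> expects.\<close>
      have "16000 * (\<tau> n * (EN (Qa n))\<^sup>2) \<le> 160000 * (\<tau> n * (EN (Qa n))\<^sup>2)" by (rule mult_right_mono) auto
      thus "(sqrt U_var)\<^sup>2 \<le> 160000 * \<tau> n * (EN (Qa n))\<^sup>2" using U_var_le U_var_pos by simp
      show "EN (\<lambda>x. (Ustat n (\<rho> n) x / sqrt U_var - lin x / sqrt lin_var)\<^sup>2) \<le> 500000 * \<tau> n"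
        by (rule normalized_diff[OF t])
      show "Ed d (\<lambda>y. xi d y / sqrt lin_var) = 0" for d by (simp add: Ed_xi)
      show "\<bar>xi d y / sqrt lin_var\<bar> \<le> 30 * sqrt (\<tau> n)" if "d \<in> ordered_pairs n" for d y
        by (rule xi_normalized_bound[OF that])
      have "(\<Sum>d\<in>ordered_pairs n. Ed d (\<lambda>y. (xi d y / sqrt lin_var)\<^sup>2)) = (\<Sum>d\<in>ordered_pairs n. Ed d (\<lambda>y. (xi d y)\<^sup>2)) / lin_var"
        by (simp add: power_divide s2 sum_divide_distrib)
      thus "(\<Sum>d\<in>ordered_pairs n. Ed d (\<lambda>y. (xi d y / sqrt lin_var)\<^sup>2)) = 1"
        using lin_var_pos by (simp add: lin_var_eq[symmetric])
    qed
  qed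
  have "weak_conv_m (\<lambda>n. distr (measure_pmf (Pi_pmf (ordered_pairs n) (False, False) (D n))) borel
          (\<lambda>f. \<Sum>d\<in>ordered_pairs n. X n d (f d) / s n)) std_normal_distribution"
  proof (rule clt_Pi_pmf[where \<epsilon>="\<lambda>n. 30 * sqrt (\<tau> n)"])
    show "(\<lambda>n. 30 * sqrt (\<tau> n)) \<longlonglongrightarrow> 0"
      by (auto intro!: tendsto_eq_intros \<tau>_lim)
  qed (use facts in \<open>auto elim!: eventually_mono\<close>)
  \<comment> \<open>\<open>p1_model\<close> carries no assumptions, so this equality of laws holds
    for every \<open>n\<close> and can be rewritten inside the sequence.\<close>
  moreover have "distr (measure_pmf (Pi_pmf (ordered_pairs n) (False, False) (D n))) borel
          (\<lambda>f. \<Sum>d\<in>ordered_pairs n. X n d (f d) / s n)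
     = distr (measure_pmf (P n)) borel (\<lambda>x. L n x / s n)" for n
  proof -
    interpret p1_model n "\<rho> n" "\<gamma> n" "\<alpha> n" "\<beta> n" .
    have "P n = map_pmf adjacency (Pi_pmf (ordered_pairs n) (False, False) (D n))"
      by (simp add: P_def p1_pmf_eq NM_def PM_def D_def)
    thus ?thesis
      by (simp add: map_pmf_rep_eq distr_distr o_def L_def lin_adjacency X_def sum_divide_distrib)
  qed
  ultimately have clt: "weak_conv_m (\<lambda>n. distr (measure_pmf (P n)) borel (\<lambda>x. L n x / s n)) std_normal_distribution"
    by simp
  have U: "weak_conv_m (\<lambda>n. distr (measure_pmf (P n)) borel (\<lambda>x. Ustat n (\<rho> n) x / \<sigma> n)) std_normal_distribution"
  \<comment> \<open>The mean square distance 500000 \<open>\<tau> n\<close> between the two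
    normalised statistics and Chebyshev transfer the limit from the linear statistic to U.\<close>
  proof (rule slutsky_pmf[OF clt real_dist_normal_dist])
    fix \<delta> :: real assume \<delta>: "\<delta> > 0"
    show "(\<lambda>n. measure_pmf.prob (P n) {x. \<bar>Ustat n (\<rho> n) x / \<sigma> n - L n x / s n\<bar> > \<delta>}) \<longlonglongrightarrow> 0"
    proof (rule Lim_null_comparison)
      show "\<forall>\<^sub>F n in sequentially. norm (measure_pmf.prob (P n) {x. \<bar>Ustat n (\<rho> n) x / \<sigma> n - L n x / s n\<bar> > \<delta>})
          \<le> 500000 * \<tau> n / \<delta>\<^sup>2"
        using facts by eventually_elim (simp, rule chebyshev_pmf[OF _ \<delta>], auto)
      show "(\<lambda>n. 500000 * \<tau> n / \<delta>\<^sup>2) \<longlonglongrightarrow> 0"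
        using \<delta> by (auto intro!: tendsto_eq_intros \<tau>_lim)
    qed
  qed
  have "weak_conv_m (\<lambda>n. distr (measure_pmf (P n)) borel
      (\<lambda>x. e n / \<sigma> n * (trunc_log_ratio (Qa n x) (Qb n x) (2 * ln (real n)) - \<rho> n))) std_normal_distribution"
  proof (rule clt_log_ratio[OF _ real_dist_normal_dist, where \<tau>="\<lambda>n. 160000 * \<tau> n"])
    show "weak_conv_m (\<lambda>n. distr (measure_pmf (P n)) borel (\<lambda>x. (Qa n x - exp (\<rho> n) * Qb n x) / \<sigma> n)) std_normal_distribution"
      using U by (simp add: Ustat_def)
    show "(\<lambda>n. 160000 * \<tau> n) \<longlonglongrightarrow> 0" by (auto intro!: tendsto_eq_intros \<tau>_lim)
  qed (use facts in \<open>auto elim!: eventually_mono simp: Ustat_def\<close>)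
  thus ?thesis using U by (simp add: P_def \<sigma>_def e_def rho_hat_def)
qed

end
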